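(* Fix $\alpha\in(0,\pi)$ and $N\ge1$. For any $R\in(0,\frac12]$ and $C_0>0$ there exists a constant $C_1>0$ such that the following holds. Let $a\in A_N$ with $\rho(a)\ge R$ and $d\in\{\pm1\}^N$, and set $\Gamma=\sum_{n=1}^N(d_n-\cos\alpha)^2$. Suppose $\epsilon\in(0,\frac12]$ with $\delta=\epsilon\log\frac1\epsilon\le R$, and $m\in M(a,d)$ satisfies \[ E_\epsilon(m)\le\frac{\pi\Gamma}{2\log\frac1\delta}+\frac{C_0}{(\log\frac1\delta)^2}. \] Let $u=U(m)$. Then \[ \int_{\Omega_\delta(a)}\Big|\nabla u-\frac{\nabla u^*_{a,d}}{\log\frac1\delta}\Big|^2dx\le\frac{C_1}{(\log\frac1\delta)^2} \quad\text{and}\quad \int_{\Omega_\delta(a)}|\nabla u|^2dx\ge\frac{\pi\Gamma}{\log\frac1\delta}-\frac{C_1}{(\log\frac1\delta)^2}. \]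
   Context: For $m=(m_1,m_2)\in W^{1,2}((-1,1);\mathbb{S}^1)$ with $m_1(\pm1)=\cos\alpha$, extend $m_1$ by $\cos\alpha$ to $\mathbb{R}$; $U(m)$ is the unique $u\in\dot W^{1,2}(\mathbb{R}^2_+)$ (homogeneous Sobolev space, completion of $C_0^\infty(\mathbb{R}^2)$ under $\|\nabla\cdot\|_{L^2}$, restricted to $\mathbb{R}^2_+$) with $u\to0$ at infinity and $\int_{\mathbb{R}^2_+}\nabla u\cdot\nabla\zeta=\int_{\mathbb{R}}m_1'\zeta(\cdot,0)$ for all $\zeta\in C_0^\infty(\mathbb{R}^2)$; $E_\epsilon(m)=\frac\epsilon2\int_{-1}^1|m'|^2+\frac12\int_{\mathbb{R}^2_+}|\nabla U(m)|^2$. $A_N=\{a:-1<a_1<\dots<a_N<1\}$; $M(a,d)$ = such $m$ with $m_1(a_n)=d_n$. $\rho(a)=\frac12\min\{2a_1+2,a_2-a_1,\dots,a_N-a_{N-1},2-2a_N\}$. $\Omega_r(a)=\mathbb{R}^2_+\setminus\bigcup_{n}B_r((a_n,0))$. Let $S=\{w\in\mathbb{C}:\operatorname{Re}w>0,\ 0<\operatorname{Im}w<\pi\}$ and $F(w)=-1/\cosh w$, a conformal bijection $S\to\mathbb{R}^2_+\cong\{\operatorname{Im}z>0\}$; set $u(z)=\frac\pi2-\operatorname{Im}F^{-1}(z)$. For $b\in(-1,1)$ let $\Phi_b(z)=\frac{z+b}{1+bz}$ and $u_b=u\circ\Phi_{-b}$. Finally $u^*_{a,d}=\sum_{n=1}^N(d_n-\cos\alpha)u_{a_n}$.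 *)

theory Defs
  imports "HOL-Analysis.Analysis"
begin

definition upper_half :: "complex set" where
  "upper_half = {z. Im z > 0}"

definition grad :: "(complex \<Rightarrow> real) \<Rightarrow> complex \<Rightarrow> complex" where
  "grad f z = Complex (frechet_derivative f (at z) 1) (frechet_derivative f (at z) \<i>)"

definition partial :: "bool \<Rightarrow> (complex \<Rightarrow> real) \<Rightarrow> complex \<Rightarrow> real" where
  "partial b f z = frechet_derivative f (at z) (if b then 1 else \<i>)"

fun iter_partial :: "bool list \<Rightarrow> (complex \<Rightarrow> real) \<Rightarrow> complex \<Rightarrow> real" where
  "iter_partial [] f = f"
| "iter_partial (b # bs) f = partial b (iter_partial bs f)"

definition smooth :: "(complex \<Rightarrow> real) \<Rightarrow> bool" where
  "smooth f \<longleftrightarrow> (\<forall>bs z. iter_partial bs f differentiable (at z))"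

definition test_fun :: "(complex \<Rightarrow> real) \<Rightarrow> bool" where
  "test_fun f \<longleftrightarrow> smooth f \<and> compact (closure {z. f z \<noteq> 0})"

text \<open>\<open>m \<in> W\<^sup>1\<^sup>,\<^sup>2((-1,1);\<SS>\<^sup>1)\<close> (continuous representative on \<open>[-1,1]\<close>), with weak derivative
  \<open>m'\<close>; \<open>\<SS>\<^sup>1\<close> is the unit circle in \<open>\<complex> = \<real>\<^sup>2\<close>, \<open>m\<^sub>1 = Re m\<close>, \<open>m\<^sub>2 = Im m\<close>.\<close>
definition W12_S1 :: "(real \<Rightarrow> complex) \<Rightarrow> (real \<Rightarrow> complex) \<Rightarrow> bool" where
  "W12_S1 m m' \<longleftrightarrow>
     (\<forall>x\<in>{-1..1}. cmod (m x) = 1) \<and>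
     set_integrable lborel {-1..1} m' \<and>
     set_integrable lborel {-1..1} (\<lambda>x. (cmod (m' x))\<^sup>2) \<and>
     (\<forall>x\<in>{-1..1}. m x = m (-1) + (LINT t:{-1..x}|lborel. m' t))"

text \<open>\<open>U(m)\<close>: the unique \<open>u\<close> (set to 0 off the open half plane) with finite Dirichlet energy,
  \<open>u \<rightarrow> 0\<close> at infinity and the weak Neumann problem
  \<open>\<integral>\<nabla>u\<cdot>\<nabla>\<zeta> = \<integral>m\<^sub>1' \<zeta>(\<cdot>,0)\<close> for all \<open>\<zeta> \<in> C\<^sub>0\<^sup>\<infinity>(\<real>\<^sup>2)\<close>
  (\<open>m\<^sub>1'\<close> vanishes outside \<open>(-1,1)\<close> since \<open>m\<^sub>1\<close> is extended by a constant).\<close>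
definition is_stray_potential :: "(real \<Rightarrow> complex) \<Rightarrow> (complex \<Rightarrow> real) \<Rightarrow> bool" where
  "is_stray_potential m' u \<longleftrightarrow>
     (\<forall>z. z \<notin> upper_half \<longrightarrow> u z = 0) \<and>
     (\<forall>z\<in>upper_half. u differentiable (at z)) \<and>
     set_integrable lborel upper_half (\<lambda>z. (norm (grad u z))\<^sup>2) \<and>
     filterlim u (nhds 0) (inf at_infinity (principal upper_half)) \<and>
     (\<forall>\<zeta>. test_fun \<zeta> \<longrightarrow>
        (LINT z:upper_half|lborel. grad u z \<bullet> grad \<zeta> z)
        = (LINT x:{-1..1}|lborel. Re (m' x) * \<zeta> (complex_of_real x)))"

definition U :: "(real \<Rightarrow> complex) \<Rightarrow> (complex \<Rightarrow> real)" where
  "U m' = (THE u. is_stray_potential m' u)"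

definition energy :: "real \<Rightarrow> (real \<Rightarrow> complex) \<Rightarrow> real" where
  "energy \<epsilon> m' = \<epsilon> / 2 * (LINT x:{-1..1}|lborel. (cmod (m' x))\<^sup>2)
                 + 1 / 2 * (LINT z:upper_half|lborel. (norm (grad (U m') z))\<^sup>2)"

definition A_set :: "nat \<Rightarrow> (nat \<Rightarrow> real) set" where
  "A_set N = {a. -1 < a 1 \<and> (\<forall>n. 1 \<le> n \<and> n < N \<longrightarrow> a n < a (Suc n)) \<and> a N < 1}"

definition in_M :: "real \<Rightarrow> nat \<Rightarrow> (nat \<Rightarrow> real) \<Rightarrow> (nat \<Rightarrow> real)
                    \<Rightarrow> (real \<Rightarrow> complex) \<Rightarrow> (real \<Rightarrow> complex) \<Rightarrow> bool" where
  "in_M \<alpha> N a d m m' \<longleftrightarrow> W12_S1 m m' \<and> Re (m (-1)) = cos \<alpha> \<and> Re (m 1) = cos \<alpha> \<and>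
     (\<forall>n\<in>{1..N}. Re (m (a n)) = d n)"

definition rho :: "nat \<Rightarrow> (nat \<Rightarrow> real) \<Rightarrow> real" where
  "rho N a = 1/2 * Min ({2 * a 1 + 2, 2 - 2 * a N} \<union> {a (Suc n) - a n | n. 1 \<le> n \<and> n < N})"

definition Omega :: "nat \<Rightarrow> real \<Rightarrow> (nat \<Rightarrow> real) \<Rightarrow> complex set" where
  "Omega N r a = upper_half - (\<Union>n\<in>{1..N}. ball (complex_of_real (a n)) r)"

definition strip :: "complex set" where
  "strip = {w. Re w > 0 \<and> 0 < Im w \<and> Im w < pi}"

definition Fmap :: "complex \<Rightarrow> complex" where
  "Fmap w = - 1 / cosh w"

definition u0 :: "complex \<Rightarrow> real" where
  "u0 z = pi / 2 - Im (the_inv_into strip Fmap z)"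

definition Phi :: "real \<Rightarrow> complex \<Rightarrow> complex" where
  "Phi b z = (z + complex_of_real b) / (1 + complex_of_real b * z)"

definition ub :: "real \<Rightarrow> complex \<Rightarrow> real" where
  "ub b z = u0 (Phi (-b) z)"

definition ustar :: "real \<Rightarrow> nat \<Rightarrow> (nat \<Rightarrow> real) \<Rightarrow> (nat \<Rightarrow> real) \<Rightarrow> complex \<Rightarrow> real" where
  "ustar \<alpha> N a d z = (\<Sum>n=1..N. (d n - cos \<alpha>) * ub (a n) z)"

end

theory Submission
  imports Defs
begin

text \<open>The stray field potential of \<open>m\<close> is the logarithmic potential of the charge \<open>m\<^sub>1'\<close> on the boundary.
  Let \<open>\<zeta>\<close> be \<open>u\<^sup>*\<close> cut off at distance \<open>r = \<kappa>\<delta>\<close> from the points \<open>a\<^sub>n\<close>. Its energy is at most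
  \<open>\<pi>\<Gamma> log (1/\<delta>) + O(1)\<close>, and its boundary values jump by \<open>\<pi>\<close> at each \<open>a\<^sub>n\<close>, so that its pairing with the
  stray field is \<open>\<pi>\<Gamma>\<close> up to an error controlled by the values of \<open>m\<^sub>1 - d\<^sub>n\<close> within distance \<open>r\<close> of \<open>a\<^sub>n\<close>.
  Since \<open>\<bar>m\<bar> = 1\<close> and \<open>m\<^sub>1 = \<plusminus>1\<close> at \<open>a\<^sub>n\<close>, this difference is quadratic in \<open>m - m(a\<^sub>n)\<close>, and the error is at
  most \<open>r / \<epsilon> = \<kappa> log (1/\<epsilon>)\<close> times the exchange energy. Expanding the square of
  \<open>\<nabla>u - \<nabla>\<zeta> / log (1/\<delta>)\<close> and choosing \<open>\<kappa>\<close> small enough to absorb the exchange energy gives both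
  estimates.\<close>

section \<open>Integration over the half plane\<close>

text \<open>\<open>U\<close> is a definite description, so nothing can be said about it before
  existence and uniqueness of the weak solution are proved. A solution is only assumed
  differentiable with square integrable gradient, and no boundary trace is given; uniqueness
  therefore rests on explicit radial test functions and on integration by parts along almost every
  line. The truncated profile \<zeta> is no test function: its gradient is singular like |z -
  1|^(-1/2) and |z + 1|^(-1/2) at the ends of the interval, and in general its support is unbounded.
  Its pairing with the stray field is therefore computed from the explicit kernel, by Fubini and an
  average over dilations of a half disc, which asks only that |grad \<zeta>| / |z - t| be
  integrable, with a bound uniform in t. For the lower bound on \<open>Omega\<close> the removed
  balls must carry little of the stray field energy: there the field differs from grad \<zeta> / log
  (1/\<delta>) by O(1/log (1/\<delta>)) in L^2, and grad \<zeta> has energy O(1) in the balls, since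
  only the distances between \<kappa>\<delta> and \<delta> contribute to its singular part.\<close>

lemma lborel_complex_eq_distr:
  "(lborel :: complex measure) = distr (lborel \<Otimes>\<^sub>M lborel) borel (\<lambda>(x, y). Complex x y)"
proof (rule lborel_eqI)
  have m [measurable]: "(\<lambda>(x, y). Complex x y) \<in> borel \<Otimes>\<^sub>M borel \<rightarrow>\<^sub>M borel"
    unfolding Complex_eq split_def by measurable
  fix l u :: complex
  assume le: "\<And>b. b \<in> Basis \<Longrightarrow> l \<bullet> b \<le> u \<bullet> b"
  have "Re l \<le> Re u" "Im l \<le> Im u"
    using le[of 1] le[of \<i>] by (auto simp: Basis_complex_def)
  moreover have "(\<lambda>(x, y). Complex x y) -` box l u = {Re l<..<Re u} \<times> {Im l<..<Im u}"
    by (auto simp: in_box_complex_iff)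
  ultimately show "emeasure (distr (lborel \<Otimes>\<^sub>M lborel) borel (\<lambda>(x, y). Complex x y)) (box l u)
      = ennreal (\<Prod>b\<in>Basis. (u - l) \<bullet> b)"
    by (simp add: emeasure_distr space_pair_measure lborel.emeasure_pair_measure_Times
        Basis_complex_def ennreal_mult)
qed simp

lemma measurable_Complex [measurable]:
  assumes [measurable]: "f \<in> borel_measurable M" "g \<in> borel_measurable M"
  shows "(\<lambda>x. Complex (f x) (g x)) \<in> borel_measurable M"
  unfolding Complex_eq by measurable

lemma
  fixes f :: "complex \<Rightarrow> real"
  assumes f: "integrable lborel f"
  shows AE_integrable_complex_fst: "AE x in lborel. integrable lborel (\<lambda>y. f (Complex x y))"
    and integrable_complex_fst: "integrable lborel (\<lambda>x. \<integral>y. f (Complex x y) \<partial>lborel)"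
    and integral_complex_fst: "(\<integral>x. (\<integral>y. f (Complex x y) \<partial>lborel) \<partial>lborel) = integral\<^sup>L lborel f"
    and AE_integrable_complex_snd: "AE y in lborel. integrable lborel (\<lambda>x. f (Complex x y))"
    and integral_complex_snd: "(\<integral>y. (\<integral>x. f (Complex x y) \<partial>lborel) \<partial>lborel) = integral\<^sup>L lborel f"
proof -
  have [measurable]: "f \<in> borel_measurable borel" using f by auto
  have p: "integrable (lborel \<Otimes>\<^sub>M lborel) (\<lambda>(x, y). f (Complex x y))"
    using f by (subst (asm) lborel_complex_eq_distr, subst (asm) integrable_distr_eq) (auto simp: split_def)
  have i: "integral\<^sup>L lborel f = (\<integral>p. f (Complex (fst p) (snd p)) \<partial>(lborel \<Otimes>\<^sub>M lborel))"
    by (subst lborel_complex_eq_distr, subst integral_distr) (auto simp: split_def)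
  show "AE x in lborel. integrable lborel (\<lambda>y. f (Complex x y))"
    using lborel_pair.AE_integrable_fst[OF p] by simp
  show "integrable lborel (\<lambda>x. \<integral>y. f (Complex x y) \<partial>lborel)"
    using lborel_pair.integrable_fst[OF p] by simp
  show "(\<integral>x. (\<integral>y. f (Complex x y) \<partial>lborel) \<partial>lborel) = integral\<^sup>L lborel f"
    using lborel_pair.integral_fst[OF p] i by (simp add: split_def)
  show "AE y in lborel. integrable lborel (\<lambda>x. f (Complex x y))"
    using lborel_pair.AE_integrable_snd[OF p] by simp
  show "(\<integral>y. (\<integral>x. f (Complex x y) \<partial>lborel) \<partial>lborel) = integral\<^sup>L lborel f"
    using lborel_pair.integral_snd[OF p] i by (simp add: split_def)
qed

lemma upper_half_minus_real: "z \<in> upper_half \<Longrightarrow> z - of_real t \<noteq> 0"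
  by (auto simp: upper_half_def complex_eq_iff)

lemma upper_half_measurable [measurable]: "upper_half \<in> sets borel"
  unfolding upper_half_def by measurable

text \<open>Conjugation preserves Lebesgue measure and exchanges the two open half discs, and the
  diameter between them is null, so each has half of the area of the disc.\<close>

lemma emeasure_half_disc:
  assumes "0 \<le> r"
  shows "emeasure lborel (upper_half \<inter> cball 0 r) = ennreal (pi * r\<^sup>2 / 2)"
proof -
  let ?U = "upper_half \<inter> cball 0 r" and ?L = "{z. Im z < 0} \<inter> cball 0 r"
  have [measurable]: "{z. Im z < 0} \<in> sets borel" by measurable
  have T: "(\<lambda>x. 0 + (\<Sum>j\<in>Basis. ((if j = \<i> then -1 else 1) * (x \<bullet> j)) *\<^sub>R j)) = cnj"
    by (auto simp: fun_eq_iff Basis_complex_def complex_eq_iff)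
  have "(lborel :: complex measure) = density (distr lborel borel cnj) (\<lambda>_. 1)"
    using lborel_affine_euclidean[of "\<lambda>j::complex. if j = \<i> then -1 else 1" 0]
    unfolding T by (simp add: Basis_complex_def ennreal_mult)
  then have "emeasure lborel ?L = emeasure (distr lborel borel cnj) ?L"
    by (simp add: density_1)
  also have "\<dots> = emeasure lborel (cnj -` ?L)"
    by (subst emeasure_distr) (auto intro!: borel_measurable_continuous_onI continuous_intros)
  also have "cnj -` ?L = ?U"
    by (auto simp: upper_half_def)
  finally have eq: "emeasure lborel ?L = emeasure lborel ?U" .
  have null: "{z. Im z = 0} \<in> null_sets lborel"
  proof -
    have "negligible {z::complex. \<i> \<bullet> z = 0}"
      by (rule negligible_hyperplane) auto
    then have "{z::complex. Im z = 0} \<in> null_sets lebesgue"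
      by (simp add: negligible_iff_null_sets)
    moreover have "{z::complex. Im z = 0} \<in> sets lborel" by simp
    ultimately show ?thesis by (simp add: null_sets_completion_iff)
  qed
  have "emeasure lborel (cball (0::complex) r) = emeasure lborel (?U \<union> ?L)"
    by (rule emeasure_eq_AE) (use AE_not_in[OF null] in \<open>auto elim!: eventually_mono simp: upper_half_def\<close>)
  also have "\<dots> = emeasure lborel ?U + emeasure lborel ?L"
    by (rule plus_emeasure[symmetric]) (auto simp: upper_half_def)
  finally have "ennreal (pi * r\<^sup>2) = 2 * emeasure lborel ?U"
    using assms eq by (simp add: emeasure_cball unit_ball_vol_2 mult_2)
  also have "ennreal (pi * r\<^sup>2) = 2 * ennreal (pi * r\<^sup>2 / 2)"
    by (simp flip: ennreal_numeral add: ennreal_mult[symmetric])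
  finally show ?thesis
    by (subst (asm) ennreal_mult_cancel_left) auto
qed

text \<open>Polar coordinates without a change of variables: the image of Lebesgue measure on the
  half plane under \<open>cmod\<close> and the measure with density \<open>pi * r\<close> give the
  same mass to every set \<open>{..a}\<close>, by the area of a half disc, and these sets generate
  the Borel sets. The centre \<open>t\<close> is real, so translating it to 0 maps the half plane to
  itself.\<close>

lemma nn_integral_half_plane_radial:
  fixes g :: "real \<Rightarrow> ennreal"
  assumes [measurable]: "g \<in> borel_measurable borel"
  shows "(\<integral>\<^sup>+z. g (cmod (z - of_real t)) * indicator upper_half z \<partial>lborel)
       = (\<integral>\<^sup>+r. ennreal (pi * r) * indicator {0<..} r * g r \<partial>lborel)"
proof -
  let ?M = "distr (density lborel (indicator upper_half)) borel cmod"
  let ?N = "density lborel (\<lambda>r. ennreal (pi * r) * indicator {0<..} r)"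
  have M: "emeasure ?M {..a} = ennreal (pi * (max 0 a)\<^sup>2 / 2)" for a
  proof -
    have [measurable]: "cmod -` {..a} \<in> sets borel"
      by (rule measurable_sets_borel[of _ borel]) auto
    have "emeasure ?M {..a} = (\<integral>\<^sup>+z. indicator (upper_half \<inter> (cmod -` {..a})) z \<partial>lborel)"
      by (simp add: emeasure_distr emeasure_density indicator_inter_arith)
    also have "\<dots> = emeasure lborel (upper_half \<inter> (cmod -` {..a}))"
      by (rule nn_integral_indicator) simp
    also have "upper_half \<inter> (cmod -` {..a}) = upper_half \<inter> cball 0 (max 0 a)"
    proof (cases "0 \<le> a")
      case False
      then have "\<not> cmod z \<le> a" for z using norm_ge_zero[of z] by linarith
      with False show ?thesis by (auto simp: upper_half_def max_def)
    qed (auto simp: max_def)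
    finally show ?thesis by (simp add: emeasure_half_disc)
  qed
  have N: "emeasure ?N {..a} = ennreal (pi * (max 0 a)\<^sup>2 / 2)" for a
  proof -
    have "emeasure ?N {..a} = (\<integral>\<^sup>+r. ennreal (pi * r) * indicator {0..max 0 a} r \<partial>lborel)"
      by (subst emeasure_density) (auto intro!: nn_integral_cong split: split_indicator)
    also have "\<dots> = ennreal (pi * (max 0 a)\<^sup>2 / 2 - pi * 0\<^sup>2 / 2)"
      by (rule nn_integral_FTC_Icc) (auto intro!: derivative_eq_intros)
    finally show ?thesis by simp
  qed
  have "?M = ?N"
  proof (rule measure_eqI_generator_eq)
    let ?E = "range (\<lambda>a::real. {..a})"
    show "Int_stable ?E" by (auto simp: Int_stable_def)
    show "sets ?M = sigma_sets UNIV ?E" "sets ?N = sigma_sets UNIV ?E"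
      by (simp_all add: borel_eq_atMost)
    show "range (\<lambda>n::nat. {..real n}) \<subseteq> ?E" by auto
    show "(\<Union>n::nat. {..real n}) = UNIV" by (auto intro: real_arch_simple)
    show "emeasure ?M {..real i} \<noteq> \<infinity>" for i by (simp add: M)
  qed (auto simp: M N)
  have "(\<integral>\<^sup>+z. g (cmod (z - of_real t)) * indicator upper_half z \<partial>lborel)
      = (\<integral>\<^sup>+z. g (cmod (z - of_real t)) * indicator upper_half z \<partial>distr lborel borel ((+) (of_real t)))"
    by (simp add: lborel_distr_plus)
  also have "\<dots> = (\<integral>\<^sup>+z. indicator upper_half z * g (cmod z) \<partial>lborel)"
    by (subst nn_integral_distr) (auto intro!: nn_integral_cong simp: upper_half_def split: split_indicator)
  also have "\<dots> = (\<integral>\<^sup>+r. g r \<partial>?M)"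
    by (subst nn_integral_distr, simp, simp, subst nn_integral_density) auto
  also have "\<dots> = (\<integral>\<^sup>+r. ennreal (pi * r) * indicator {0<..} r * g r \<partial>lborel)"
    unfolding \<open>?M = ?N\<close> by (subst nn_integral_density) auto
  finally show ?thesis .
qed

text \<open>Only one-sided limits of the primitive enter at the end points, so the integrand may
  blow up there, as 1 / sqrt x does.\<close>

lemma nn_integral_real_set_FTC_open:
  fixes F f :: "real \<Rightarrow> real" and a b :: real
  assumes ab: "a < b"
    and F: "\<And>x. a < x \<Longrightarrow> x < b \<Longrightarrow> DERIV F x :> f x"
    and f: "continuous_on {a<..<b} f"
    and nn: "\<And>x. a < x \<Longrightarrow> x < b \<Longrightarrow> 0 \<le> f x"
    and A: "(F \<longlongrightarrow> A) (at_right a)" and B: "(F \<longlongrightarrow> B) (at_left b)"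
  shows "(\<integral>\<^sup>+x. ennreal (f x) * indicator {a<..<b} x \<partial>lborel) = ennreal (B - A)"
proof -
  have c: "isCont f x" if "a < x" "x < b" for x
    using f that by (auto simp: continuous_on_eq_continuous_at)
  have 1: "set_integrable lborel (einterval (ereal a) (ereal b)) f"
    by (rule interval_integral_FTC_nonneg(1)[of "ereal a" "ereal b" F f A B])
      (use assms c in \<open>auto simp: ereal_tendsto_simps\<close>)
  have 2: "(LBINT x=ereal a..ereal b. f x) = B - A"
    by (rule interval_integral_FTC_nonneg(2)[of "ereal a" "ereal b" F f A B])
      (use assms c in \<open>auto simp: ereal_tendsto_simps\<close>)
  have "(\<integral>\<^sup>+x. ennreal (f x) * indicator {a<..<b} x \<partial>lborel)
      = (\<integral>\<^sup>+x. ennreal (indicator {a<..<b} x *\<^sub>R f x) \<partial>lborel)"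
    by (auto intro!: nn_integral_cong split: split_indicator)
  also have "\<dots> = ennreal (LINT x:{a<..<b}|lborel. f x)"
    using 1 nn unfolding set_lebesgue_integral_def set_integrable_def
    by (intro nn_integral_eq_integral) (auto split: split_indicator)
  finally show ?thesis
    using 2 ab by (simp add: interval_lebesgue_integral_def)
qed

text \<open>Every logarithm in the energy estimates comes from this borderline exponent. The
  companion integrals below use that exponents under 2 are integrable near the centre and exponents
  over 2 at infinity.\<close>

lemma nn_integral_half_plane_inverse_square:
  assumes "0 < r" "r \<le> s"
  shows "(\<integral>\<^sup>+z. ennreal (1 / (cmod (z - of_real t))\<^sup>2) * indicator {r..s} (cmod (z - of_real t))
            * indicator upper_half z \<partial>lborel) = ennreal (pi * ln (s / r))"
proof -
  have "(\<integral>\<^sup>+z. ennreal (1 / (cmod (z - of_real t))\<^sup>2) * indicator {r..s} (cmod (z - of_real t))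
            * indicator upper_half z \<partial>lborel)
      = (\<integral>\<^sup>+x. ennreal (pi * x) * indicator {0<..} x * (ennreal (1 / x\<^sup>2) * indicator {r..s} x) \<partial>lborel)"
    by (rule nn_integral_half_plane_radial) simp
  also have "\<dots> = (\<integral>\<^sup>+x. ennreal (pi / x) * indicator {r..s} x \<partial>lborel)"
    using assms by (intro nn_integral_cong)
      (auto split: split_indicator simp: ennreal_mult[symmetric] power2_eq_square)
  also have "\<dots> = ennreal (pi * ln s - pi * ln r)"
    by (rule nn_integral_FTC_Icc) (use assms in \<open>auto intro!: derivative_eq_intros simp: mult.commute\<close>)
  finally show ?thesis using assms by (simp add: ln_div right_diff_distrib)
qed

lemma nn_integral_half_plane_inverse:
  assumes "0 < s"
  shows "(\<integral>\<^sup>+z. ennreal (1 / cmod (z - of_real t)) * indicator {..s} (cmod (z - of_real t))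
            * indicator upper_half z \<partial>lborel) = ennreal (pi * s)"
proof -
  have "(\<integral>\<^sup>+z. ennreal (1 / cmod (z - of_real t)) * indicator {..s} (cmod (z - of_real t))
            * indicator upper_half z \<partial>lborel)
      = (\<integral>\<^sup>+x. ennreal (pi * x) * indicator {0<..} x * (ennreal (1 / x) * indicator {..s} x) \<partial>lborel)"
    by (rule nn_integral_half_plane_radial) simp
  also have "\<dots> = (\<integral>\<^sup>+x. ennreal pi * indicator {0<..s} x \<partial>lborel)"
    using assms by (intro nn_integral_cong)
      (auto split: split_indicator simp: ennreal_mult[symmetric])
  also have "\<dots> = ennreal (pi * s)"
    using assms by (simp add: nn_integral_cmult ennreal_mult)
  finally show ?thesis .
qed

lemma nn_integral_half_plane_inverse_three_halves:
  assumes "0 < s"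
  shows "(\<integral>\<^sup>+z. ennreal (1 / (cmod (z - of_real t) * sqrt (cmod (z - of_real t))))
            * indicator {..<s} (cmod (z - of_real t))
            * indicator upper_half z \<partial>lborel) = ennreal (2 * pi * sqrt s)"
proof -
  have "(\<integral>\<^sup>+z. ennreal (1 / (cmod (z - of_real t) * sqrt (cmod (z - of_real t))))
            * indicator {..<s} (cmod (z - of_real t))
            * indicator upper_half z \<partial>lborel)
      = (\<integral>\<^sup>+x. ennreal (pi * x) * indicator {0<..} x * (ennreal (1 / (x * sqrt x)) * indicator {..<s} x) \<partial>lborel)"
    by (rule nn_integral_half_plane_radial) simp
  also have "\<dots> = (\<integral>\<^sup>+x. ennreal (pi / sqrt x) * indicator {0<..<s} x \<partial>lborel)"
    using assms by (intro nn_integral_cong)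
      (auto split: split_indicator simp: ennreal_mult[symmetric])
  also have "\<dots> = ennreal (2 * pi * sqrt s - 2 * pi * sqrt 0)"
  proof (rule nn_integral_real_set_FTC_open[OF assms])
    show "((\<lambda>x. 2 * pi * sqrt x) has_real_derivative pi / sqrt x) (at x)" if "0 < x" for x
      using that by (auto intro!: derivative_eq_intros simp: field_simps)
    show "((\<lambda>x. 2 * pi * sqrt x) \<longlongrightarrow> 2 * pi * sqrt 0) (at_right 0)"
      "((\<lambda>x. 2 * pi * sqrt x) \<longlongrightarrow> 2 * pi * sqrt s) (at_left s)"
      by (auto intro!: tendsto_eq_intros)
  qed (auto intro!: continuous_intros)
  finally show ?thesis by simp
qed

lemma nn_integral_half_plane_inverse_cube:
  assumes "0 < s"
  shows "(\<integral>\<^sup>+z. ennreal (1 / (cmod (z - of_real t))^3) * indicator {s..} (cmod (z - of_real t))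
            * indicator upper_half z \<partial>lborel) = ennreal (pi / s)"
proof -
  have "(\<integral>\<^sup>+z. ennreal (1 / (cmod (z - of_real t))^3) * indicator {s..} (cmod (z - of_real t))
            * indicator upper_half z \<partial>lborel)
      = (\<integral>\<^sup>+x. ennreal (pi * x) * indicator {0<..} x * (ennreal (1 / x^3) * indicator {s..} x) \<partial>lborel)"
    by (rule nn_integral_half_plane_radial) simp
  also have "\<dots> = (\<integral>\<^sup>+x. ennreal (pi / x\<^sup>2) * indicator {s..} x \<partial>lborel)"
    using assms by (intro nn_integral_cong)
      (auto split: split_indicator simp: ennreal_mult[symmetric] power2_eq_square power3_eq_cube)
  also have "\<dots> = ennreal (0 - (- pi / s))"
  proof (rule nn_integral_FTC_atLeast)
    show "((\<lambda>x. - pi / x) \<longlongrightarrow> 0) at_top"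
      by (rule real_tendsto_divide_at_top) (auto intro: filterlim_ident)
    show "((\<lambda>x. - pi / x) has_real_derivative pi / x\<^sup>2) (at x)" if "s \<le> x" for x
      using that assms by (auto intro!: derivative_eq_intros simp: power2_eq_square)
  qed auto
  finally show ?thesis by simp
qed

lemma nn_integral_inverse_cube_atLeast:
  assumes "0 < r"
  shows "(\<integral>\<^sup>+x. ennreal (1 / x^3) * indicator {r..} x \<partial>lborel) = ennreal (1 / (2 * r\<^sup>2))"
proof -
  have "(\<integral>\<^sup>+x. ennreal (1 / x^3) * indicator {r..} x \<partial>lborel) = ennreal (0 - (- 1 / (2 * r\<^sup>2)))"
  proof (rule nn_integral_FTC_atLeast)
    show "((\<lambda>x::real. - 1 / (2 * x\<^sup>2)) \<longlongrightarrow> 0) at_top"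
      by (rule real_tendsto_divide_at_top)
        (auto intro!: filterlim_tendsto_pos_mult_at_top filterlim_pow_at_top filterlim_ident)
    show "((\<lambda>x. - 1 / (2 * x\<^sup>2)) has_real_derivative 1 / x^3) (at x)" if "r \<le> x" for x
      using that assms by (auto intro!: derivative_eq_intros simp: power2_eq_square power3_eq_cube field_simps)
  qed (use assms in auto)
  then show ?thesis by simp
qed

section \<open>Averaging over dilations of the half disc\<close>

definition half_disc :: "complex set" where
  "half_disc = upper_half \<inter> cball 0 1"

lemma half_disc_measurable [measurable]: "half_disc \<in> sets borel"
  unfolding half_disc_def by measurable

text \<open>For fixed s the substitution y = s z has Jacobian s^2 and turns the weight 1/s into
  1/s^3 on |y| <= s; integrating 1/s^3 over s >= |y| leaves 1 / (2 |y|^2).\<close>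

lemma nn_integral_dilations_half_disc:
  fixes g :: "complex \<Rightarrow> ennreal"
  assumes [measurable]: "g \<in> borel_measurable borel"
  shows "(\<integral>\<^sup>+p. (case p of (s, z) \<Rightarrow> ennreal (1 / s) * indicator {0<..} s * indicator half_disc z * g (s *\<^sub>R z))
            \<partial>(lborel \<Otimes>\<^sub>M lborel))
       = (\<integral>\<^sup>+y. ennreal (1 / (2 * (cmod y)\<^sup>2)) * indicator upper_half y * g y \<partial>lborel)"
proof -
  have inner: "(\<integral>\<^sup>+z. ennreal (1 / s) * indicator {0<..} s * indicator half_disc z * g (s *\<^sub>R z) \<partial>lborel)
      = (\<integral>\<^sup>+y. indicator {0<..} s * (ennreal (1 / s^3) * indicator {cmod y..} s) * indicator upper_half y * g y \<partial>lborel)"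
    for s :: real
  proof (cases "0 < s")
    case s: True
    let ?k = "\<lambda>y. (ennreal (1 / s^3) * indicator {..s} (cmod y)) * indicator upper_half y * g y"
    have "(\<integral>\<^sup>+y. ?k y \<partial>lborel) = (\<integral>\<^sup>+y. ?k y \<partial>density (distr lborel borel (\<lambda>x. 0 + s *\<^sub>R x)) (\<lambda>_. ennreal (\<bar>s\<bar>^DIM(complex))))"
      using lborel_affine[of s "0::complex"] s by simp
    also have "\<dots> = (\<integral>\<^sup>+z. ennreal (s\<^sup>2) * ?k (s *\<^sub>R z) \<partial>lborel)"
      using s by (simp add: nn_integral_density nn_integral_distr nn_integral_cmult)
    also have "\<dots> = (\<integral>\<^sup>+z. ennreal (1 / s) * indicator half_disc z * g (s *\<^sub>R z) \<partial>lborel)"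
      using s by (intro nn_integral_cong)
        (auto simp: half_disc_def upper_half_def mult_le_cancel_left1 zero_less_mult_iff mult.assoc[symmetric] ennreal_mult[symmetric]
            power2_eq_square power3_eq_cube split: split_indicator)
    finally show ?thesis using s by (simp add: indicator_def)
  qed simp
  have "(\<integral>\<^sup>+p. (case p of (s, z) \<Rightarrow> ennreal (1 / s) * indicator {0<..} s * indicator half_disc z * g (s *\<^sub>R z))
            \<partial>(lborel \<Otimes>\<^sub>M lborel))
     = (\<integral>\<^sup>+s. (\<integral>\<^sup>+z. ennreal (1 / s) * indicator {0<..} s * indicator half_disc z * g (s *\<^sub>R z) \<partial>lborel) \<partial>lborel)"
    by (subst lborel.nn_integral_fst[symmetric]) (auto simp: split_def)
  also have "\<dots> = (\<integral>\<^sup>+s. (\<integral>\<^sup>+y. indicator {0<..} s * (ennreal (1 / s^3) * indicator {p. cmod (snd p) \<le> fst p} (s, y)) * indicator upper_half y * g y \<partial>lborel) \<partial>lborel)"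
    unfolding inner by (intro nn_integral_cong) (auto split: split_indicator)
  also have "\<dots> = (\<integral>\<^sup>+y. (\<integral>\<^sup>+s. indicator {0<..} s * (ennreal (1 / s^3) * indicator {p. cmod (snd p) \<le> fst p} (s, y)) * indicator upper_half y * g y \<partial>lborel) \<partial>lborel)"
    by (rule lborel_pair.Fubini') (simp add: split_def)
  also have "\<dots> = (\<integral>\<^sup>+y. ennreal (1 / (2 * (cmod y)\<^sup>2)) * indicator upper_half y * g y \<partial>lborel)"
  proof (rule nn_integral_cong)
    fix y :: complex
    have "(\<integral>\<^sup>+s. indicator {0<..} s * (ennreal (1 / s^3) * indicator {p. cmod (snd p) \<le> fst p} (s, y)) * indicator upper_half y * g y \<partial>lborel)
       = (\<integral>\<^sup>+s. (ennreal (1 / s^3) * indicator {cmod y..} s) * (indicator upper_half y * g y) \<partial>lborel)"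
    proof (rule nn_integral_cong)
      fix s
      show "indicator {0<..} s * (ennreal (1 / s^3) * indicator {p. cmod (snd p) \<le> fst p} (s, y)) * indicator upper_half y * g y
         = (ennreal (1 / s^3) * indicator {cmod y..} s) * (indicator upper_half y * g y)"
      proof (cases "y \<in> upper_half")
        case True
        then have "0 < cmod y" by (auto simp: upper_half_def)
        then have "cmod y \<le> s \<Longrightarrow> 0 < s" by linarith
        then show ?thesis by (auto split: split_indicator simp: mult_ac)
      qed simp
    qed
    also have "\<dots> = (\<integral>\<^sup>+s. (ennreal (1 / s^3) * indicator {cmod y..} s) \<partial>lborel) * (indicator upper_half y * g y)"
      by (rule nn_integral_multc) simp
    also have "\<dots> = ennreal (1 / (2 * (cmod y)\<^sup>2)) * indicator upper_half y * g y"
    proof (cases "y \<in> upper_half")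
      case True
      then have "0 < cmod y" by (auto simp: upper_half_def)
      then show ?thesis using nn_integral_inverse_cube_atLeast[of "cmod y"] by (simp add: mult_ac)
    qed simp
    finally show "(\<integral>\<^sup>+s. indicator {0<..} s * (ennreal (1 / s^3) * indicator {p. cmod (snd p) \<le> fst p} (s, y)) * indicator upper_half y * g y \<partial>lborel)
       = ennreal (1 / (2 * (cmod y)\<^sup>2)) * indicator upper_half y * g y" .
  qed
  finally show ?thesis .
qed

text \<open>As an equality of measures the substitution also transfers integrability and the
  integrals of functions that change sign.\<close>

lemma distr_dilations_half_disc:
  "distr (density (lborel \<Otimes>\<^sub>M lborel) (\<lambda>(s, z). ennreal (1 / s) * indicator {0<..} s * indicator half_disc z))
      borel (\<lambda>(s, z). s *\<^sub>R z)
   = density lborel (\<lambda>y. ennreal (1 / (2 * (cmod y)\<^sup>2)) * indicator upper_half y)" (is "?M = ?N")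
proof (rule measure_eqI)
  fix A assume "A \<in> sets ?M"
  then have A [measurable]: "A \<in> sets borel" by simp
  have "emeasure ?M A = (\<integral>\<^sup>+y. indicator A y \<partial>?M)" using A by simp
  also have "\<dots> = (\<integral>\<^sup>+y. indicator A y \<partial>?N)"
    using nn_integral_dilations_half_disc[of "indicator A"]
    by (simp add: nn_integral_distr nn_integral_density split_def del: nn_integral_indicator)
  also have "\<dots> = emeasure ?N A" using A by simp
  finally show "emeasure ?M A = emeasure ?N A" .
qed simp

text \<open>The kernel \<open>(z - t) / \<bar>z - t\<bar>\<^sup>2\<close> is what remains of the derivative along the rays from \<open>t\<close>
  after averaging over all dilations of the half disc around \<open>t\<close>.\<close>

lemma set_integral_grad_inner_kernel:
  fixes \<zeta> :: "complex \<Rightarrow> real" and G :: "complex \<Rightarrow> complex" and t :: real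
  assumes der: "\<And>z. z \<in> upper_half \<Longrightarrow> (\<zeta> has_derivative (\<lambda>h. G z \<bullet> h)) (at z)"
    and cont: "continuous_on upper_half G"
    and int: "set_integrable lborel upper_half (\<lambda>z. cmod (G z) / cmod (z - of_real t))"
    and lim0: "(\<zeta> \<longlongrightarrow> \<zeta>0) (at (of_real t) within upper_half)"
    and limi: "(\<zeta> \<longlongrightarrow> \<zeta>i) (inf at_infinity (principal upper_half))"
  shows "(LINT z:upper_half|lborel. G z \<bullet> ((z - of_real t) /\<^sub>R (cmod (z - of_real t))\<^sup>2)) = pi * (\<zeta>i - \<zeta>0)"
proof -
  define Gt where "Gt z = indicator upper_half z *\<^sub>R G z" for z
  have [measurable]: "Gt \<in> borel_measurable borel"
    unfolding Gt_def[abs_def] by (rule borel_measurable_continuous_on_indicator) (use cont in auto)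
  define g where "g y = Gt (of_real t + y) \<bullet> y" for y
  have [measurable]: "g \<in> borel_measurable borel"
    unfolding g_def[abs_def] by measurable
  let ?w = "\<lambda>y::complex. (1::real) / (2 * (cmod y)\<^sup>2) * indicator upper_half y"
  let ?v = "\<lambda>p::real \<times> complex. 1 / fst p * indicator {0<..} (fst p) * indicator half_disc (snd p)"
  let ?N = "density lborel (\<lambda>y. ennreal (?w y))"
  let ?D = "density (lborel \<Otimes>\<^sub>M lborel) (\<lambda>p. ennreal (?v p))"
  have vnn: "0 \<le> ?v p" for p by (auto split: split_indicator)
  have MN: "distr ?D borel (\<lambda>p. fst p *\<^sub>R snd p) = ?N"
  proof -
    have "(\<lambda>p. ennreal (?v p)) = (\<lambda>(s, z). ennreal (1 / s) * indicator {0<..} s * indicator half_disc z)"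
      "(\<lambda>y. ennreal (?w y)) = (\<lambda>y. ennreal (1 / (2 * (cmod y)\<^sup>2)) * indicator upper_half y)"
      by (auto simp: fun_eq_iff split: split_indicator)
    then show ?thesis using distr_dilations_half_disc by (simp add: split_def)
  qed
  have shift: "integrable lborel (\<lambda>y. f (of_real t + y)) \<longleftrightarrow> integrable lborel f"
    "(\<integral>y. f (of_real t + y) \<partial>lborel) = (\<integral>y. f y \<partial>lborel)"
    if [measurable]: "f \<in> borel_measurable borel" for f :: "complex \<Rightarrow> real"
    by (subst (2) lborel_distr_plus[symmetric, of "of_real t"], subst integrable_distr_eq, auto)
      (subst (2) lborel_distr_plus[symmetric, of "of_real t"], subst integral_distr, auto)
  have wg: "integrable lborel (\<lambda>y. ?w y * g y)"
  proof -
    have "integrable lborel (\<lambda>z. indicator upper_half z *\<^sub>R (cmod (Gt z) / cmod (z - of_real t)))"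
      using int unfolding set_integrable_def
      by (rule Bochner_Integration.integrable_cong[THEN iffD1, rotated -1]) (auto simp: Gt_def split: split_indicator)
    then have "integrable lborel (\<lambda>z. indicator upper_half z *\<^sub>R (cmod (Gt (of_real t + z)) / cmod z))"
      by (subst (asm) shift(1)[symmetric]) (auto simp: upper_half_def indicator_def)
    then show ?thesis
    proof (rule Bochner_Integration.integrable_bound)
      show "AE y in lborel. norm (?w y * g y) \<le> norm (indicator upper_half y *\<^sub>R (cmod (Gt (of_real t + y)) / cmod y))"
      proof (rule AE_I2)
        fix y
        have "\<bar>g y\<bar> \<le> cmod (Gt (of_real t + y)) * cmod y"
          unfolding g_def by (rule Cauchy_Schwarz_ineq2)
        then have "\<bar>g y\<bar> / (2 * (cmod y)\<^sup>2) \<le> cmod (Gt (of_real t + y)) * cmod y / (2 * (cmod y)\<^sup>2)"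
          by (intro divide_right_mono) auto
        also have "\<dots> \<le> cmod (Gt (of_real t + y)) / cmod y"
          by (auto simp: power2_eq_square field_simps)
        finally show "norm (?w y * g y) \<le> norm (indicator upper_half y *\<^sub>R (cmod (Gt (of_real t + y)) / cmod y))"
          by (auto simp: abs_mult split: split_indicator)
      qed
    qed measurable
  qed
  have p: "integrable (lborel \<Otimes>\<^sub>M lborel) (\<lambda>p. ?v p * g (fst p *\<^sub>R snd p))"
  proof -
    have "integrable ?N g" using wg by (subst integrable_density) auto
    then have "integrable ?D (\<lambda>p. g (fst p *\<^sub>R snd p))"
      unfolding MN[symmetric] by (subst (asm) integrable_distr_eq) auto
    then show ?thesis using vnn by (subst (asm) integrable_density) auto
  qed
  have eq: "(\<integral>y. ?w y * g y \<partial>lborel) = (\<integral>p. ?v p * g (fst p *\<^sub>R snd p) \<partial>(lborel \<Otimes>\<^sub>M lborel))"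
  proof -
    have "(\<integral>y. ?w y * g y \<partial>lborel) = (\<integral>y. g y \<partial>?N)"
      by (subst integral_density) auto
    also have "\<dots> = (\<integral>p. g (fst p *\<^sub>R snd p) \<partial>?D)"
      unfolding MN[symmetric] by (subst integral_distr) auto
    also have "\<dots> = (\<integral>p. ?v p * g (fst p *\<^sub>R snd p) \<partial>(lborel \<Otimes>\<^sub>M lborel))"
      using vnn by (subst integral_density) auto
    finally show ?thesis .
  qed
  \<comment> \<open>The weight 1/s cancels the factor s in \<open>g (s *\<^sub>R z)\<close>, so the
    integrand is the derivative of \<zeta> along the ray from t in direction z, and the integral is
    the difference of the limits at infinity and at t. Integrability along the ray is known only for
    almost every z.\<close>
  have ray: "(\<integral>s. ?v (s, z) * g (s *\<^sub>R z) \<partial>lborel) = indicator half_disc z * (\<zeta>i - \<zeta>0)"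
    if i: "integrable lborel (\<lambda>s. ?v (s, z) * g (s *\<^sub>R z))" for z
  proof (cases "z \<in> half_disc")
    case True
    then have z: "Im z > 0" by (auto simp: half_disc_def upper_half_def)
    then have z0: "z \<noteq> 0" by auto
    have H: "of_real t + s *\<^sub>R z \<in> upper_half" if "0 < s" for s
      using z that by (auto simp: upper_half_def)
    let ?F = "\<lambda>s. \<zeta> (of_real t + s *\<^sub>R z)" and ?f = "\<lambda>s. G (of_real t + s *\<^sub>R z) \<bullet> z"
    have feq: "?v (s, z) * g (s *\<^sub>R z) = indicator {0<..} s *\<^sub>R ?f s" for s
      using True H[of s] by (auto simp: g_def Gt_def split: split_indicator)
    have "(LBINT s=0..\<infinity>. ?f s) = \<zeta>i - \<zeta>0"
    proof (rule interval_integral_FTC_integrable)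
      show "(?F has_vector_derivative ?f s) (at s)" if "0 < ereal s" for s
      proof -
        have "((\<lambda>s. of_real t + s *\<^sub>R z) has_derivative (\<lambda>h. h *\<^sub>R z)) (at s)"
          by (auto intro!: derivative_eq_intros)
        from has_derivative_compose[OF this der[OF H]] that show ?thesis
          by (simp add: has_vector_derivative_def)
      qed
      show "isCont ?f s" if "0 < ereal s" for s
      proof -
        have "open upper_half" unfolding upper_half_def by (rule open_halfspace_Im_gt)
        then have "isCont G (of_real t + s *\<^sub>R z)"
          using cont H[of s] that by (simp add: continuous_on_eq_continuous_at)
        then show ?thesis by (intro continuous_intros isCont_o2[of s _ G]) auto
      qed
      show "set_integrable lborel (einterval 0 \<infinity>) ?f"
        using i unfolding feq set_integrable_def
        by (rule Bochner_Integration.integrable_cong[THEN iffD1, rotated -1]) (auto simp: einterval_iff split: split_indicator)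
      have "((\<lambda>s. of_real t + s *\<^sub>R z) \<longlongrightarrow> of_real t) (at_right 0)"
        by (auto intro!: tendsto_eq_intros)
      moreover have "eventually (\<lambda>s. of_real t + s *\<^sub>R z \<in> upper_half \<and> of_real t + s *\<^sub>R z \<noteq> of_real t) (at_right 0)"
        by (rule eventually_mono[OF eventually_at_right_less[of 0]]) (use H z0 in auto)
      ultimately have "filterlim (\<lambda>s. of_real t + s *\<^sub>R z) (at (of_real t) within upper_half) (at_right 0)"
        by (simp add: filterlim_at)
      from filterlim_compose[OF lim0 this]
      show "((?F \<circ> real_of_ereal) \<longlongrightarrow> \<zeta>0) (at_right 0)"
        unfolding zero_ereal_def ereal_tendsto_simps .
      have "filterlim (\<lambda>s. of_real t + s *\<^sub>R z) at_infinity at_top"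
      proof (rule tendsto_add_filterlim_at_infinity[OF tendsto_const])
        have "filterlim (\<lambda>s. norm (s *\<^sub>R z)) at_top at_top"
          using z0 by (auto intro!: filterlim_at_top_mult_tendsto_pos[OF tendsto_const] filterlim_abs_real)
        then show "filterlim (\<lambda>s. s *\<^sub>R z) at_infinity at_top"
          by (rule filterlim_norm_at_top_imp_at_infinity)
      qed
      moreover have "filterlim (\<lambda>s. of_real t + s *\<^sub>R z) (principal upper_half) at_top"
        unfolding filterlim_principal
        by (rule eventually_mono[OF eventually_gt_at_top[of 0]]) (use H in auto)
      ultimately have "filterlim (\<lambda>s. of_real t + s *\<^sub>R z) (inf at_infinity (principal upper_half)) at_top"
        by (simp add: filterlim_inf)
      from filterlim_compose[OF limi this]
      show "((?F \<circ> real_of_ereal) \<longlongrightarrow> \<zeta>i) (at_left \<infinity>)"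
        by (simp add: ereal_tendsto_simps)
    qed auto
    moreover have "(LBINT s=0..\<infinity>. ?f s) = (\<integral>s. ?v (s, z) * g (s *\<^sub>R z) \<partial>lborel)"
      unfolding feq interval_lebesgue_integral_def set_lebesgue_integral_def
      by (auto intro!: Bochner_Integration.integral_cong simp: einterval_iff split: split_indicator)
    ultimately show ?thesis using True by simp
  qed simp
  \<comment> \<open>The half disc has area pi/2, and \<open>?w\<close> carries a factor 1/2 compared
    with the kernel; together they give the factor pi.\<close>
  have hd: "emeasure lborel half_disc = ennreal (pi / 2)"
    using emeasure_half_disc[of 1] by (simp add: half_disc_def)
  have "(\<integral>y. ?w y * g y \<partial>lborel) = (\<integral>z. (\<integral>s. ?v (s, z) * g (s *\<^sub>R z) \<partial>lborel) \<partial>lborel)"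
    unfolding eq using lborel_pair.integral_snd[of "\<lambda>s z. ?v (s, z) * g (s *\<^sub>R z)"] p
    by (simp add: split_def)
  also have "\<dots> = (\<integral>z. indicator half_disc z * (\<zeta>i - \<zeta>0) \<partial>lborel)"
  proof (rule integral_cong_AE)
    have "AE z in lborel. integrable lborel (\<lambda>s. ?v (s, z) * g (s *\<^sub>R z))"
      using lborel_pair.AE_integrable_snd[of "\<lambda>s z. ?v (s, z) * g (s *\<^sub>R z)"] p by (simp add: split_def)
    then show "AE z in lborel. (\<integral>s. ?v (s, z) * g (s *\<^sub>R z) \<partial>lborel) = indicator half_disc z * (\<zeta>i - \<zeta>0)"
      by eventually_elim (rule ray)
  qed measurable
  also have "\<dots> = pi / 2 * (\<zeta>i - \<zeta>0)"
    using hd by (simp add: measure_def)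
  finally have A: "(\<integral>y. ?w y * g y \<partial>lborel) = pi / 2 * (\<zeta>i - \<zeta>0)" .
  have "(\<integral>y. ?w y * g y \<partial>lborel) = (\<integral>y. ?w (y - of_real t) * g (y - of_real t) \<partial>lborel)"
    using shift(2)[of "\<lambda>y. ?w (y - of_real t) * g (y - of_real t)"] by simp
  also have "\<dots> = (\<integral>z. (1/2) * (indicator upper_half z *\<^sub>R (G z \<bullet> ((z - of_real t) /\<^sub>R (cmod (z - of_real t))\<^sup>2))) \<partial>lborel)"
  proof (rule Bochner_Integration.integral_cong[OF refl])
    fix z
    have "z - of_real t \<in> upper_half \<longleftrightarrow> z \<in> upper_half" by (simp add: upper_half_def)
    then show "?w (z - of_real t) * g (z - of_real t)
      = (1/2) * (indicator upper_half z *\<^sub>R (G z \<bullet> ((z - of_real t) /\<^sub>R (cmod (z - of_real t))\<^sup>2)))"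
      unfolding g_def Gt_def by (cases "z \<in> upper_half") (simp_all add: inverse_eq_divide)
  qed
  also have "\<dots> = (1/2) * (LINT z:upper_half|lborel. G z \<bullet> ((z - of_real t) /\<^sub>R (cmod (z - of_real t))\<^sup>2))"
    unfolding set_lebesgue_integral_def by (rule integral_mult_right_zero)
  finally show ?thesis using A by simp
qed

section \<open>Smooth cut-offs\<close>

text \<open>\<open>Ck n\<close> asks for n derivatives on the whole line without continuity of the
  last one. Smoothness is \<open>Ck n\<close> for all n, and continuity at each order comes from the
  order above it.\<close>

primrec Ck :: "nat \<Rightarrow> (real \<Rightarrow> real) \<Rightarrow> bool" where
  "Ck 0 f \<longleftrightarrow> True"
| "Ck (Suc n) f \<longleftrightarrow> (\<exists>f'. (\<forall>x. (f has_real_derivative f' x) (at x)) \<and> Ck n f')"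

lemma Ck_Suc_imp: "Ck (Suc n) f \<Longrightarrow> Ck n f"
  by (induction n arbitrary: f) (simp, metis Ck.simps(2))

lemma Ck_SucI: "(\<And>x. (f has_real_derivative f' x) (at x)) \<Longrightarrow> Ck n f' \<Longrightarrow> Ck (Suc n) f"
  by auto

lemma Ck_const: "Ck n (\<lambda>x. c)"
  by (induction n arbitrary: c) (simp, rule Ck_SucI[of _ "\<lambda>_. 0"], auto)

lemma Ck_add: "Ck n f \<Longrightarrow> Ck n g \<Longrightarrow> Ck n (\<lambda>x. f x + g x)"
proof (induction n arbitrary: f g)
  case (Suc n)
  then obtain f' g' where "\<forall>x. (f has_real_derivative f' x) (at x)" "Ck n f'"
    "\<forall>x. (g has_real_derivative g' x) (at x)" "Ck n g'" by auto
  with Suc.IH show ?case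
    by (intro Ck_SucI[of _ "\<lambda>x. f' x + g' x"]) (auto intro!: derivative_eq_intros)
qed simp

lemma Ck_mult: "Ck n f \<Longrightarrow> Ck n g \<Longrightarrow> Ck n (\<lambda>x. f x * g x)"
proof (induction n arbitrary: f g)
  case (Suc n)
  then obtain f' g' where d: "\<forall>x. (f has_real_derivative f' x) (at x)" "Ck n f'"
    "\<forall>x. (g has_real_derivative g' x) (at x)" "Ck n g'" by auto
  have "Ck n f" "Ck n g" using Suc.prems by - (rule Ck_Suc_imp, assumption)+
  with d Suc.IH show ?case
    by (intro Ck_SucI[of _ "\<lambda>x. f' x * g x + f x * g' x"] Ck_add) (auto intro!: derivative_eq_intros)
qed simp

lemma Ck_cmult: "Ck n f \<Longrightarrow> Ck n (\<lambda>x. c * f x)"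
  by (rule Ck_mult[OF Ck_const])

lemma Ck_diff: "Ck n f \<Longrightarrow> Ck n g \<Longrightarrow> Ck n (\<lambda>x. f x - g x)"
  using Ck_add[OF _ Ck_cmult[of n g "-1"], of f] by simp

lemma Ck_affine: "Ck n f \<Longrightarrow> Ck n (\<lambda>x. f (a * x + b))"
proof (induction n arbitrary: f)
  case (Suc n)
  then obtain f' where f': "\<forall>x. (f has_real_derivative f' x) (at x)" "Ck n f'" by auto
  have "((\<lambda>x. f (a * x + b)) has_real_derivative a * f' (a * x + b)) (at x)" for x
  proof -
    have "((\<lambda>x. a * x + b) has_real_derivative a) (at x)" by (auto intro!: derivative_eq_intros)
    from DERIV_chain2[where f = f, OF f'(1)[rule_format] this] show ?thesis by (simp add: mult.commute)
  qed
  with f' Suc.IH show ?case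
    by (intro Ck_SucI[of _ "\<lambda>x. a * f' (a * x + b)"] Ck_cmult) auto
qed simp

lemma DERIV_power_nonzero:
  "x \<noteq> 0 \<Longrightarrow> ((\<lambda>x::real. x ^ k) has_real_derivative real k * x ^ k / x) (at x)"
  using DERIV_pow[of k x] by (cases k) auto

text \<open>The hypothesis that \<open>f\<close> vanishes near \<open>0\<close> makes the junk value of \<open>f x / x ^ k\<close> at \<open>0\<close> harmless.\<close>

lemma Ck_divide_power:
  assumes "Ck n f" "\<And>x. x < 1 \<Longrightarrow> f x = 0"
  shows "Ck n (\<lambda>x. f x / x ^ k)"
  using assms
proof (induction n arbitrary: f k)
  case (Suc n)
  then obtain f' where f': "\<forall>x. (f has_real_derivative f' x) (at x)" "Ck n f'" by auto
  have f'0: "f' x = 0" if "x < 1" for x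
  proof -
    have "(f has_real_derivative 0) (at x)"
      by (rule DERIV_cong_ev[THEN iffD1, OF refl _ refl DERIV_const[of 0]])
        (use Suc.prems(2) eventually_nhds_in_open[of "{..<1}" x] that in \<open>auto elim!: eventually_mono\<close>)
    with f'(1) show ?thesis using DERIV_unique by blast
  qed
  have "((\<lambda>x. f x / x ^ k) has_real_derivative f' x / x ^ k - real k * (f x / x ^ Suc k)) (at x)" for x
  proof (cases "x < 1")
    case True
    have "((\<lambda>x. f x / x ^ k) has_real_derivative 0) (at x)"
      by (rule DERIV_cong_ev[THEN iffD1, OF refl _ refl DERIV_const[of 0]])
        (use Suc.prems(2) eventually_nhds_in_open[of "{..<1}" x] True in \<open>auto elim!: eventually_mono\<close>)
    with True f'0 Suc.prems(2) show ?thesis by simp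
  next
    case False
    then have "x \<noteq> 0" by simp
    show ?thesis
      by (rule DERIV_cong[OF DERIV_divide[OF f'(1)[rule_format] DERIV_power_nonzero]])
        (use \<open>x \<noteq> 0\<close> in \<open>auto simp: field_simps\<close>)
  qed
  moreover have "Ck n f" by (rule Ck_Suc_imp) fact
  ultimately show ?case
    using Suc.IH[OF f'(2) f'0] Suc.IH[of f "Suc k"] Suc.prems(2)
    by (intro Ck_SucI[of _ "\<lambda>x. f' x / x ^ k - real k * (f x / x ^ Suc k)"] Ck_diff Ck_cmult) auto
qed simp

text \<open>The flat function exp (-1/x) together with its quotients by powers of x: differentiation
  maps this family into its linear span, so smoothness follows by an induction that treats all k at
  once.\<close>

definition flat_exp :: "nat \<Rightarrow> real \<Rightarrow> real" where
  "flat_exp k x = (if x > 0 then exp (- 1 / x) / x ^ k else 0)"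

lemma flat_exp_tendsto_0: "(flat_exp k \<longlongrightarrow> 0) (at 0)"
proof -
  have "((\<lambda>x::real. inverse x ^ k / exp (inverse x)) \<longlongrightarrow> 0) (at_right 0)"
    by (rule filterlim_compose[OF tendsto_power_div_exp_0 filterlim_inverse_at_top_right])
  then have "(flat_exp k \<longlongrightarrow> 0) (at_right 0)"
    by (rule Lim_transform_eventually)
      (auto simp: eventually_at_right_field flat_exp_def exp_minus divide_inverse power_inverse
        intro!: exI[of _ 1])
  moreover have "(flat_exp k \<longlongrightarrow> 0) (at_left 0)"
    by (rule Lim_transform_eventually[OF tendsto_const])
      (auto simp: eventually_at_left_field flat_exp_def intro!: exI[of _ "-1"])
  ultimately show ?thesis by (simp add: filterlim_split_at)
qed

lemma flat_exp_deriv: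
  "(flat_exp k has_real_derivative flat_exp (k + 2) x - real k * flat_exp (k + 1) x) (at x)"
proof (cases x "0::real" rule: linorder_cases)
  case less
  have "(flat_exp k has_real_derivative 0) (at x)"
    by (rule DERIV_cong_ev[THEN iffD1, OF refl _ refl DERIV_const[of 0]])
      (use eventually_nhds_in_open[of "{..<0}" x] less in \<open>auto elim!: eventually_mono simp: flat_exp_def\<close>)
  with less show ?thesis by (simp add: flat_exp_def)
next
  case equal
  \<comment> \<open>The difference quotient at 0 is \<open>flat_exp (Suc k)\<close>, which tends to
    0, as does the claimed formula by its default value at 0.\<close>
  have "((\<lambda>h. (flat_exp k (0 + h) - flat_exp k 0) / h) \<longlongrightarrow> 0) (at 0)"
    by (rule Lim_transform_eventually[OF flat_exp_tendsto_0[of "Suc k"]])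
      (auto simp: flat_exp_def eventually_at_filter)
  with equal show ?thesis by (simp add: flat_exp_def DERIV_def)
next
  case greater
  have "((\<lambda>x. exp (- 1 / x) / x ^ k) has_real_derivative
      exp (- 1 / x) / x ^ (k + 2) - real k * (exp (- 1 / x) / x ^ (k + 1))) (at x)"
  proof -
    have "((\<lambda>x. exp (- 1 / x)) has_real_derivative exp (- 1 / x) / x\<^sup>2) (at x)"
      using greater by (auto intro!: derivative_eq_intros simp: field_simps power2_eq_square)
    then show ?thesis
      by (rule DERIV_cong[OF DERIV_divide[OF _ DERIV_power_nonzero]])
        (use greater in \<open>auto simp: field_simps power2_eq_square\<close>)
  qed
  then show ?thesis
    by (subst DERIV_cong_ev[OF refl _ refl, of _ "\<lambda>x. exp (- 1 / x) / x ^ k"])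
      (use eventually_nhds_in_open[of "{0<..}" x] greater in \<open>auto elim!: eventually_mono simp: flat_exp_def\<close>)
qed

lemma Ck_flat_exp: "Ck n (flat_exp k)"
  by (induction n arbitrary: k) (simp, rule Ck_SucI[OF flat_exp_deriv], intro Ck_diff Ck_cmult, auto)

definition bump :: "real \<Rightarrow> real" where
  "bump x = flat_exp 0 (x - 1) * flat_exp 0 (2 - x)"

lemma Ck_bump: "Ck n bump"
proof -
  have "Ck n (\<lambda>x. flat_exp 0 (1 * x + (- 1)) * flat_exp 0 ((- 1) * x + 2))"
    by (intro Ck_mult Ck_affine Ck_flat_exp)
  then show ?thesis by (simp add: bump_def[abs_def])
qed

lemma bump_pos: "1 < x \<Longrightarrow> x < 2 \<Longrightarrow> 0 < bump x"
  and bump_eq_0: "x \<le> 1 \<or> 2 \<le> x \<Longrightarrow> bump x = 0"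
  and bump_nonneg: "0 \<le> bump x"
  by (auto simp: bump_def flat_exp_def)

lemma bump_le_1: "bump x \<le> 1"
  by (auto simp: bump_def flat_exp_def intro!: mult_le_one)

lemma Ck_imp_continuous: "Ck (Suc n) f \<Longrightarrow> continuous_on A f"
  by (metis Ck.simps(2) DERIV_isCont continuous_at_imp_continuous_on)

lemma continuous_bump: "continuous_on A bump"
  by (rule Ck_imp_continuous[of 0]) (rule Ck_bump)

text \<open>Determined only up to an additive constant, so it enters only through differences of its
  values and through its derivative.\<close>

definition antiderivative :: "(real \<Rightarrow> real) \<Rightarrow> real \<Rightarrow> real" where
  "antiderivative f = (SOME F. \<forall>x. (F has_real_derivative f x) (at x))"

lemma antiderivative:
  assumes "continuous_on UNIV f"
  shows "(antiderivative f has_real_derivative f x) (at x)"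
proof -
  have "\<exists>F. \<forall>x. - \<infinity> < ereal x \<longrightarrow> ereal x < \<infinity> \<longrightarrow> (F has_vector_derivative f x) (at x)"
    by (rule einterval_antiderivative) (use assms in \<open>auto simp: continuous_on_eq_continuous_at\<close>)
  then have "\<exists>F. \<forall>x. (F has_real_derivative f x) (at x)"
    by (simp add: has_real_derivative_iff_has_vector_derivative)
  from someI_ex[OF this] show ?thesis unfolding antiderivative_def by blast
qed

definition step_mass :: real where
  "step_mass = antiderivative bump 2 - antiderivative bump 1"

text \<open>Rises from 0 to 1 between 1 and 2. Its arguments will be squared distances divided by
  squared radii, which keeps the resulting radial cut-offs smooth at their centre.\<close>

definition step :: "real \<Rightarrow> real" where
  "step x = (antiderivative bump x - antiderivative bump 1) / step_mass"

definition step' :: "real \<Rightarrow> real" where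
  "step' x = bump x / step_mass"

lemma step_mass_pos: "0 < step_mass"
proof -
  obtain z where "1 < z" "z < 2" "antiderivative bump 2 - antiderivative bump 1 = (2 - 1) * bump z"
    using MVT2[of 1 2 "antiderivative bump" bump] antiderivative[OF continuous_bump] by auto
  then show ?thesis using bump_pos[of z] by (simp add: step_mass_def)
qed

lemma step_deriv: "(step has_real_derivative step' x) (at x)"
  unfolding step_def[abs_def] step'_def using step_mass_pos
  by (auto intro!: derivative_eq_intros antiderivative continuous_bump)

lemma Ck_step': "Ck n step'"
  using Ck_cmult[OF Ck_bump, of n "1 / step_mass"] by (simp add: step'_def[abs_def])

lemma Ck_step: "Ck n step"
  by (cases n) (simp, blast intro: Ck_SucI step_deriv Ck_step')

lemma step'_nonneg: "0 \<le> step' x"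
  and step'_eq_0: "x \<le> 1 \<or> 2 \<le> x \<Longrightarrow> step' x = 0"
  and step'_pos: "1 < x \<Longrightarrow> x < 2 \<Longrightarrow> 0 < step' x"
  and step'_le: "step' x \<le> 1 / step_mass"
  using step_mass_pos bump_nonneg[of x] bump_eq_0[of x] bump_pos[of x] bump_le_1[of x]
  by (auto simp: step'_def divide_right_mono)

lemma continuous_step': "continuous_on A step'" and continuous_step: "continuous_on A step"
  by (rule Ck_imp_continuous[of 0], rule Ck_step' Ck_step)+

lemma DERIV_zero_on_interval_eq:
  fixes f :: "real \<Rightarrow> real"
  assumes "\<And>x. (f has_real_derivative f' x) (at x)" "\<And>x. a < x \<Longrightarrow> x < b \<Longrightarrow> f' x = 0" "a \<le> b"
  shows "f a = f b"
proof (cases "a < b")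
  case True
  then obtain z where "a < z" "z < b" "f b - f a = (b - a) * f' z"
    using MVT2[of a b f f'] assms(1) by auto
  then show ?thesis using assms(2)[of z] by simp
qed (use assms(3) in simp)

lemma step_eq_0: "x \<le> 1 \<Longrightarrow> step x = 0"
  using DERIV_zero_on_interval_eq[of step step' x 1] step_deriv step'_eq_0 by (simp add: step_def)

lemma step_eq_1: "2 \<le> x \<Longrightarrow> step x = 1"
  using DERIV_zero_on_interval_eq[of step step' 2 x] step_deriv step'_eq_0 step_mass_pos
  by (simp add: step_def step_mass_def)

lemma step_mono: "x \<le> y \<Longrightarrow> step x \<le> step y"
  by (rule DERIV_nonneg_imp_nondecreasing[of x y step]) (use step_deriv step'_nonneg in auto)

lemma step_bounds: "0 \<le> step x" "step x \<le> 1"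
  using step_mono[of "min x 1" x] step_mono[of x "max x 2"] step_eq_0[of "min x 1"] step_eq_1[of "max x 2"] by auto

section \<open>Smooth functions on the plane and gradients\<close>

primrec Ck2 :: "nat \<Rightarrow> (complex \<Rightarrow> real) \<Rightarrow> bool" where
  "Ck2 0 f \<longleftrightarrow> True"
| "Ck2 (Suc n) f \<longleftrightarrow> (\<exists>fx fy. (\<forall>z. (f has_derivative (\<lambda>h. Re h * fx z + Im h * fy z)) (at z)) \<and> Ck2 n fx \<and> Ck2 n fy)"

lemma Ck2_Suc_imp: "Ck2 (Suc n) f \<Longrightarrow> Ck2 n f"
  by (induction n arbitrary: f) (simp, metis Ck2.simps(2))

lemma Ck2_SucI:
  "(\<And>z. (f has_derivative (\<lambda>h. Re h * fx z + Im h * fy z)) (at z)) \<Longrightarrow> Ck2 n fx \<Longrightarrow> Ck2 n fy \<Longrightarrow> Ck2 (Suc n) f"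
  by auto

lemma Ck2_const: "Ck2 n (\<lambda>z. c)"
  by (induction n arbitrary: c) (simp, rule Ck2_SucI[of _ "\<lambda>_. 0" "\<lambda>_. 0"], auto)

lemma Ck2_Re: "Ck2 n Re" and Ck2_Im: "Ck2 n Im"
proof -
  show "Ck2 n Re"
    by (cases n) (simp, auto intro!: Ck2_SucI[of _ "\<lambda>_. 1" "\<lambda>_. 0"] Ck2_const derivative_eq_intros simp del: Ck2.simps)
  show "Ck2 n Im"
    by (cases n) (simp, auto intro!: Ck2_SucI[of _ "\<lambda>_. 0" "\<lambda>_. 1"] Ck2_const derivative_eq_intros simp del: Ck2.simps)
qed

lemma Ck2_add: "Ck2 n f \<Longrightarrow> Ck2 n g \<Longrightarrow> Ck2 n (\<lambda>x. f x + g x)"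
proof (induction n arbitrary: f g)
  case (Suc n)
  then obtain fx fy gx gy where d: "\<forall>z. (f has_derivative (\<lambda>h. Re h * fx z + Im h * fy z)) (at z)"
      "Ck2 n fx" "Ck2 n fy" "\<forall>z. (g has_derivative (\<lambda>h. Re h * gx z + Im h * gy z)) (at z)"
      "Ck2 n gx" "Ck2 n gy" by auto
  with Suc.IH show ?case
    by (intro Ck2_SucI[of _ "\<lambda>x. fx x + gx x" "\<lambda>x. fy x + gy x"])
      (auto intro!: derivative_eq_intros simp: algebra_simps)
qed simp

lemma Ck2_mult: "Ck2 n f \<Longrightarrow> Ck2 n g \<Longrightarrow> Ck2 n (\<lambda>x. f x * g x)"
proof (induction n arbitrary: f g)
  case (Suc n)
  then obtain fx fy gx gy where d: "\<forall>z. (f has_derivative (\<lambda>h. Re h * fx z + Im h * fy z)) (at z)"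
      "Ck2 n fx" "Ck2 n fy" "\<forall>z. (g has_derivative (\<lambda>h. Re h * gx z + Im h * gy z)) (at z)"
      "Ck2 n gx" "Ck2 n gy" by auto
  have "Ck2 n f" "Ck2 n g" using Suc.prems by - (rule Ck2_Suc_imp, assumption)+
  with d Suc.IH show ?case
    by (intro Ck2_SucI[of _ "\<lambda>x. fx x * g x + f x * gx x" "\<lambda>x. fy x * g x + f x * gy x"] Ck2_add)
      (auto intro!: derivative_eq_intros simp: algebra_simps)
qed simp

lemma Ck2_compose: "Ck n h \<Longrightarrow> Ck2 n q \<Longrightarrow> Ck2 n (\<lambda>z. h (q z))"
proof (induction n arbitrary: h)
  case (Suc n)
  then obtain qx qy h' where d: "\<forall>z. (q has_derivative (\<lambda>h. Re h * qx z + Im h * qy z)) (at z)"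
      "Ck2 n qx" "Ck2 n qy" "\<forall>x. (h has_real_derivative h' x) (at x)" "Ck n h'" by auto
  have q: "Ck2 n q" using Suc.prems by - (rule Ck2_Suc_imp, assumption)+
  have "((\<lambda>z. h (q z)) has_derivative (\<lambda>k. Re k * (h' (q z) * qx z) + Im k * (h' (q z) * qy z))) (at z)" for z
    using has_derivative_compose[OF d(1)[rule_format, of z] d(4)[rule_format, of "q z", THEN has_field_derivative_imp_has_derivative]]
    by (simp add: algebra_simps)
  with d q Suc.IH[OF d(5) q] show ?case
    by (intro Ck2_SucI[of _ "\<lambda>z. h' (q z) * qx z" "\<lambda>z. h' (q z) * qy z"] Ck2_mult) auto
qed simp

text \<open>Each partial derivative costs one order, so the induction over \<open>bs\<close> has to
  carry all orders at once.\<close>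

lemma Ck2_iter_partial:
  "\<forall>n. Ck2 n f \<Longrightarrow> \<forall>n. Ck2 n (iter_partial bs f)"
proof (induction bs)
  case (Cons b bs)
  show ?case
  proof
    fix n
    obtain fx fy where d: "\<And>z. (iter_partial bs f has_derivative (\<lambda>h. Re h * fx z + Im h * fy z)) (at z)"
      "Ck2 n fx" "Ck2 n fy"
      using Cons.IH[OF Cons.prems, rule_format, of "Suc n"] by auto
    have "frechet_derivative (iter_partial bs f) (at z) = (\<lambda>h. Re h * fx z + Im h * fy z)" for z
      using frechet_derivative_at[OF d(1)[of z]] by simp
    then have "iter_partial (b # bs) f = (if b then fx else fy)"
      by (auto simp: partial_def fun_eq_iff)
    with d show "Ck2 n (iter_partial (b # bs) f)" by simp
  qed
qed simp

lemma smoothI: "(\<And>n. Ck2 n f) \<Longrightarrow> smooth f"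
  unfolding smooth_def
proof (intro allI)
  fix bs z
  assume "\<And>n. Ck2 n f"
  then have "Ck2 (Suc 0) (iter_partial bs f)"
    using Ck2_iter_partial[of f bs] by blast
  then show "iter_partial bs f differentiable (at z)"
    by (auto simp: differentiable_def)
qed

lemma grad_eqI: "(f has_derivative (\<lambda>h. g \<bullet> h)) (at z) \<Longrightarrow> grad f z = g"
  using frechet_derivative_at[of f "\<lambda>h. g \<bullet> h" z]
  by (auto simp: grad_def inner_complex_def complex_eq_iff dest: sym)

lemma has_derivative_grad: "f differentiable (at z) \<Longrightarrow> (f has_derivative (\<lambda>h. grad f z \<bullet> h)) (at z)"
proof -
  assume "f differentiable (at z)"
  then have d: "(f has_derivative frechet_derivative f (at z)) (at z)"
    by (simp add: frechet_derivative_works)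
  then have l: "linear (frechet_derivative f (at z))" by (rule has_derivative_linear)
  have "frechet_derivative f (at z) h = grad f z \<bullet> h" for h
  proof -
    have h: "Re h *\<^sub>R 1 + Im h *\<^sub>R \<i> = h" by (simp add: complex_eq_iff)
    have "frechet_derivative f (at z) (Re h *\<^sub>R 1 + Im h *\<^sub>R \<i>)
        = Re h *\<^sub>R frechet_derivative f (at z) 1 + Im h *\<^sub>R frechet_derivative f (at z) \<i>"
      by (simp only: linear_add[OF l] linear_scale[OF l])
    then have "frechet_derivative f (at z) h
        = Re h *\<^sub>R frechet_derivative f (at z) 1 + Im h *\<^sub>R frechet_derivative f (at z) \<i>"
      unfolding h .
    then show ?thesis by (simp add: grad_def inner_complex_def mult.commute)
  qed
  then have "frechet_derivative f (at z) = (\<lambda>h. grad f z \<bullet> h)" by (rule ext)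
  then show ?thesis using d by simp
qed

section \<open>Integration by parts\<close>

text \<open>The derivative is only integrable, not continuous. The gauge integral version of the
  fundamental theorem asks for no continuity, and it agrees with the Lebesgue integral where the
  latter exists. A weak solution has just this regularity along almost every line.\<close>

lemma set_integral_FTC_Icc:
  fixes \<phi> Q :: "real \<Rightarrow> real"
  assumes "a \<le> b" "\<And>x. a \<le> x \<Longrightarrow> x \<le> b \<Longrightarrow> (\<phi> has_real_derivative Q x) (at x)"
    and "set_integrable lborel {a..b} Q"
  shows "(LINT x:{a..b}|lborel. Q x) = \<phi> b - \<phi> a"
proof -
  have "(Q has_integral \<phi> b - \<phi> a) {a..b}"
    using assms(1,2)
    by (intro fundamental_theorem_of_calculus)
      (auto simp flip: has_real_derivative_iff_has_vector_derivative intro: has_field_derivative_at_within)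
  then show ?thesis
    using set_borel_integral_eq_integral(2)[OF assms(3)] by (simp add: integral_unique)
qed

lemma integral_FTC_half_line:
  fixes \<phi> Q :: "real \<Rightarrow> real"
  assumes d: "\<And>x. a \<le> x \<Longrightarrow> (\<phi> has_real_derivative Q x) (at x)"
    and i: "integrable lborel (\<lambda>x. indicator {a<..} x * Q x)"
    and z: "\<And>x. b < x \<Longrightarrow> Q x = 0 \<and> \<phi> x = 0"
  shows "(\<integral>x. indicator {a<..} x * Q x \<partial>lborel) = - \<phi> a"
proof -
  let ?c = "max a b + 1"
  have eq: "AE x in lborel. indicator {a<..} x * Q x = indicator {a..?c} x *\<^sub>R Q x"
    using AE_lborel_singleton[of a]
  proof eventually_elim
    case (elim x)
    have "Q x = 0" if "x > ?c" using that z by auto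
    then show ?case using elim by (auto split: split_indicator)
  qed
  have [measurable]: "(\<lambda>x. indicator {a<..} x * Q x) \<in> borel_measurable borel" using i by auto
  have m: "(\<lambda>x. indicator {a..?c} x *\<^sub>R Q x) \<in> borel_measurable borel"
  proof -
    have "(\<lambda>x. indicator {a..?c} x *\<^sub>R (indicator {a<..} x * Q x) + indicator {a} x * Q a) \<in> borel_measurable borel"
      by measurable
    also have "(\<lambda>x. indicator {a..?c} x *\<^sub>R (indicator {a<..} x * Q x) + indicator {a} x * Q a)
       = (\<lambda>x. indicator {a..?c} x *\<^sub>R Q x)"
      by (auto simp: fun_eq_iff split: split_indicator)
    finally show ?thesis .
  qed
  have "set_integrable lborel {a..?c} Q"
    unfolding set_integrable_def using i eq m by (subst (asm) integrable_cong_AE) auto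
  from set_integral_FTC_Icc[OF _ d this] z[of ?c]
  have "(LINT x:{a..?c}|lborel. Q x) = - \<phi> a" by auto
  moreover have "(\<integral>x. indicator {a<..} x * Q x \<partial>lborel) = (LINT x:{a..?c}|lborel. Q x)"
    unfolding set_lebesgue_integral_def using eq m by (intro integral_cong_AE) auto
  ultimately show ?thesis by simp
qed

lemma integral_FTC_line:
  fixes \<phi> Q :: "real \<Rightarrow> real"
  assumes d: "\<And>x. (\<phi> has_real_derivative Q x) (at x)"
    and i: "integrable lborel Q"
    and z: "\<And>x. b < \<bar>x\<bar> \<Longrightarrow> Q x = 0 \<and> \<phi> x = 0"
  shows "(\<integral>x. Q x \<partial>lborel) = 0"
proof -
  let ?a = "- \<bar>b\<bar> - 1"
  have eq: "indicator {?a<..} x * Q x = Q x" for x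
    using z[of x] by (auto split: split_indicator)
  have "(\<integral>x. indicator {?a<..} x * Q x \<partial>lborel) = - \<phi> ?a"
    by (rule integral_FTC_half_line[OF d, of _ b]) (use i z in \<open>auto simp: eq\<close>)
  then show ?thesis using z[of ?a] by (simp add: eq)
qed

lemma has_derivative_imp_partials:
  assumes "(w has_derivative (\<lambda>h. W \<bullet> h)) (at (Complex x y))"
  shows "((\<lambda>s. w (Complex s y)) has_real_derivative Re W) (at x)"
    and "((\<lambda>s. w (Complex x s)) has_real_derivative Im W) (at y)"
proof -
  have "((\<lambda>s. Complex s y) has_derivative (\<lambda>h. of_real h)) (at x)"
    "((\<lambda>s. Complex x s) has_derivative (\<lambda>h. \<i> * of_real h)) (at y)"
    unfolding Complex_eq by (auto intro!: derivative_eq_intros)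
  from has_derivative_compose[OF this(1), of w, OF assms] has_derivative_compose[OF this(2), of w, OF assms]
  show "((\<lambda>s. w (Complex s y)) has_real_derivative Re W) (at x)"
    "((\<lambda>s. w (Complex x s)) has_real_derivative Im W) (at y)"
    by (simp_all add: has_field_derivative_def inner_complex_def mult_commute_abs)
qed

lemma open_upper_half: "open upper_half"
  unfolding upper_half_def by (rule open_halfspace_Im_gt)

lemma has_derivative_upper_half_continuous:
  assumes "\<And>z. z \<in> upper_half \<Longrightarrow> (w has_derivative (\<lambda>h. W z \<bullet> h)) (at z)"
  shows "continuous_on upper_half w"
  using assms by (auto intro!: continuous_at_imp_continuous_on dest!: has_derivative_continuous)

text \<open>The gradient of a function that is merely differentiable is a pointwise limit of
  difference quotients along steps 1/(n+1). Only directions e with Im e >= 0 are used, so that the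
  shifted points stay in the half plane.\<close>

lemma borel_measurable_indicator_grad:
  fixes w :: "complex \<Rightarrow> real"
  assumes w: "\<And>z. z \<in> upper_half \<Longrightarrow> (w has_derivative (\<lambda>h. W z \<bullet> h)) (at z)"
  shows "(\<lambda>z. indicator upper_half z *\<^sub>R W z) \<in> borel_measurable borel"
proof -
  define v where "v z = indicator upper_half z *\<^sub>R w z" for z
  have [measurable]: "v \<in> borel_measurable borel"
    unfolding v_def[abs_def]
    by (rule borel_measurable_continuous_on_indicator) (use has_derivative_upper_half_continuous[OF w] in auto)
  have lim: "(\<lambda>n. indicator upper_half z * ((v (z + of_real (inverse (real (Suc n))) * e) - v z) / inverse (real (Suc n))))
       \<longlonglongrightarrow> indicator upper_half z * (W z \<bullet> e)" if e: "Im e \<ge> 0" for z e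
  proof (cases "z \<in> upper_half")
    case True
    have "((\<lambda>s. z + of_real s * e) has_derivative (\<lambda>h. of_real h * e)) (at 0)"
      by (auto intro!: derivative_eq_intros)
    moreover have "(w has_derivative (\<lambda>h. W z \<bullet> h)) (at (z + of_real 0 * e))"
      using w[OF True] by simp
    ultimately have "((\<lambda>s. w (z + of_real s * e)) has_derivative (\<lambda>h. W z \<bullet> (of_real h * e))) (at 0)"
      by (rule has_derivative_compose)
    moreover have "(\<lambda>h. W z \<bullet> (of_real h * e)) = (*) (W z \<bullet> e)"
      by (simp add: fun_eq_iff inner_complex_def algebra_simps)
    ultimately have "((\<lambda>s. w (z + of_real s * e)) has_real_derivative W z \<bullet> e) (at 0)"
      by (simp add: has_field_derivative_def)
    then have "((\<lambda>h. (w (z + of_real h * e) - w z) / h) \<longlongrightarrow> W z \<bullet> e) (at 0)"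
      by (simp add: DERIV_def)
    then have "(\<lambda>n. (w (z + of_real (inverse (real (Suc n))) * e) - w z) / inverse (real (Suc n))) \<longlonglongrightarrow> W z \<bullet> e"
      by (rule filterlim_compose)
        (auto simp: filterlim_at intro!: always_eventually LIMSEQ_inverse_real_of_nat simp del: of_nat_Suc)
    moreover have "z + of_real (inverse (real (Suc n))) * e \<in> upper_half" for n
      using True e by (auto simp: upper_half_def intro!: add_pos_nonneg)
    ultimately show ?thesis using True by (simp add: v_def)
  qed simp
  have "(\<lambda>z. indicator upper_half z * (W z \<bullet> e)) \<in> borel_measurable borel" if "Im e \<ge> 0" for e
    by (rule borel_measurable_LIMSEQ_real[OF lim[OF that]]) measurable
  from this[of 1] this[of \<i>]
  have [measurable]: "(\<lambda>z. indicator upper_half z * Re (W z)) \<in> borel_measurable borel"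
    "(\<lambda>z. indicator upper_half z * Im (W z)) \<in> borel_measurable borel"
    by (simp_all add: inner_complex_def)
  have "(\<lambda>z. Complex (indicator upper_half z * Re (W z)) (indicator upper_half z * Im (W z))) \<in> borel_measurable borel"
    by measurable
  also have "(\<lambda>z. Complex (indicator upper_half z * Re (W z)) (indicator upper_half z * Im (W z)))
     = (\<lambda>z. indicator upper_half z *\<^sub>R W z)"
    by (auto simp: complex_eq_iff)
  finally show ?thesis .
qed

lemma integrable_continuous_compact_support:
  fixes f :: "complex \<Rightarrow> real"
  assumes "continuous_on K f" "compact K" "\<And>z. z \<notin> K \<Longrightarrow> f z = 0"
  shows "integrable lborel f"
proof -
  have "integrable lborel (\<lambda>z. indicator K z *\<^sub>R f z)"
    by (rule borel_integrable_compact) fact+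
  also have "(\<lambda>z. indicator K z *\<^sub>R f z) = f"
    using assms(3) by (auto split: split_indicator)
  finally show ?thesis .
qed

lemma continuous_on_closed_half_plane:
  assumes "\<And>z. z \<in> upper_half \<Longrightarrow> (w has_derivative (\<lambda>h. W z \<bullet> h)) (at z)" "0 < \<eta>"
  shows "continuous_on {z. \<eta> \<le> Im z} w"
  by (rule continuous_on_subset[OF has_derivative_upper_half_continuous[OF assms(1)]])
    (use assms(2) in \<open>auto simp: upper_half_def\<close>)

lemma integrable_half_plane_compact_support:
  fixes f :: "complex \<Rightarrow> real"
  assumes w: "\<And>z. z \<in> upper_half \<Longrightarrow> (w has_derivative (\<lambda>h. W z \<bullet> h)) (at z)"
    and f: "0 < \<eta>" "continuous_on UNIV f" "\<And>z. \<rho> < cmod z \<Longrightarrow> f z = 0"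
  shows "integrable lborel (\<lambda>z. indicator {z. \<eta> < Im z} z * (w z * f z))"
proof -
  have cl: "closed {z. \<eta> \<le> Im z}" by (rule closed_halfspace_Im_ge)
  have [measurable]: "{z. \<eta> < Im z} \<in> sets borel" by measurable
  let ?K = "cball 0 \<rho> \<inter> {z. \<eta> \<le> Im z}"
  have "integrable lborel (\<lambda>z. indicator ?K z *\<^sub>R (w z * f z))"
    by (rule borel_integrable_compact)
     (use f cl in \<open>auto intro!: compact_Int_closed continuous_on_mult
        intro: continuous_on_subset[OF continuous_on_closed_half_plane[OF w f(1)]] continuous_on_subset[OF f(2)]\<close>)
  then have "integrable lborel (\<lambda>z. indicator {z. \<eta> < Im z} z *\<^sub>R (indicator ?K z *\<^sub>R (w z * f z)))"
    by (rule integrable_mult_indicator[rotated]) auto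
  also have "(\<lambda>z. indicator {z. \<eta> < Im z} z *\<^sub>R (indicator ?K z *\<^sub>R (w z * f z)))
      = (\<lambda>z. indicator {z. \<eta> < Im z} z * (w z * f z))"
    using f(3) by (auto simp: fun_eq_iff split: split_indicator)
  finally show ?thesis .
qed

text \<open>Above height \<eta> the horizontal part integrates to 0 on almost every line by compact
  support, and the vertical part leaves the boundary term w V2 at height \<eta>. No boundary values
  of w are available, but V2 vanishes on the real line, so this term is O(\<eta>) once w is bounded
  at height \<eta> by a function of x that is integrable and independent of \<eta>. Convergence of
  the integral of w up to the real line is not claimed in advance, hence the form as a limit over
  truncated half planes.\<close>

lemma half_plane_integration_by_parts:
  fixes w V1 V2 V1x V2y :: "complex \<Rightarrow> real"
  assumes w: "\<And>z. z \<in> upper_half \<Longrightarrow> (w has_derivative (\<lambda>h. W z \<bullet> h)) (at z)"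
    and W2: "set_integrable lborel upper_half (\<lambda>z. (cmod (W z))\<^sup>2)"
    and V1: "\<And>x y. ((\<lambda>x. V1 (Complex x y)) has_real_derivative V1x (Complex x y)) (at x)"
    and V2: "\<And>x y. ((\<lambda>y. V2 (Complex x y)) has_real_derivative V2y (Complex x y)) (at y)"
    and cont: "continuous_on UNIV V1" "continuous_on UNIV V2" "continuous_on UNIV V1x" "continuous_on UNIV V2y"
    and supp: "\<And>z. \<rho> < cmod z \<Longrightarrow> V1 z = 0 \<and> V2 z = 0 \<and> V1x z = 0 \<and> V2y z = 0"
    and V20: "\<And>x. V2 (of_real x) = 0"
    and zero: "(LINT z:upper_half|lborel. Re (W z) * V1 z + Im (W z) * V2 z) = 0"
  shows "(\<lambda>n. LINT z:{z. inverse (real (Suc n)) < Im z}|lborel. w z * (V1x z + V2y z)) \<longlonglongrightarrow> 0"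
proof -
  have [measurable]: "V1 \<in> borel_measurable borel" "V2 \<in> borel_measurable borel"
     "V1x \<in> borel_measurable borel" "V2y \<in> borel_measurable borel"
    using cont by (auto intro: borel_measurable_continuous_onI)
  define Wt where "Wt z = indicator upper_half z *\<^sub>R W z" for z
  have [measurable]: "Wt \<in> borel_measurable borel"
    unfolding Wt_def[abs_def] by (rule borel_measurable_indicator_grad[OF w])
  have Wt2: "integrable lborel (\<lambda>z. (cmod (Wt z))\<^sup>2)"
    using W2 unfolding set_integrable_def Wt_def
    by (rule Bochner_Integration.integrable_cong[THEN iffD1, rotated -1]) (auto split: split_indicator)
  have intK: "integrable lborel f" if "continuous_on UNIV f" "\<And>z. \<rho> < cmod z \<Longrightarrow> f z = 0" for f :: "complex \<Rightarrow> real"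
    by (rule integrable_continuous_compact_support[of "cball 0 \<rho>"])
      (use that in \<open>auto intro: continuous_on_subset\<close>)
  have ii: "integrable lborel (\<lambda>z. (V1 z)\<^sup>2 + (V2 z)\<^sup>2)"
    by (rule intK) (use supp cont in \<open>auto intro!: continuous_intros\<close>)
  have prod: "integrable lborel (\<lambda>z. Re (Wt z) * V1 z)" "integrable lborel (\<lambda>z. Im (Wt z) * V2 z)"
  proof -
    have *: "\<bar>a * b\<bar> \<le> a\<^sup>2 + b\<^sup>2" for a b :: real
    proof -
      have "2 * \<bar>a * b\<bar> \<le> a\<^sup>2 + b\<^sup>2"
        using sum_squares_bound[of "\<bar>a\<bar>" "\<bar>b\<bar>"] by (simp add: abs_mult mult.assoc)
      then show ?thesis using abs_ge_zero[of "a * b"] by linarith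
    qed
    have sq: "(cmod z)\<^sup>2 = (Re z)\<^sup>2 + (Im z)\<^sup>2" for z by (rule cmod_power2)
    have i: "integrable lborel (\<lambda>z. (cmod (Wt z))\<^sup>2 + ((V1 z)\<^sup>2 + (V2 z)\<^sup>2))"
      using Wt2 ii by (rule Bochner_Integration.integrable_add)
    show "integrable lborel (\<lambda>z. Re (Wt z) * V1 z)"
    proof (rule Bochner_Integration.integrable_bound[OF i], measurable, rule AE_I2)
      fix z show "norm (Re (Wt z) * V1 z) \<le> norm ((cmod (Wt z))\<^sup>2 + ((V1 z)\<^sup>2 + (V2 z)\<^sup>2))"
        using *[of "Re (Wt z)" "V1 z"] zero_le_power2[of "Im (Wt z)"] zero_le_power2[of "V2 z"]
        unfolding sq real_norm_def by linarith
    qed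
    show "integrable lborel (\<lambda>z. Im (Wt z) * V2 z)"
    proof (rule Bochner_Integration.integrable_bound[OF i], measurable, rule AE_I2)
      fix z show "norm (Im (Wt z) * V2 z) \<le> norm ((cmod (Wt z))\<^sup>2 + ((V1 z)\<^sup>2 + (V2 z)\<^sup>2))"
        using *[of "Im (Wt z)" "V2 z"] zero_le_power2[of "Re (Wt z)"] zero_le_power2[of "V1 z"]
        unfolding sq real_norm_def by linarith
    qed
  qed
  note contw = continuous_on_closed_half_plane[OF w]
  have intw: "integrable lborel (\<lambda>z. indicator {z. \<eta> < Im z} z * (w z * f z))"
    if "0 < \<eta>" "continuous_on UNIV f" "\<And>z. \<rho> < cmod z \<Longrightarrow> f z = 0" for f :: "complex \<Rightarrow> real" and \<eta>
    by (rule integrable_half_plane_compact_support[OF w that])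
  have [measurable]: "{z. \<eta> < Im z} \<in> sets borel" for \<eta> by measurable
  have iV: "integrable lborel (\<lambda>z. indicator {z. \<eta> < Im z} z * (Re (Wt z) * V1 z))"
     "integrable lborel (\<lambda>z. indicator {z. \<eta> < Im z} z * (Im (Wt z) * V2 z))" for \<eta>
    using prod[THEN integrable_mult_indicator[rotated], of "{z. \<eta> < Im z}"] by auto
  have hor: "(\<integral>z. indicator {z. \<eta> < Im z} z * (Re (Wt z) * V1 z + w z * V1x z) \<partial>lborel) = 0"
    (is "integral\<^sup>L lborel ?Q = 0") if "0 < \<eta>" for \<eta>
  proof -
    have Q: "integrable lborel ?Q"
      using Bochner_Integration.integrable_add[OF iV(1)[of \<eta>] intw[OF that, of V1x]] cont supp by (simp add: distrib_left)
    have "(\<integral>x. ?Q (Complex x y) \<partial>lborel) = 0" if i: "integrable lborel (\<lambda>x. ?Q (Complex x y))" for y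
    proof (cases "\<eta> < y")
      case True
      let ?q = "\<lambda>x. Re (W (Complex x y)) * V1 (Complex x y) + w (Complex x y) * V1x (Complex x y)"
      have q: "(\<lambda>x. ?Q (Complex x y)) = ?q"
        using True \<open>0 < \<eta>\<close> by (auto simp: Wt_def upper_half_def)
      show ?thesis unfolding q
      proof (rule integral_FTC_line)
        show "integrable lborel ?q" using i unfolding q .
        show "((\<lambda>x. w (Complex x y) * V1 (Complex x y)) has_real_derivative ?q x) (at x)" for x
          using DERIV_mult[OF has_derivative_imp_partials(1)[OF w] V1, of x y] True \<open>0 < \<eta>\<close>
          by (simp add: upper_half_def add_ac mult_ac)
        fix x assume "\<rho> < \<bar>x\<bar>"
        then have "\<rho> < cmod (Complex x y)" using abs_Re_le_cmod[of "Complex x y"] by simp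
        with supp show "?q x = 0 \<and> w (Complex x y) * V1 (Complex x y) = 0" by simp
      qed
    qed simp
    then have "AE y in lborel. (\<integral>x. ?Q (Complex x y) \<partial>lborel) = 0"
      using AE_integrable_complex_snd[OF Q] by (auto elim!: eventually_mono)
    then show ?thesis
      unfolding integral_complex_snd[OF Q, symmetric]
      by (rule integral_eq_zero_AE)
  qed
  obtain C where C: "0 \<le> C" "\<And>z. \<bar>V2y z\<bar> \<le> C"
  proof -
    have "compact (V2y ` cball 0 \<rho>)"
      by (intro compact_continuous_image) (auto intro: continuous_on_subset[OF cont(4)])
    then obtain B where B: "\<And>z. cmod z \<le> \<rho> \<Longrightarrow> \<bar>V2y z\<bar> \<le> B"
      by (force dest!: compact_imp_bounded simp: bounded_iff)
    show ?thesis
      by (rule that[of "max 0 B"]) (use B supp in \<open>auto simp: le_max_iff_disj not_le[symmetric]\<close>)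
  qed
  \<comment> \<open>By the mean value theorem from the real line, where \<open>V2\<close> vanishes;
    this supplies the factor \<eta> in the boundary term.\<close>
  have V2le: "\<bar>V2 (Complex x y)\<bar> \<le> C * y" if y: "0 < y" for x y
  proof -
    obtain s where "V2 (Complex x y) - V2 (Complex x 0) = (y - 0) * V2y (Complex x s)"
      using MVT2[OF y, of "\<lambda>y. V2 (Complex x y)" "\<lambda>y. V2y (Complex x y)"] V2 by auto
    then have "V2 (Complex x y) = y * V2y (Complex x s)"
      using V20[of x] by (simp add: complex_of_real_def)
    then show ?thesis using C(2)[of "Complex x s"] y by (simp add: abs_mult mult.commute mult_left_mono)
  qed
  \<comment> \<open>A majorant of |w| at all heights in (0,1]: the value at height 1 plus the total
    variation on the vertical segment below it. It is integrable over |x| <= \<rho> because the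
    gradient is square integrable and the strip is bounded there.\<close>
  define J where "J x = \<bar>w (Complex x 1)\<bar> + (\<integral>y. indicator {0<..1} y * \<bar>Im (Wt (Complex x y))\<bar> \<partial>lborel)" for x
  let ?B = "\<lambda>z. indicator {-\<rho>..\<rho>} (Re z) * (indicator {0<..1} (Im z) * \<bar>Im (Wt z)\<bar>)"
  have B: "integrable lborel ?B"
  proof -
    have "emeasure lborel (cbox (Complex (-\<rho>) 0) (Complex \<rho> 1)) < \<infinity>"
      by (rule emeasure_bounded_finite) simp
    then have "integrable lborel (indicator (cbox (Complex (-\<rho>) 0) (Complex \<rho> 1)) :: complex \<Rightarrow> real)"
      by (intro integrable_real_indicator) auto
    from Bochner_Integration.integrable_add[OF Wt2 this] show ?thesis
    proof (rule Bochner_Integration.integrable_bound, measurable, intro AE_I2)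
      fix z
      have "\<bar>Im (Wt z)\<bar> \<le> cmod (Wt z)" by (rule abs_Im_le_cmod)
      also have "\<dots> \<le> (cmod (Wt z))\<^sup>2 + 1"
      proof -
        have "2 * cmod (Wt z) \<le> (cmod (Wt z))\<^sup>2 + 1"
          using sum_squares_bound[of "cmod (Wt z)" 1] by simp
        then show ?thesis using norm_ge_zero[of "Wt z"] by linarith
      qed
      finally show "norm (?B z) \<le> norm ((cmod (Wt z))\<^sup>2 + indicator (cbox (Complex (- \<rho>) 0) (Complex \<rho> 1)) z)"
        by (auto simp: in_cbox_complex_iff split: split_indicator)
    qed
  qed
  have wle: "\<bar>w (Complex x \<eta>)\<bar> \<le> J x"
    if i: "integrable lborel (\<lambda>y. indicator {0<..1} y * \<bar>Im (Wt (Complex x y))\<bar>)" and \<eta>: "0 < \<eta>" "\<eta> \<le> 1" for x \<eta>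
  proof -
    have H: "Complex x y \<in> upper_half" if "\<eta> \<le> y" for y using \<eta> that by (simp add: upper_half_def)
    have m: "(\<lambda>y. indicator {\<eta>..1} y *\<^sub>R Im (W (Complex x y))) \<in> borel_measurable borel"
    proof -
      have "(\<lambda>y. indicator {\<eta>..1} y *\<^sub>R Im (Wt (Complex x y))) \<in> borel_measurable borel" by measurable
      also have "(\<lambda>y. indicator {\<eta>..1} y *\<^sub>R Im (Wt (Complex x y))) = (\<lambda>y. indicator {\<eta>..1} y *\<^sub>R Im (W (Complex x y)))"
        using H by (auto simp: Wt_def fun_eq_iff split: split_indicator)
      finally show ?thesis .
    qed
    have s: "set_integrable lborel {\<eta>..1} (\<lambda>y. Im (W (Complex x y)))"
      unfolding set_integrable_def
      by (rule Bochner_Integration.integrable_bound[OF i])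
        (use H \<eta> m in \<open>auto simp: Wt_def split: split_indicator\<close>)
    have "(LINT y:{\<eta>..1}|lborel. Im (W (Complex x y))) = w (Complex x 1) - w (Complex x \<eta>)"
      by (rule set_integral_FTC_Icc[OF _ has_derivative_imp_partials(2)[OF w] s]) (use H \<eta> in auto)
    moreover have "\<bar>LINT y:{\<eta>..1}|lborel. Im (W (Complex x y))\<bar> \<le> (\<integral>y. indicator {0<..1} y * \<bar>Im (Wt (Complex x y))\<bar> \<partial>lborel)"
      unfolding set_lebesgue_integral_def
      by (rule order_trans[OF integral_abs_bound] , rule integral_mono)
        (use s i H \<eta> in \<open>auto simp: set_integrable_def Wt_def split: split_indicator\<close>)
    ultimately show ?thesis by (auto simp: J_def)
  qed
  have Jint: "integrable lborel (\<lambda>x. indicator {-\<rho>..\<rho>} x * J x)"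
  proof -
    have "continuous_on {-\<rho>..\<rho>} (\<lambda>x. \<bar>w (Complex x 1)\<bar>)"
    proof -
      have "continuous_on {-\<rho>..\<rho>} (\<lambda>x. w (Complex x 1))"
        by (rule continuous_on_compose2[OF contw[of 1]])
          (auto simp: Complex_eq intro!: continuous_intros)
      then show ?thesis by (rule continuous_on_rabs)
    qed
    then have "integrable lborel (\<lambda>x. indicator {-\<rho>..\<rho>} x *\<^sub>R \<bar>w (Complex x 1)\<bar>)"
      by (intro borel_integrable_compact) auto
    then show ?thesis
      using integrable_complex_fst[OF B] by (simp add: J_def distrib_left)
  qed
  have AEi: "AE x in lborel. \<bar>x\<bar> \<le> \<rho> \<longrightarrow> integrable lborel (\<lambda>y. indicator {0<..1} y * \<bar>Im (Wt (Complex x y))\<bar>)"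
    using AE_integrable_complex_fst[OF B]
    by eventually_elim (auto simp: indicator_eq_0_iff abs_le_iff)
  let ?b = "\<integral>x. indicator {-\<rho>..\<rho>} x * J x \<partial>lborel"
  have ver: "\<bar>\<integral>z. indicator {z. \<eta> < Im z} z * (Im (Wt z) * V2 z + w z * V2y z) \<partial>lborel\<bar> \<le> C * \<eta> * ?b"
    (is "\<bar>integral\<^sup>L lborel ?Q\<bar> \<le> _") if \<eta>: "0 < \<eta>" "\<eta> \<le> 1" for \<eta>
  proof -
    have Q: "integrable lborel ?Q"
      using Bochner_Integration.integrable_add[OF iV(2)[of \<eta>] intw[OF that(1), of V2y]] cont supp by (simp add: distrib_left)
    have eq: "(\<integral>y. ?Q (Complex x y) \<partial>lborel) = - (w (Complex x \<eta>) * V2 (Complex x \<eta>))"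
      if i: "integrable lborel (\<lambda>y. ?Q (Complex x y))" for x
    proof -
      let ?q = "\<lambda>y. Im (W (Complex x y)) * V2 (Complex x y) + w (Complex x y) * V2y (Complex x y)"
      have q: "(\<lambda>y. ?Q (Complex x y)) = (\<lambda>y. indicator {\<eta><..} y * ?q y)"
        using \<open>0 < \<eta>\<close> by (auto simp: Wt_def upper_half_def fun_eq_iff split: split_indicator)
      show ?thesis unfolding q
      proof (rule integral_FTC_half_line)
        show "integrable lborel (\<lambda>y. indicator {\<eta><..} y * ?q y)" using i unfolding q .
        show "((\<lambda>y. w (Complex x y) * V2 (Complex x y)) has_real_derivative ?q y) (at y)" if "\<eta> \<le> y" for y
          using DERIV_mult[OF has_derivative_imp_partials(2)[OF w] V2, of x y] that \<open>0 < \<eta>\<close>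
          by (simp add: upper_half_def add_ac mult_ac)
        fix y assume "\<rho> < y"
        then have "\<rho> < cmod (Complex x y)" using abs_Im_le_cmod[of "Complex x y"] by simp
        with supp show "?q y = 0 \<and> w (Complex x y) * V2 (Complex x y) = 0" by simp
      qed
    qed
    have bd: "AE x in lborel. \<bar>\<integral>y. ?Q (Complex x y) \<partial>lborel\<bar> \<le> C * \<eta> * (indicator {-\<rho>..\<rho>} x * J x)"
      using AE_integrable_complex_fst[OF Q] AEi
    proof eventually_elim
      case (elim x)
      have e: "\<bar>\<integral>y. ?Q (Complex x y) \<partial>lborel\<bar> = \<bar>w (Complex x \<eta>)\<bar> * \<bar>V2 (Complex x \<eta>)\<bar>"
        using eq[OF elim(1)] by (simp add: abs_mult)
      show ?case
      proof (cases "\<bar>x\<bar> \<le> \<rho>")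
        case True
        have "\<bar>w (Complex x \<eta>)\<bar> * \<bar>V2 (Complex x \<eta>)\<bar> \<le> J x * (C * \<eta>)"
          by (rule mult_mono) (use True elim wle[OF _ \<eta>] V2le[OF \<eta>(1)] in \<open>auto simp: J_def intro!: add_nonneg_nonneg integral_nonneg_AE\<close>)
        with True e show ?thesis by (simp add: abs_le_iff mult_ac)
      next
        case False
        then have "\<rho> < cmod (Complex x \<eta>)" using abs_Re_le_cmod[of "Complex x \<eta>"] by simp
        moreover have "x \<notin> {-\<rho>..\<rho>}" using False by auto
        ultimately show ?thesis using supp e by simp
      qed
    qed
    have "\<bar>integral\<^sup>L lborel ?Q\<bar> = \<bar>\<integral>x. (\<integral>y. ?Q (Complex x y) \<partial>lborel) \<partial>lborel\<bar>"
      unfolding integral_complex_fst[OF Q] ..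
    also have "\<dots> \<le> (\<integral>x. \<bar>\<integral>y. ?Q (Complex x y) \<partial>lborel\<bar> \<partial>lborel)"
      by (rule integral_abs_bound)
    also have "\<dots> \<le> (\<integral>x. C * \<eta> * (indicator {-\<rho>..\<rho>} x * J x) \<partial>lborel)"
      by (rule integral_mono_AE[OF _ _ bd])
        (use integrable_complex_fst[OF Q] Jint in auto)
    also have "\<dots> = C * \<eta> * ?b" by simp
    finally show ?thesis .
  qed
  let ?\<eta> = "\<lambda>n. inverse (real (Suc n))"
  have main: "(LINT z:{z. ?\<eta> n < Im z}|lborel. w z * (V1x z + V2y z))
      = (\<integral>z. indicator {z. ?\<eta> n < Im z} z * (Im (Wt z) * V2 z + w z * V2y z) \<partial>lborel)
        - (\<integral>z. indicator {z. ?\<eta> n < Im z} z * (Re (Wt z) * V1 z + Im (Wt z) * V2 z) \<partial>lborel)" for n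
  proof -
    have p: "0 < ?\<eta> n" by simp
    have i1: "integrable lborel (\<lambda>z. indicator {z. ?\<eta> n < Im z} z * (w z * V1x z))"
      and i2: "integrable lborel (\<lambda>z. indicator {z. ?\<eta> n < Im z} z * (w z * V2y z))"
      using intw[OF p, of V1x] intw[OF p, of V2y] cont supp by auto
    show ?thesis
      using hor[OF p] i1 i2 iV[of "?\<eta> n"]
      by (simp add: set_lebesgue_integral_def distrib_left Bochner_Integration.integral_add)
  qed
  have lim1: "(\<lambda>n. \<integral>z. indicator {z. ?\<eta> n < Im z} z * (Im (Wt z) * V2 z + w z * V2y z) \<partial>lborel) \<longlonglongrightarrow> 0"
  proof (rule Lim_null_comparison)
    show "eventually (\<lambda>n. norm (\<integral>z. indicator {z. ?\<eta> n < Im z} z * (Im (Wt z) * V2 z + w z * V2y z) \<partial>lborel)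
        \<le> C * ?\<eta> n * ?b) sequentially"
    proof (intro always_eventually allI)
      fix n
      have "?\<eta> n \<le> 1" using inverse_le_1_iff[of "real (Suc n)"] by simp
      then show "norm (\<integral>z. indicator {z. ?\<eta> n < Im z} z * (Im (Wt z) * V2 z + w z * V2y z) \<partial>lborel) \<le> C * ?\<eta> n * ?b"
        using ver[of "?\<eta> n"] by simp
    qed
    show "(\<lambda>n. C * ?\<eta> n * ?b) \<longlonglongrightarrow> 0"
      using tendsto_mult[OF tendsto_mult[OF tendsto_const LIMSEQ_inverse_real_of_nat] tendsto_const, of C ?b] by simp
  qed
  have lim2: "(\<lambda>n. \<integral>z. indicator {z. ?\<eta> n < Im z} z * (Re (Wt z) * V1 z + Im (Wt z) * V2 z) \<partial>lborel)
      \<longlonglongrightarrow> (\<integral>z. Re (Wt z) * V1 z + Im (Wt z) * V2 z \<partial>lborel)"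
  proof (rule integral_dominated_convergence[where w = "\<lambda>z. \<bar>Re (Wt z) * V1 z + Im (Wt z) * V2 z\<bar>"])
    show "integrable lborel (\<lambda>z. \<bar>Re (Wt z) * V1 z + Im (Wt z) * V2 z\<bar>)"
      using prod by auto
    show "AE z in lborel. (\<lambda>n. indicator {z. ?\<eta> n < Im z} z * (Re (Wt z) * V1 z + Im (Wt z) * V2 z))
        \<longlonglongrightarrow> Re (Wt z) * V1 z + Im (Wt z) * V2 z"
    proof (rule AE_I2)
      fix z
      show "(\<lambda>n. indicator {z. ?\<eta> n < Im z} z * (Re (Wt z) * V1 z + Im (Wt z) * V2 z))
        \<longlonglongrightarrow> Re (Wt z) * V1 z + Im (Wt z) * V2 z"
      proof (cases "0 < Im z")
        case True
        then have "eventually (\<lambda>n. ?\<eta> n < Im z) sequentially"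
          using order_tendstoD(2)[OF LIMSEQ_inverse_real_of_nat] by blast
        then show ?thesis by (intro tendsto_eventually) (erule eventually_mono, simp)
      qed (simp add: Wt_def upper_half_def)
    qed
  qed (auto split: split_indicator)
  have "(\<integral>z. Re (Wt z) * V1 z + Im (Wt z) * V2 z \<partial>lborel) = 0"
    using zero unfolding set_lebesgue_integral_def Wt_def by (simp add: algebra_simps)
  with tendsto_diff[OF lim1 lim2] show ?thesis unfolding main by (simp del: of_nat_Suc)
qed

section \<open>Uniqueness of the stray field potential\<close>

lemma set_integrable_inner_L2:
  fixes F G :: "complex \<Rightarrow> complex"
  assumes F: "(\<lambda>z. indicator A z *\<^sub>R F z) \<in> borel_measurable borel" "set_integrable lborel A (\<lambda>z. (cmod (F z))\<^sup>2)"
    and G: "(\<lambda>z. indicator A z *\<^sub>R G z) \<in> borel_measurable borel" "set_integrable lborel A (\<lambda>z. (cmod (G z))\<^sup>2)"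
  shows "set_integrable lborel A (\<lambda>z. F z \<bullet> G z)"
proof -
  have m: "(\<lambda>z. indicator A z *\<^sub>R (F z \<bullet> G z)) \<in> borel_measurable borel"
  proof -
    have "(\<lambda>z. (indicator A z *\<^sub>R F z) \<bullet> (indicator A z *\<^sub>R G z)) \<in> borel_measurable borel"
      using F(1) G(1) by measurable
    also have "(\<lambda>z. (indicator A z *\<^sub>R F z) \<bullet> (indicator A z *\<^sub>R G z)) = (\<lambda>z. indicator A z *\<^sub>R (F z \<bullet> G z))"
      by (auto simp: fun_eq_iff split: split_indicator)
    finally show ?thesis .
  qed
  have "integrable lborel (\<lambda>z. indicator A z *\<^sub>R (cmod (F z))\<^sup>2 + indicator A z *\<^sub>R (cmod (G z))\<^sup>2)"
    using F(2) G(2) unfolding set_integrable_def by (rule Bochner_Integration.integrable_add)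
  then show ?thesis unfolding set_integrable_def
  proof (rule Bochner_Integration.integrable_bound)
    show "AE z in lborel. norm (indicator A z *\<^sub>R (F z \<bullet> G z))
        \<le> norm (indicator A z *\<^sub>R (cmod (F z))\<^sup>2 + indicator A z *\<^sub>R (cmod (G z))\<^sup>2)"
    proof (rule AE_I2)
      fix z
      have "\<bar>F z \<bullet> G z\<bar> \<le> cmod (F z) * cmod (G z)" by (rule Cauchy_Schwarz_ineq2)
      also have "\<dots> \<le> (cmod (F z))\<^sup>2 + (cmod (G z))\<^sup>2"
        using sum_squares_bound[of "cmod (F z)" "cmod (G z)"] mult_nonneg_nonneg[OF norm_ge_zero[of "F z"] norm_ge_zero[of "G z"]]
        unfolding mult.assoc by linarith
      finally show "norm (indicator A z *\<^sub>R (F z \<bullet> G z))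
        \<le> norm (indicator A z *\<^sub>R (cmod (F z))\<^sup>2 + indicator A z *\<^sub>R (cmod (G z))\<^sup>2)"
        by (auto split: split_indicator)
    qed
  qed (use m in auto)
qed

text \<open>The squared distance is a polynomial, so smooth functions of it are smooth also at
  \<open>p\<close>, where the distance itself is not.\<close>

definition dist2 :: "complex \<Rightarrow> complex \<Rightarrow> real" where
  "dist2 p z = (Re z - Re p)\<^sup>2 + (Im z - Im p)\<^sup>2"

lemma dist2_eq: "dist2 p z = (cmod (z - p))\<^sup>2"
  by (simp add: dist2_def cmod_power2)

lemma continuous_on_dist2 [continuous_intros]: "continuous_on A (dist2 p)"
  unfolding dist2_def[abs_def] by (intro continuous_intros)

lemma Ck2_dist2: "Ck2 n (dist2 p)"
proof -
  have "Ck2 n (\<lambda>z. (Re z + (- Re p)) * (Re z + (- Re p)) + (Im z + (- Im p)) * (Im z + (- Im p)))"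
    by (intro Ck2_add Ck2_mult Ck2_Re Ck2_Im Ck2_const)
  then show ?thesis by (simp add: dist2_def[abs_def] power2_eq_square)
qed

lemma has_derivative_dist2:
  "(dist2 p has_derivative (\<lambda>h. Re h * (2 * (Re z - Re p)) + Im h * (2 * (Im z - Im p)))) (at z)"
  unfolding dist2_def[abs_def] by (auto intro!: derivative_eq_intros simp: fun_eq_iff algebra_simps)

lemma two_le_divide_power2:
  fixes r x :: real
  assumes "0 < r" "(2 * r)\<^sup>2 \<le> x" shows "2 \<le> x / r\<^sup>2"
proof -
  have "2 * r\<^sup>2 \<le> (2 * r)\<^sup>2" by (simp add: power_mult_distrib)
  with assms(2) have "2 * r\<^sup>2 \<le> x" by linarith
  with assms(1) show ?thesis by (simp add: pos_le_divide_eq)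
qed

lemma two_le_dist2:
  assumes "0 < R" "2 * R \<le> cmod (z - q)" shows "2 \<le> dist2 q z / R\<^sup>2"
  unfolding dist2_eq by (rule two_le_divide_power2[OF assms(1) power_mono]) (use assms in auto)

lemma emeasure_cball_complex: "0 \<le> r \<Longrightarrow> emeasure lborel (cball (p::complex) r) = ennreal (pi * r\<^sup>2)"
  by (simp add: emeasure_cball unit_ball_vol_2)

lemma integrable_step'_dist2:
  assumes "0 < R" shows "integrable lborel (\<lambda>z. step' (dist2 q z / R\<^sup>2) / R\<^sup>2)"
proof (rule integrable_continuous_compact_support[of "cball q (2 * R)"])
  show "continuous_on (cball q (2 * R)) (\<lambda>z. step' (dist2 q z / R\<^sup>2) / R\<^sup>2)"
    using assms by (intro continuous_intros continuous_on_compose2[OF continuous_step']) auto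
  fix z assume "z \<notin> cball q (2 * R)"
  then have "2 * R \<le> cmod (z - q)" by (simp add: dist_norm norm_minus_commute)
  with assms have "2 \<le> dist2 q z / R\<^sup>2" by (rule two_le_dist2)
  then show "step' (dist2 q z / R\<^sup>2) / R\<^sup>2 = 0" using step'_eq_0 by simp
qed simp

text \<open>The area of the supporting disc grows like R^2 and cancels the division by R^2. That the
  bound does not depend on R is what allows bumps of arbitrarily large radius in the uniqueness
  proof.\<close>

lemma integral_step'_dist2_le:
  assumes "0 < R" shows "(\<integral>z. step' (dist2 q z / R\<^sup>2) / R\<^sup>2 \<partial>lborel) \<le> 4 * pi / step_mass"
proof -
  have "(\<integral>z. step' (dist2 q z / R\<^sup>2) / R\<^sup>2 \<partial>lborel)
      \<le> (\<integral>z. (1 / step_mass / R\<^sup>2) * indicator (cball q (2 * R)) z \<partial>lborel)"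
  proof (rule integral_mono[OF integrable_step'_dist2[OF assms]])
    show "integrable lborel (\<lambda>z. (1 / step_mass / R\<^sup>2) * indicator (cball q (2 * R)) z)"
      using assms by (intro integrable_mult_right integrable_real_indicator) (auto simp: emeasure_cball_complex)
    fix z
    show "step' (dist2 q z / R\<^sup>2) / R\<^sup>2 \<le> (1 / step_mass / R\<^sup>2) * indicator (cball q (2 * R)) z"
    proof (cases "z \<in> cball q (2 * R)")
      case True
      then show ?thesis using divide_right_mono[OF step'_le, of "R\<^sup>2"] by simp
    next
      case False
      then have "2 * R \<le> cmod (z - q)" by (simp add: dist_norm norm_minus_commute)
      with assms have "2 \<le> dist2 q z / R\<^sup>2" by (rule two_le_dist2)
      then show ?thesis using step'_eq_0 False by simp
    qed
  qed
  also have "\<dots> = 4 * pi / step_mass"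
    using assms by (simp add: measure_def emeasure_cball_complex power_mult_distrib)
  finally show ?thesis .
qed

text \<open>Prescribing s g(s) = step (s / r^2) - step (s / R^2) yields the last equation by
  differentiation, and division by s is harmless because \<open>step\<close> vanishes below 1. If h
  is a primitive of g, the Laplacian of h (|z - p|^2) is 4 (g + s g') at s = |z - p|^2.\<close>

lemma radial_weight_exists:
  assumes rR: "0 < r" "r < R"
  obtains g g' :: "real \<Rightarrow> real" where "\<And>s. (g has_real_derivative g' s) (at s)" "\<And>n. Ck n g"
    "\<And>s. 2 * R\<^sup>2 < s \<Longrightarrow> g s = 0" "\<And>s. 2 * R\<^sup>2 < s \<Longrightarrow> g' s = 0"
    "continuous_on UNIV g" "continuous_on UNIV g'"
    "\<And>s. g s + s * g' s = step' (s / r\<^sup>2) / r\<^sup>2 - step' (s / R\<^sup>2) / R\<^sup>2"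
proof -
  define g1 where "g1 s = step s / s ^ 1" for s
  have g1: "Ck n g1" for n
    unfolding g1_def[abs_def] by (intro Ck_divide_power Ck_step step_eq_0) simp
  define g where "g s = (1 / r\<^sup>2) * g1 ((1 / r\<^sup>2) * s + 0) - (1 / R\<^sup>2) * g1 ((1 / R\<^sup>2) * s + 0)" for s
  have g: "Ck n g" for n
    unfolding g_def[abs_def] by (intro Ck_diff Ck_cmult Ck_affine g1)
  obtain g' where g': "\<And>s. (g has_real_derivative g' s) (at s)" "Ck (Suc 0) g'"
    using g[of "Suc (Suc 0)"] by auto
  have sg: "s * g s = step (s / r\<^sup>2) - step (s / R\<^sup>2)" for s
    using rR step_eq_0[of 0] by (cases "s = 0") (auto simp: g_def g1_def field_simps)
  have R0: "0 < R" using rR by simp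
  have gz: "g s = 0" if "2 * R\<^sup>2 < s" for s
  proof -
    have "r\<^sup>2 \<le> R\<^sup>2" using rR by (intro power_mono) auto
    then have "2 * r\<^sup>2 \<le> s" "2 * R\<^sup>2 \<le> s" using that by auto
    then have "2 \<le> s / r\<^sup>2" "2 \<le> s / R\<^sup>2" using rR by (auto simp: pos_le_divide_eq)
    then have "s * g s = 0" by (simp add: sg step_eq_1)
    moreover have "s \<noteq> 0" using that zero_le_power2[of R] by auto
    ultimately show ?thesis by simp
  qed
  have g'z: "g' s = 0" if "2 * R\<^sup>2 < s" for s
  proof -
    have "(g has_real_derivative 0) (at s)"
      by (rule DERIV_cong_ev[THEN iffD1, OF refl _ refl DERIV_const[of 0]])
        (use gz eventually_nhds_in_open[of "{2 * R\<^sup>2<..}" s] that in \<open>auto elim!: eventually_mono\<close>)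
    with g'(1) show ?thesis using DERIV_unique by blast
  qed
  have "g s + s * g' s = step' (s / r\<^sup>2) / r\<^sup>2 - step' (s / R\<^sup>2) / R\<^sup>2" for s
  proof (rule DERIV_unique)
    show "((\<lambda>s. s * g s) has_real_derivative g s + s * g' s) (at s)"
      using DERIV_mult[OF DERIV_ident g'(1)[of s]] by (simp add: mult.commute add.commute)
    have st: "((\<lambda>s. step (s / c)) has_real_derivative step' (s / c) * (1 / c)) (at s)" for c
      by (rule DERIV_chain2[OF step_deriv DERIV_cdivide[OF DERIV_ident]])
    from DERIV_diff[OF st[of "r\<^sup>2"] st[of "R\<^sup>2"]] show "((\<lambda>s. s * g s) has_real_derivative step' (s / r\<^sup>2) / r\<^sup>2 - step' (s / R\<^sup>2) / R\<^sup>2) (at s)"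
      unfolding sg by simp
  qed
  moreover have "continuous_on UNIV g" "continuous_on UNIV g'"
    by (rule Ck_imp_continuous[of 0], fact)+
  ultimately show ?thesis using that[of g g'] g g' gz g'z by blast
qed

lemma eq_0_if_abs_le_mult:
  fixes A M :: real
  assumes "0 < M" "\<And>e. 0 < e \<Longrightarrow> \<bar>A\<bar> \<le> e * M" shows "A = 0"
proof (rule ccontr)
  assume "A \<noteq> 0"
  then have "\<bar>A\<bar> \<le> \<bar>A\<bar> / (2 * M) * M" using assms by (intro assms(2)) auto
  then show False using \<open>A \<noteq> 0\<close> assms(1) by simp
qed

text \<open>Testing with a radial function around \<open>p\<close>, symmetrised by reflection, whose Laplacian is
  a bump at \<open>p\<close> minus a bump spread over a large annulus.\<close>

lemma weak_neumann_integral_bump_eq_0: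
  fixes w :: "complex \<Rightarrow> real"
  assumes w: "\<And>z. z \<in> upper_half \<Longrightarrow> (w has_derivative (\<lambda>h. W z \<bullet> h)) (at z)"
    and W2: "set_integrable lborel upper_half (\<lambda>z. (cmod (W z))\<^sup>2)"
    and lim: "filterlim w (nhds 0) (inf at_infinity (principal upper_half))"
    and weak: "\<And>\<zeta>. test_fun \<zeta> \<Longrightarrow> (LINT z:upper_half|lborel. W z \<bullet> grad \<zeta> z) = 0"
    and p: "p \<in> upper_half" and r: "0 < r" "2 * r < Im p"
  shows "(\<integral>z. indicator upper_half z * (w z * (step' (dist2 p z / r\<^sup>2) / r\<^sup>2)) \<partial>lborel) = 0" (is "?A = 0")
proof -
  \<comment> \<open>The second summand is the mirror image at \<open>cnj p\<close>. The
    corresponding test function is even in the imaginary part, so its normal derivative vanishes on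
    the real axis, as the integration by parts requires.\<close>
  define b where "b R z = step' (dist2 p z / R\<^sup>2) / R\<^sup>2 + step' (dist2 (cnj p) z / R\<^sup>2) / R\<^sup>2" for R z
  have bnn: "0 \<le> b R z" for R z by (simp add: b_def step'_nonneg)
  have bcont: "continuous_on UNIV (b R)" if "0 < R" for R
    unfolding b_def[abs_def] using that
    by (intro continuous_intros continuous_on_compose2[OF continuous_step']) auto
  have bint: "integrable lborel (b R)" "(\<integral>z. b R z \<partial>lborel) \<le> 8 * pi / step_mass" if "0 < R" for R
    using integrable_step'_dist2[OF that] integral_step'_dist2_le[OF that, of p] integral_step'_dist2_le[OF that, of "cnj p"]
    by (simp_all add: b_def[abs_def])
  have key: "\<bar>?A\<bar> \<le> e * (8 * pi / step_mass)" if e: "0 < e" for e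
  proof -
    obtain T where T: "\<And>z. z \<in> upper_half \<Longrightarrow> T \<le> cmod z \<Longrightarrow> \<bar>w z\<bar> < e"
    proof -
      have "eventually (\<lambda>z. dist (w z) 0 < e) (inf at_infinity (principal upper_half))"
        using tendstoD[OF lim e] .
      then show ?thesis using that
        by (auto simp: eventually_inf_principal eventually_at_infinity)
    qed
    \<comment> \<open>Large enough that the annulus carrying the spread-out bumps, which have
      centres \<open>p\<close> and \<open>cnj p\<close> and inner radius \<open>R\<close>, lies
      outside the disc of radius |T|, where |w| < e.\<close>
    define R where "R = max r \<bar>T\<bar> + cmod p + 1"
    have R: "r < R" "0 < R" "\<bar>T\<bar> + cmod p \<le> R"
      using r(1) norm_ge_zero[of p] unfolding R_def by linarith+
    define \<rho> where "\<rho> = 2 * R + cmod p"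
    obtain g g' where g: "\<And>s. (g has_real_derivative g' s) (at s)" "\<And>n. Ck n g"
      and gz: "\<And>s. 2 * R\<^sup>2 < s \<Longrightarrow> g s = 0" "\<And>s. 2 * R\<^sup>2 < s \<Longrightarrow> g' s = 0"
      and gc: "continuous_on UNIV g" "continuous_on UNIV g'"
      and gg: "\<And>s. g s + s * g' s = step' (s / r\<^sup>2) / r\<^sup>2 - step' (s / R\<^sup>2) / R\<^sup>2"
      using radial_weight_exists[OF r(1) R(1)] by blast
    \<comment> \<open>Normalised at \<open>3 * R\<^sup>2\<close>, beyond the support of
      \<open>g\<close>, so that \<open>h\<close> vanishes there and \<zeta> has compact
      support.\<close>
    define h where "h s = antiderivative g s - antiderivative g (3 * R\<^sup>2)" for s
    have hd: "(h has_real_derivative g s) (at s)" for s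
      unfolding h_def[abs_def] by (auto intro!: derivative_eq_intros antiderivative[OF gc(1)])
    have hz: "h s = 0" if "2 * R\<^sup>2 < s" for s
    proof (cases "s \<le> 3 * R\<^sup>2")
      case True
      then have "antiderivative g s = antiderivative g (3 * R\<^sup>2)"
        by (intro DERIV_zero_on_interval_eq[OF antiderivative[OF gc(1)]]) (use gz that in auto)
      then show ?thesis by (simp add: h_def)
    next
      case False
      then have "antiderivative g (3 * R\<^sup>2) = antiderivative g s"
        by (intro DERIV_zero_on_interval_eq[OF antiderivative[OF gc(1)]])
          (use gz that R(2) in \<open>auto intro!: gz(1) simp: less_le_trans\<close>, smt (verit) zero_less_power)
      then show ?thesis by (simp add: h_def)
    qed
    have Ckh: "Ck n h" for n
      by (cases n) (simp, blast intro: Ck_SucI hd g(2))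
    define \<zeta> where "\<zeta> z = h (dist2 p z) + h (dist2 (cnj p) z)" for z
    define V1 where "V1 z = 2 * (Re z - Re p) * g (dist2 p z) + 2 * (Re z - Re p) * g (dist2 (cnj p) z)" for z
    define V2 where "V2 z = 2 * (Im z - Im p) * g (dist2 p z) + 2 * (Im z + Im p) * g (dist2 (cnj p) z)" for z
    define V1x where "V1x z = 2 * g (dist2 p z) + 4 * (Re z - Re p)\<^sup>2 * g' (dist2 p z)
        + 2 * g (dist2 (cnj p) z) + 4 * (Re z - Re p)\<^sup>2 * g' (dist2 (cnj p) z)" for z
    define V2y where "V2y z = 2 * g (dist2 p z) + 4 * (Im z - Im p)\<^sup>2 * g' (dist2 p z)
        + 2 * g (dist2 (cnj p) z) + 4 * (Im z + Im p)\<^sup>2 * g' (dist2 (cnj p) z)" for z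
    have far: "2 * R\<^sup>2 < dist2 p z \<and> 2 * R\<^sup>2 < dist2 (cnj p) z" if "\<rho> < cmod z" for z
    proof -
      have "2 * R \<le> cmod (z - q)" if "cmod q = cmod p" for q
        using norm_triangle_ineq2[of z q] \<open>\<rho> < cmod z\<close> that by (simp add: \<rho>_def)
      then have q: "(2 * R)\<^sup>2 \<le> (cmod (z - q))\<^sup>2" if "cmod q = cmod p" for q
        using that R(2) by (intro power_mono) auto
      have "2 * R\<^sup>2 < (2 * R)\<^sup>2" using R(2) by (simp add: power2_eq_square)
      then show ?thesis using q[of p, OF refl] q[of "cnj p", OF complex_mod_cnj] unfolding dist2_eq by (intro conjI) linarith+
    qed
    have dz: "(\<zeta> has_derivative (\<lambda>k. Complex (V1 z) (V2 z) \<bullet> k)) (at z)" for z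
    proof -
      have "((\<lambda>z. h (dist2 q z)) has_derivative (\<lambda>k. (Re k * (2 * (Re z - Re q)) + Im k * (2 * (Im z - Im q))) * g (dist2 q z))) (at z)" for q
        using has_derivative_compose[OF has_derivative_dist2[of q z] hd[of "dist2 q z", THEN has_field_derivative_imp_has_derivative]]
        by (simp add: mult.commute)
      from has_derivative_add[OF this[of p] this[of "cnj p"]] show ?thesis
        unfolding \<zeta>_def[abs_def]
        by (rule has_derivative_eq_rhs) (auto simp: V1_def V2_def inner_complex_def algebra_simps)
    qed
    have "test_fun \<zeta>"
      unfolding test_fun_def
    proof
      show "smooth \<zeta>"
        unfolding \<zeta>_def[abs_def] by (rule smoothI, rule Ck2_add; rule Ck2_compose[OF Ckh Ck2_dist2])
      have "{z. \<zeta> z \<noteq> 0} \<subseteq> cball 0 \<rho>"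
      proof
        fix z assume "z \<in> {z. \<zeta> z \<noteq> 0}"
        then have "\<not> \<rho> < cmod z" using far[of z] hz by (auto simp: \<zeta>_def)
        then show "z \<in> cball 0 \<rho>" by simp
      qed
      then show "compact (closure {z. \<zeta> z \<noteq> 0})"
        by (meson bounded_cball bounded_subset compact_closure)
    qed
    then have zero: "(LINT z:upper_half|lborel. Re (W z) * V1 z + Im (W z) * V2 z) = 0"
      using weak[of \<zeta>] by (simp add: grad_eqI[OF dz] inner_complex_def)
    have V1d: "((\<lambda>x. V1 (Complex x y)) has_real_derivative V1x (Complex x y)) (at x)" for x y
    proof -
      have "((\<lambda>x. g (dist2 q (Complex x y))) has_real_derivative g' (dist2 q (Complex x y)) * (2 * (x - Re q))) (at x)" for q
        by (rule DERIV_chain2[OF g(1)]) (auto simp: dist2_def intro!: derivative_eq_intros)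
      then show ?thesis unfolding V1_def V1x_def
        by (auto intro!: derivative_eq_intros simp: power2_eq_square algebra_simps)
    qed
    have V2d: "((\<lambda>y. V2 (Complex x y)) has_real_derivative V2y (Complex x y)) (at y)" for x y
    proof -
      have "((\<lambda>y. g (dist2 q (Complex x y))) has_real_derivative g' (dist2 q (Complex x y)) * (2 * (y - Im q))) (at y)" for q
        by (rule DERIV_chain2[OF g(1)]) (auto simp: dist2_def intro!: derivative_eq_intros)
      then show ?thesis unfolding V2_def V2y_def
        by (auto intro!: derivative_eq_intros simp: power2_eq_square algebra_simps)
    qed
    have div: "V1x z + V2y z = 4 * b r z - 4 * b R z" for z
    proof -
      have "V1x z + V2y z = 4 * (g (dist2 p z) + dist2 p z * g' (dist2 p z))
          + 4 * (g (dist2 (cnj p) z) + dist2 (cnj p) z * g' (dist2 (cnj p) z))"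
        by (simp add: V1x_def V2y_def dist2_def algebra_simps)
      then show ?thesis unfolding gg by (simp add: b_def algebra_simps)
    qed
    have V20: "V2 (of_real x) = 0" for x
      by (simp add: V2_def dist2_def)
    have lim0: "(\<lambda>n. LINT z:{z. inverse (real (Suc n)) < Im z}|lborel. w z * (V1x z + V2y z)) \<longlonglongrightarrow> 0"
    proof (rule half_plane_integration_by_parts[OF w W2 V1d V2d _ _ _ _ _ V20 zero])
      show "continuous_on UNIV V1" "continuous_on UNIV V2" "continuous_on UNIV V1x" "continuous_on UNIV V2y"
        unfolding V1_def[abs_def] V2_def[abs_def] V1x_def[abs_def] V2y_def[abs_def]
        by (intro continuous_intros continuous_on_compose2[OF gc(1)] continuous_on_compose2[OF gc(2)]; simp)+
      show "V1 z = 0 \<and> V2 z = 0 \<and> V1x z = 0 \<and> V2y z = 0" if "\<rho> < cmod z" for z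
        using far[OF that] gz by (simp add: V1_def V2_def V1x_def V2y_def)
    qed
    have ev: "eventually (\<lambda>n. \<bar>4 * ?A\<bar> \<le> \<bar>LINT z:{z. inverse (real (Suc n)) < Im z}|lborel. w z * (V1x z + V2y z)\<bar>
        + 4 * e * (8 * pi / step_mass)) sequentially"
    proof -
      have "eventually (\<lambda>n. inverse (real (Suc n)) < Im p - 2 * r) sequentially"
        using order_tendstoD(2)[OF LIMSEQ_inverse_real_of_nat, of "Im p - 2 * r"] r by simp
      then show ?thesis
      proof eventually_elim
        case (elim n)
        let ?\<eta> = "inverse (real (Suc n))"
        have \<eta>: "0 < ?\<eta>" by simp
        \<comment> \<open>In the half plane only the bump at \<open>p\<close> is left, since the
          mirror bump lies below the axis, and by the choice of n the support of the former lies
          above height \<open>?\<eta>\<close>.\<close>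
        have near: "indicator {z. ?\<eta> < Im z} z * (w z * b r z) = indicator upper_half z * (w z * (step' (dist2 p z / r\<^sup>2) / r\<^sup>2))" for z
        proof (cases "z \<in> upper_half")
          case True
          have "(Im p)\<^sup>2 \<le> (Im z + Im p)\<^sup>2" using True p by (intro power_mono) (auto simp: upper_half_def)
          then have "(Im p)\<^sup>2 \<le> dist2 (cnj p) z" by (simp add: dist2_def add_increasing)
          moreover have "(2 * r)\<^sup>2 \<le> (Im p)\<^sup>2" using r by (intro power_mono) auto
          ultimately have "2 \<le> dist2 (cnj p) z / r\<^sup>2" by (intro two_le_divide_power2 r(1)) linarith
          then have b: "b r z = step' (dist2 p z / r\<^sup>2) / r\<^sup>2" by (simp add: b_def step'_eq_0)
          show ?thesis
          proof (cases "?\<eta> < Im z")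
            case False
            then have "2 * r \<le> Im p - Im z" using elim by simp
            then have "(2 * r)\<^sup>2 \<le> (Im p - Im z)\<^sup>2" using r by (intro power_mono) auto
            then have "(2 * r)\<^sup>2 \<le> dist2 p z" by (simp add: dist2_def power2_commute add_increasing)
            then have "2 \<le> dist2 p z / r\<^sup>2" by (rule two_le_divide_power2[OF r(1)])
            then show ?thesis by (simp add: b step'_eq_0)
          qed (use True b in simp)
        next
          case False
          then have "\<not> ?\<eta> < Im z" using \<eta> unfolding upper_half_def mem_Collect_eq by linarith
          with False show ?thesis by simp
        qed
        have bz: "b S z = 0" if "\<rho> < cmod z" "0 < S" "S \<le> R" for z S
        proof -
          have "S\<^sup>2 \<le> R\<^sup>2" using that by (intro power_mono) auto
          with far[OF that(1)] have "2 \<le> dist2 p z / S\<^sup>2" "2 \<le> dist2 (cnj p) z / S\<^sup>2"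
            using that(2) by (auto simp: field_simps)
          then show ?thesis by (simp add: b_def step'_eq_0)
        qed
        have i1: "integrable lborel (\<lambda>z. indicator {z. ?\<eta> < Im z} z * (w z * b r z))"
          by (rule integrable_half_plane_compact_support[OF w \<eta> bcont[OF r(1)], of \<rho>]) (use bz r R in auto)
        have i2: "integrable lborel (\<lambda>z. indicator {z. ?\<eta> < Im z} z * (w z * b R z))"
          by (rule integrable_half_plane_compact_support[OF w \<eta> bcont[OF R(2)], of \<rho>]) (use bz R in auto)
        have "(LINT z:{z. ?\<eta> < Im z}|lborel. w z * (V1x z + V2y z))
           = (\<integral>z. 4 * (indicator {z. ?\<eta> < Im z} z * (w z * b r z)) - 4 * (indicator {z. ?\<eta> < Im z} z * (w z * b R z)) \<partial>lborel)"
          unfolding set_lebesgue_integral_def div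
          by (intro Bochner_Integration.integral_cong) (auto simp: algebra_simps)
        also have "\<dots> = 4 * (\<integral>z. indicator {z. ?\<eta> < Im z} z * (w z * b r z) \<partial>lborel)
            - 4 * (\<integral>z. indicator {z. ?\<eta> < Im z} z * (w z * b R z) \<partial>lborel)"
          using i1 i2 by (subst Bochner_Integration.integral_diff) auto
        also have "(\<integral>z. indicator {z. ?\<eta> < Im z} z * (w z * b r z) \<partial>lborel) = ?A"
          unfolding near ..
        finally have eq: "4 * ?A = (LINT z:{z. ?\<eta> < Im z}|lborel. w z * (V1x z + V2y z))
            + 4 * (\<integral>z. indicator {z. ?\<eta> < Im z} z * (w z * b R z) \<partial>lborel)" by simp
        \<comment> \<open>On the part of the support of \<open>b R\<close> in the half plane |w| < e
          by the choice of \<open>R\<close>, and the mass of \<open>b R\<close> is bounded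
          independently of \<open>R\<close>.\<close>
        have "\<bar>\<integral>z. indicator {z. ?\<eta> < Im z} z * (w z * b R z) \<partial>lborel\<bar> \<le> (\<integral>z. e * b R z \<partial>lborel)"
        proof (rule order_trans[OF integral_abs_bound], rule integral_mono)
          show "integrable lborel (\<lambda>z. \<bar>indicator {z. ?\<eta> < Im z} z * (w z * b R z)\<bar>)" using i2 by auto
          show "integrable lborel (\<lambda>z. e * b R z)" using bint(1)[OF R(2)] by simp
          fix z
          show "\<bar>indicator {z. ?\<eta> < Im z} z * (w z * b R z)\<bar> \<le> e * b R z"
          proof (cases "?\<eta> < Im z \<and> b R z \<noteq> 0")
            case True
            then have z: "z \<in> upper_half" using \<eta> unfolding upper_half_def mem_Collect_eq by linarith
            have "T \<le> cmod z"
            proof (rule ccontr)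
              assume "\<not> T \<le> cmod z"
              then have "cmod z < \<bar>T\<bar>" by simp
              have "step' (dist2 q z / R\<^sup>2) = 0" if "cmod q = cmod p" for q
              proof -
                have "cmod (z - q) \<le> R" using norm_triangle_ineq4[of z q] that \<open>cmod z < \<bar>T\<bar>\<close> R(3) by linarith
                then have "(cmod (z - q))\<^sup>2 \<le> R\<^sup>2" by (intro power_mono) auto
                then have "dist2 q z / R\<^sup>2 \<le> 1" using R(2) by (simp add: dist2_eq)
                then show ?thesis by (simp add: step'_eq_0)
              qed
              then have "b R z = 0" by (simp add: b_def)
              with True show False by simp
            qed
            from T[OF z this] have "\<bar>w z\<bar> * b R z \<le> e * b R z" using bnn by (intro mult_right_mono) auto
            then show ?thesis using True bnn by (simp add: abs_mult)
          qed (use e bnn in \<open>auto simp: indicator_def\<close>)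
        qed
        also have "\<dots> \<le> e * (8 * pi / step_mass)" using mult_left_mono[OF bint(2)[OF R(2)], of e] e by simp
        finally show ?case using eq by linarith
      qed
    qed
    have "(\<lambda>n. \<bar>LINT z:{z. inverse (real (Suc n)) < Im z}|lborel. w z * (V1x z + V2y z)\<bar> + 4 * e * (8 * pi / step_mass))
        \<longlonglongrightarrow> \<bar>0\<bar> + 4 * e * (8 * pi / step_mass)"
      by (rule tendsto_add[OF tendsto_rabs[OF lim0] tendsto_const])
    from tendsto_lowerbound[OF this ev]
    have "\<bar>4 * ?A\<bar> \<le> \<bar>0\<bar> + 4 * e * (8 * pi / step_mass)" by simp
    then show ?thesis by simp
  qed
  show ?thesis
    by (rule eq_0_if_abs_le_mult[OF _ key]) (use step_mass_pos in auto)
qed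

text \<open>A nonzero value at \<open>p\<close> fixes the sign of \<open>w\<close> near
  \<open>p\<close>, and then the integral of \<open>w\<close> against a nonnegative bump supported
  there cannot vanish. This plays the part of the mean value property, as \<open>w\<close> is not
  known to be harmonic in the classical sense.\<close>

lemma weak_neumann_eq_0:
  fixes w :: "complex \<Rightarrow> real"
  assumes w: "\<And>z. z \<in> upper_half \<Longrightarrow> (w has_derivative (\<lambda>h. W z \<bullet> h)) (at z)"
    and W2: "set_integrable lborel upper_half (\<lambda>z. (cmod (W z))\<^sup>2)"
    and lim: "filterlim w (nhds 0) (inf at_infinity (principal upper_half))"
    and weak: "\<And>\<zeta>. test_fun \<zeta> \<Longrightarrow> (LINT z:upper_half|lborel. W z \<bullet> grad \<zeta> z) = 0"
    and p: "p \<in> upper_half"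
  shows "w p = 0"
proof (rule ccontr)
  assume wp: "w p \<noteq> 0"
  have "isCont w p" using w[OF p] by (rule has_derivative_continuous)
  then have "isCont (\<lambda>z. w p * w z) p" by (intro continuous_intros)
  moreover have "0 < w p * w p" using wp by (simp flip: power2_eq_square)
  ultimately have "eventually (\<lambda>z. 0 < w p * w z) (at p)"
    unfolding isCont_def by (rule order_tendstoD)
  then obtain d where d: "0 < d" "\<And>z. z \<noteq> p \<Longrightarrow> dist z p < d \<Longrightarrow> 0 < w p * w z"
    by (auto simp: eventually_at)
  have pos: "0 < w p * w z" if "dist z p < d" for z
    using d(2)[of z] that \<open>0 < w p * w p\<close> by (cases "z = p") auto
  define r where "r = min (d / 3) (Im p / 3)"
  have Imp: "0 < Im p" using p by (simp add: upper_half_def)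
  have r: "0 < r" "2 * r < Im p" "2 * r < d" using d(1) Imp by (auto simp: r_def)
  let ?b = "\<lambda>z. step' (dist2 p z / r\<^sup>2) / r\<^sup>2"
  have bcont: "continuous_on UNIV ?b"
    using r by (intro continuous_intros continuous_on_compose2[OF continuous_step']) auto
  have near: "dist z p < d \<and> z \<in> upper_half" if "?b z \<noteq> 0" for z
  proof -
    have "cmod (z - p) < 2 * r"
      using two_le_dist2[OF r(1), of z p] step'_eq_0[of "dist2 p z / r\<^sup>2"] that by force
    moreover have "\<bar>Im (z - p)\<bar> \<le> cmod (z - p)" by (rule abs_Im_le_cmod)
    ultimately show ?thesis using r by (simp add: dist_norm upper_half_def)
  qed
  let ?f = "\<lambda>z. indicator upper_half z * (w z * ?b z)"
  have f: "integrable lborel ?f"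
  proof -
    have "integrable lborel (\<lambda>z. indicator {z. Im p - 2 * r < Im z} z * (w z * ?b z))"
    proof (rule integrable_half_plane_compact_support[OF w _ bcont])
      show "0 < Im p - 2 * r" using r by simp
      fix z assume "cmod p + 2 * r < cmod z"
      then have "2 * r \<le> cmod (z - p)" using norm_triangle_ineq2[of z p] by linarith
      then show "?b z = 0" using two_le_dist2[OF r(1)] step'_eq_0 by simp
    qed
    also have "(\<lambda>z. indicator {z. Im p - 2 * r < Im z} z * (w z * ?b z)) = ?f"
    proof
      fix z
      show "indicator {z. Im p - 2 * r < Im z} z * (w z * ?b z) = ?f z"
      proof (cases "?b z = 0")
        case False
        then have "\<not> 2 * r \<le> cmod (z - p)"
          using two_le_dist2[OF r(1), of z p] step'_eq_0[of "dist2 p z / r\<^sup>2"] by force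
        then have "Im p - 2 * r < Im z" using abs_Im_le_cmod[of "z - p"] by simp
        then show ?thesis using near[OF False] by simp
      qed (simp only: mult_zero_right)
    qed
    finally show ?thesis .
  qed
  have "(\<integral>z. w p * ?f z \<partial>lborel) = w p * (\<integral>z. ?f z \<partial>lborel)" by (rule integral_mult_right_zero)
  also have "(\<integral>z. ?f z \<partial>lborel) = 0"
    by (rule weak_neumann_integral_bump_eq_0[OF w W2 lim weak p r(1,2)])
  finally have "(\<integral>z. w p * ?f z \<partial>lborel) = 0" by simp
  moreover have "0 \<le> w p * ?f z" for z
  proof (cases "?b z = 0")
    case False
    then have "0 \<le> (w p * w z) * ?b z"
      using near[OF False] pos[of z] step'_nonneg
      by (intro mult_nonneg_nonneg[of "w p * w z"] divide_nonneg_nonneg) auto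
    then show ?thesis by (auto simp: mult_ac split: split_indicator)
  qed (simp only: mult_zero_right)
  ultimately have "AE z in lborel. w p * ?f z = 0"
    using integral_nonneg_eq_0_iff_AE[of lborel "\<lambda>z. w p * ?f z"] integrable_mult_right[of "w p" lborel ?f] f
    by (simp only: AE_I2 simp_thms)
  then have "AE z in lborel. z \<in> {z. ?b z = 0}"
  proof eventually_elim
    case (elim z)
    then show ?case using near[of z] pos[of z] by (cases "?b z = 0") auto
  qed
  \<comment> \<open>A closed set of full measure is the whole plane.\<close>
  moreover have "closed {z. ?b z = 0}"
    using bcont by (intro closed_Collect_eq) (auto intro: continuous_intros)
  ultimately have "z \<in> {z. ?b z = 0}" for z
    by (intro mem_closed_if_AE_lebesgue) (auto intro: AE_completion)
  \<comment> \<open>At distance 6/5 r the scaled squared distance is 36/25, inside the interval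
    (1,2) where \<open>step'\<close> is positive: a contradiction.\<close>
  then have a: "step' (dist2 p (p + of_real (6 / 5 * r)) / r\<^sup>2) = 0" using r by auto
  have b: "dist2 p (p + of_real (6 / 5 * r)) / r\<^sup>2 = 36 / 25"
    using r by (simp add: dist2_def power2_eq_square)
  show False using a step'_pos[of "36 / 25"] unfolding b by simp
qed

lemma test_fun_has_derivative:
  assumes "test_fun \<zeta>"
  shows "(\<zeta> has_derivative (\<lambda>h. grad \<zeta> z \<bullet> h)) (at z)"
    and "continuous_on UNIV (grad \<zeta>)"
    and "\<exists>\<rho>>0. \<forall>z. \<rho> < cmod z \<longrightarrow> \<zeta> z = 0 \<and> grad \<zeta> z = 0"
proof -
  have sm: "iter_partial bs \<zeta> differentiable (at z)" for bs z
    using assms by (simp add: test_fun_def smooth_def)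
  show d: "(\<zeta> has_derivative (\<lambda>h. grad \<zeta> z \<bullet> h)) (at z)" for z
    using sm[of "[]"] by (simp add: has_derivative_grad)
  have "continuous_on UNIV (partial b \<zeta>)" for b
    using sm[of "[b]"] by (auto intro!: continuous_at_imp_continuous_on differentiable_imp_continuous_within)
  moreover have "grad \<zeta> = (\<lambda>z. Complex (partial True \<zeta> z) (partial False \<zeta> z))"
    by (simp add: fun_eq_iff grad_def partial_def)
  ultimately show "continuous_on UNIV (grad \<zeta>)"
    by (simp add: Complex_eq) (intro continuous_intros; simp)
  have "bounded {z. \<zeta> z \<noteq> 0}"
    by (rule bounded_subset[OF compact_imp_bounded closure_subset]) (use assms in \<open>simp add: test_fun_def\<close>)
  then obtain B where B: "\<And>z. \<zeta> z \<noteq> 0 \<Longrightarrow> cmod z \<le> B" by (auto simp: bounded_iff)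
  show "\<exists>\<rho>>0. \<forall>z. \<rho> < cmod z \<longrightarrow> \<zeta> z = 0 \<and> grad \<zeta> z = 0"
  proof (intro exI[of _ "max 1 B"] conjI allI impI)
    fix z assume z: "max 1 B < cmod z"
    then show "\<zeta> z = 0" using B[of z] by force
    have "open {z. max 1 B < cmod z}" by (intro open_Collect_less continuous_intros)
    then have "eventually (\<lambda>z. \<zeta> z = 0) (nhds z)"
      using eventually_nhds_in_open[of "{z. max 1 B < cmod z}" z] z B
      by (force elim: eventually_mono)
    then have "(\<zeta> has_derivative (\<lambda>h. 0 \<bullet> h)) (at z)"
    proof -
      assume "eventually (\<lambda>z. \<zeta> z = 0) (nhds z)"
      then have "eventually (\<lambda>x. 0 = \<zeta> x) (at z)"
        by (auto simp: eventually_at_filter elim: eventually_mono)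
      from has_derivative_transform_eventually[OF has_derivative_const this] \<open>\<zeta> z = 0\<close> show ?thesis by simp
    qed
    then show "grad \<zeta> z = 0" by (rule grad_eqI)
  qed simp
qed

text \<open>The equation is linear, so the difference of two solutions satisfies it with right-hand
  side 0. Off the half plane both are 0 by definition, which gives equality as functions and makes
  \<open>U\<close> meaningful once a solution is exhibited.\<close>

lemma stray_potential_unique:
  assumes u: "is_stray_potential m' u" and v: "is_stray_potential m' v"
  shows "u = v"
proof
  fix z
  have du: "(f has_derivative (\<lambda>h. grad f z \<bullet> h)) (at z)" if "is_stray_potential m' f" "z \<in> upper_half" for f z
    using that by (intro has_derivative_grad) (simp add: is_stray_potential_def)
  have L2: "set_integrable lborel upper_half (\<lambda>z. (cmod (grad f z))\<^sup>2)" if "is_stray_potential m' f" for f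
    using that by (simp add: is_stray_potential_def)
  have meas: "(\<lambda>z. indicator upper_half z *\<^sub>R grad f z) \<in> borel_measurable borel" if "is_stray_potential m' f" for f
    by (rule borel_measurable_indicator_grad[OF du[OF that]])
  let ?W = "\<lambda>z. grad u z - grad v z"
  have dw: "((\<lambda>z. u z - v z) has_derivative (\<lambda>h. ?W z \<bullet> h)) (at z)" if "z \<in> upper_half" for z
    using has_derivative_diff[OF du[OF u that] du[OF v that]] by (simp add: inner_diff_left)
  have W2: "set_integrable lborel upper_half (\<lambda>z. (cmod (?W z))\<^sup>2)"
  proof -
    have "set_integrable lborel upper_half (\<lambda>z. (cmod (grad u z))\<^sup>2 + (cmod (grad v z))\<^sup>2 - 2 * (grad u z \<bullet> grad v z))"
      by (intro set_integral_diff(1) set_integral_add(1) L2 u v set_integrable_mult_right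
          set_integrable_inner_L2[OF meas[OF u] L2[OF u] meas[OF v] L2[OF v]])
    then show ?thesis
      by (simp add: power2_norm_eq_inner inner_diff_left inner_diff_right inner_commute algebra_simps)
  qed
  have lim: "filterlim (\<lambda>z. u z - v z) (nhds 0) (inf at_infinity (principal upper_half))"
    using tendsto_diff[of u 0 _ v 0] u v by (simp add: is_stray_potential_def)
  have weak: "(LINT z:upper_half|lborel. ?W z \<bullet> grad \<zeta> z) = 0" if t: "test_fun \<zeta>" for \<zeta>
  proof -
    note td = test_fun_has_derivative[OF t]
    obtain \<rho> where \<rho>: "\<And>z. \<rho> < cmod z \<Longrightarrow> grad \<zeta> z = 0" using td(3) by blast
    have [measurable]: "grad \<zeta> \<in> borel_measurable borel" using td(2) by (rule borel_measurable_continuous_onI)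
    have "integrable lborel (\<lambda>z. (cmod (grad \<zeta> z))\<^sup>2)"
      by (rule integrable_continuous_compact_support[of "cball 0 \<rho>"])
        (use \<rho> td(2) in \<open>auto intro!: continuous_intros intro: continuous_on_subset\<close>)
    then have g2: "set_integrable lborel upper_half (\<lambda>z. (cmod (grad \<zeta> z))\<^sup>2)"
      unfolding set_integrable_def by (rule integrable_mult_indicator[rotated]) simp
    have gi: "set_integrable lborel upper_half (\<lambda>z. grad f z \<bullet> grad \<zeta> z)" if "is_stray_potential m' f" for f
      by (rule set_integrable_inner_L2[OF meas[OF that] L2[OF that] _ g2]) measurable
    have "(LINT z:upper_half|lborel. grad u z \<bullet> grad \<zeta> z) = (LINT z:upper_half|lborel. grad v z \<bullet> grad \<zeta> z)"
      using u v t by (simp add: is_stray_potential_def)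
    then show ?thesis
      using set_integral_diff(2)[OF gi[OF u] gi[OF v]] by (simp add: inner_diff_left)
  qed
  show "u z = v z"
  proof (cases "z \<in> upper_half")
    case True
    then show ?thesis using weak_neumann_eq_0[OF dw W2 lim weak True] by simp
  next
    case False
    then show ?thesis using u v by (simp add: is_stray_potential_def)
  qed
qed

lemma U_eqI: "is_stray_potential m' u \<Longrightarrow> U m' = u"
  unfolding U_def by (blast intro: the_equality stray_potential_unique)

section \<open>The logarithmic potential of the boundary charge\<close>

text \<open>Write |\<xi> + h|^2 = |\<xi>|^2 (1 + q). With x = |h| / |\<xi>| <= 1/5 one has |q| <=
  11/5 x <= 1/2, the range in which the standard quadratic bound for ln (1 + q) - q applies.\<close>

lemma ln_cmod_expansion:
  assumes "\<xi> \<noteq> 0" "5 * cmod h \<le> cmod \<xi>"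
  shows "\<bar>ln (cmod (\<xi> + h)) - ln (cmod \<xi>) - (\<xi> /\<^sub>R (cmod \<xi>)\<^sup>2) \<bullet> h\<bar> \<le> 6 * (cmod h)\<^sup>2 / (cmod \<xi>)\<^sup>2"
proof -
  define x where "x = cmod h / cmod \<xi>"
  define i where "i = (\<xi> /\<^sub>R (cmod \<xi>)\<^sup>2) \<bullet> h"
  have x: "0 \<le> x" "x \<le> 1 / 5" using assms by (auto simp: x_def field_simps)
  have n0: "0 < cmod \<xi>" using assms by simp
  have i: "\<bar>i\<bar> \<le> x"
  proof -
    have "\<bar>i\<bar> \<le> cmod (\<xi> /\<^sub>R (cmod \<xi>)\<^sup>2) * cmod h" unfolding i_def by (rule Cauchy_Schwarz_ineq2)
    then show ?thesis using n0 by (simp add: x_def power2_eq_square field_simps)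
  qed
  define q where "q = 2 * i + x\<^sup>2"
  have "x\<^sup>2 \<le> 1/5 * x" using mult_right_mono[OF x(2) x(1)] by (simp add: power2_eq_square)
  then have q: "\<bar>q\<bar> \<le> 11 / 5 * x" using i x zero_le_power2[of x] unfolding q_def by linarith
  then have q2: "\<bar>q\<bar> \<le> 1 / 2" using x by linarith
  have "(cmod (\<xi> + h))\<^sup>2 = (cmod \<xi>)\<^sup>2 + 2 * (\<xi> \<bullet> h) + (cmod h)\<^sup>2"
    by (simp add: power2_norm_eq_inner inner_add_left inner_add_right inner_commute)
  also have "\<dots> = (cmod \<xi>)\<^sup>2 * (1 + q)"
    using n0 by (simp add: q_def i_def x_def field_simps)
  finally have sq: "(cmod (\<xi> + h))\<^sup>2 = (cmod \<xi>)\<^sup>2 * (1 + q)" .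
  have q1: "0 < 1 + q" using q2 by linarith
  then have "0 < (cmod (\<xi> + h))\<^sup>2" unfolding sq using n0 by simp
  then have "0 < cmod (\<xi> + h)" by simp
  then have "2 * ln (cmod (\<xi> + h)) = ln ((cmod (\<xi> + h))\<^sup>2)" by (simp add: ln_realpow)
  also have "\<dots> = 2 * ln (cmod \<xi>) + ln (1 + q)"
    unfolding sq using n0 q1 by (simp add: ln_mult ln_realpow)
  finally have l: "ln (cmod (\<xi> + h)) - ln (cmod \<xi>) - i = (ln (1 + q) - q) / 2 + x\<^sup>2 / 2"
    by (simp add: q_def field_simps)
  have "\<bar>ln (1 + q) - q\<bar> \<le> 2 * q\<^sup>2" by (rule abs_ln_one_plus_x_minus_x_bound[OF q2])
  also have "q\<^sup>2 \<le> (11 / 5 * x)\<^sup>2" using q by (rule abs_le_square_iff[THEN iffD1, OF order_trans]) simp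
  finally have "\<bar>ln (1 + q) - q\<bar> \<le> 2 * (11 / 5 * x)\<^sup>2" by simp
  moreover have "2 * (11 / 5 * x)\<^sup>2 = 242 / 25 * x\<^sup>2" by (simp add: power2_eq_square)
  ultimately have "\<bar>ln (1 + q) - q\<bar> \<le> 10 * x\<^sup>2" using zero_le_power2[of x] by linarith
  moreover have "\<bar>(l + X) / 2\<bar> \<le> 6 * X" if "\<bar>l\<bar> \<le> 10 * X" "0 \<le> X" for l X :: real
  proof (rule abs_leI)
    show "(l + X) / 2 \<le> 6 * X" using that abs_ge_self[of l] by (simp add: field_simps)
    show "- ((l + X) / 2) \<le> 6 * X" using that abs_ge_minus_self[of l] by (simp add: field_simps)
  qed
  ultimately have "\<bar>(ln (1 + q) - q + x\<^sup>2) / 2\<bar> \<le> 6 * x\<^sup>2" by simp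
  then have "\<bar>(ln (1 + q) - q) / 2 + x\<^sup>2 / 2\<bar> \<le> 6 * x\<^sup>2" by (simp add: add_divide_distrib)
  then show ?thesis unfolding l[unfolded i_def] x_def by (simp add: power_divide)
qed

text \<open>Uniform in x: the unit intervals to the left and right of x contribute at most 2 each,
  and elsewhere the integrand is at most 1 on an interval of length 2.\<close>

lemma nn_integral_inverse_sqrt_le:
  "(\<integral>\<^sup>+t. ennreal (1 / sqrt \<bar>x - t\<bar>) * indicator {-1..1} t \<partial>lborel) \<le> 6"
proof -
  have l: "(\<integral>\<^sup>+t. ennreal (1 / sqrt (x - t)) * indicator {x - 1<..<x} t \<partial>lborel) = ennreal (0 - (- 2))"
  proof (rule nn_integral_real_set_FTC_open[of _ _ "\<lambda>t. - 2 * sqrt (x - t)"])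
    show "((\<lambda>t. - 2 * sqrt (x - t)) has_real_derivative 1 / sqrt (x - t)) (at t)" if "t < x" for t
      using that by (auto intro!: derivative_eq_intros simp: field_simps)
    show "((\<lambda>t. - 2 * sqrt (x - t)) \<longlongrightarrow> - 2) (at_right (x - 1))" "((\<lambda>t. - 2 * sqrt (x - t)) \<longlongrightarrow> 0) (at_left x)"
      by (auto intro!: tendsto_eq_intros)
  qed (auto intro!: continuous_intros)
  have r: "(\<integral>\<^sup>+t. ennreal (1 / sqrt (t - x)) * indicator {x<..<x + 1} t \<partial>lborel) = ennreal (2 - 0)"
  proof (rule nn_integral_real_set_FTC_open[of _ _ "\<lambda>t. 2 * sqrt (t - x)"])
    show "((\<lambda>t. 2 * sqrt (t - x)) has_real_derivative 1 / sqrt (t - x)) (at t)" if "x < t" for t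
      using that by (auto intro!: derivative_eq_intros simp: field_simps)
    show "((\<lambda>t. 2 * sqrt (t - x)) \<longlongrightarrow> 0) (at_right x)" "((\<lambda>t. 2 * sqrt (t - x)) \<longlongrightarrow> 2) (at_left (x + 1))"
      by (auto intro!: tendsto_eq_intros)
  qed (auto intro!: continuous_intros)
  have "(\<integral>\<^sup>+t. ennreal (1 / sqrt \<bar>x - t\<bar>) * indicator {-1..1} t \<partial>lborel)
     \<le> (\<integral>\<^sup>+t. indicator {-1..1} t + (ennreal (1 / sqrt (x - t)) * indicator {x - 1<..<x} t
         + ennreal (1 / sqrt (t - x)) * indicator {x<..<x + 1} t) \<partial>lborel)"
  proof (rule nn_integral_mono)
    fix t
    consider "x = t" | "1 \<le> \<bar>x - t\<bar>" | "x - 1 < t" "t < x" | "x < t" "t < x + 1" by linarith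
    then show "ennreal (1 / sqrt \<bar>x - t\<bar>) * indicator {-1..1} t
        \<le> indicator {-1..1} t + (ennreal (1 / sqrt (x - t)) * indicator {x - 1<..<x} t
         + ennreal (1 / sqrt (t - x)) * indicator {x<..<x + 1} t)"
    proof cases
      case 2
      then have "1 / sqrt \<bar>x - t\<bar> \<le> 1" by simp
      then have "ennreal (1 / sqrt \<bar>x - t\<bar>) \<le> 1" by (simp add: ennreal_le_1)
      then show ?thesis by (auto split: split_indicator intro: add_increasing2)
    qed (auto split: split_indicator intro: add_increasing)
  qed
  also have "\<dots> = 2 + (ennreal 2 + ennreal 2)"
    using l r by (simp add: nn_integral_add)
  also have "\<dots> = 6" by (simp flip: ennreal_plus ennreal_numeral)
  finally show ?thesis .
qed

text \<open>\<open>f\<close> models the derivative of the first component of m, extended by 0.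
  Square integrability gives finite energy near the interval, and mean zero gives the decay at
  infinity.\<close>

locale boundary_charge =
  fixes f :: "real \<Rightarrow> real"
  assumes integrable_f: "integrable lborel f"
    and integrable_f2: "integrable lborel (\<lambda>t. (f t)\<^sup>2)"
    and supp: "\<And>t. t \<notin> {-1..1} \<Longrightarrow> f t = 0"
    and mean_zero: "(\<integral>t. f t \<partial>lborel) = 0"
begin

text \<open>The factor 1/pi, instead of the 1/(2 pi) of the whole plane, accounts for the even
  reflection that doubles the charge. The value 0 off the half plane is the one that
  \<open>is_stray_potential\<close> prescribes.\<close>

definition pot :: "complex \<Rightarrow> real" where
  "pot z = (if z \<in> upper_half then - (1 / pi) * (\<integral>t. f t * ln (cmod (z - of_real t)) \<partial>lborel) else 0)"

text \<open>The gradient of ln |z - t| with respect to z; correspondingly \<open>field\<close> will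
  be the gradient of \<open>pot\<close>.\<close>

definition kern :: "complex \<Rightarrow> real \<Rightarrow> complex" where
  "kern z t = (z - of_real t) /\<^sub>R (cmod (z - of_real t))\<^sup>2"

definition field :: "complex \<Rightarrow> complex" where
  "field z = - (1 / pi) *\<^sub>R (\<integral>t. f t *\<^sub>R kern z t \<partial>lborel)"

lemma kern_measurable [measurable (raw)]:
  assumes [measurable]: "g \<in> borel_measurable M" "h \<in> borel_measurable M"
  shows "(\<lambda>x. kern (g x) (h x)) \<in> borel_measurable M"
  unfolding kern_def by measurable

lemma f_measurable [measurable]: "f \<in> borel_measurable borel"
  using integrable_f by auto

lemma integrable_continuous_kernel:
  fixes k :: "real \<Rightarrow> 'a :: {banach, second_countable_topology}"
  assumes "continuous_on {-1..1} k"
  shows "integrable lborel (\<lambda>t. f t *\<^sub>R k t)"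
proof -
  have m: "(\<lambda>t. indicator {-1..1} t *\<^sub>R k t) \<in> borel_measurable borel"
    by (rule borel_measurable_continuous_on_indicator) (use assms in auto)
  have eq: "(\<lambda>t. f t *\<^sub>R k t) = (\<lambda>t. f t *\<^sub>R (indicator {-1..1} t *\<^sub>R k t))"
    using supp by (auto simp: fun_eq_iff split: split_indicator)
  have "bounded (k ` {-1..1})"
    using assms by (intro compact_imp_bounded compact_continuous_image) auto
  then obtain B where "\<forall>x\<in>k ` {-1..1}. norm x \<le> B"
    unfolding bounded_iff by blast
  then have B: "norm (k t) \<le> B" if "t \<in> {-1..1}" for t using that by blast
  show ?thesis
  proof (rule Bochner_Integration.integrable_bound)
    show "integrable lborel (\<lambda>t. \<bar>B\<bar> * \<bar>f t\<bar>)" using integrable_f by auto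
    show "(\<lambda>t. f t *\<^sub>R k t) \<in> borel_measurable lborel" unfolding eq using m by measurable
    show "AE t in lborel. norm (f t *\<^sub>R k t) \<le> norm (\<bar>B\<bar> * \<bar>f t\<bar>)"
    proof (rule AE_I2)
      fix t show "norm (f t *\<^sub>R k t) \<le> norm (\<bar>B\<bar> * \<bar>f t\<bar>)"
      proof (cases "t \<in> {-1..1}")
        case True
        then have "norm (k t) \<le> \<bar>B\<bar>" using B[of t] by linarith
        from mult_right_mono[OF this, of "\<bar>f t\<bar>"] show ?thesis by (simp add: abs_mult mult.commute)
      qed (simp add: supp)
    qed
  qed
qed

lemma integrable_ln_kernel: "z \<in> upper_half \<Longrightarrow> integrable lborel (\<lambda>t. f t * ln (cmod (z - of_real t)))"
proof -
  assume z: "z \<in> upper_half"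
  have "continuous_on {-1..1} (\<lambda>t. ln (cmod (z - of_real t)))"
    using upper_half_minus_real[OF z] by (intro continuous_intros) auto
  from integrable_continuous_kernel[OF this] show ?thesis by simp
qed

lemma integrable_kern: "z \<in> upper_half \<Longrightarrow> integrable lborel (\<lambda>t. f t *\<^sub>R kern z t)"
  unfolding kern_def using upper_half_minus_real[of z]
  by (intro integrable_continuous_kernel continuous_intros) auto

text \<open>The second order remainder of the logarithm is at most 6 |h|^2 / (Im z)^2 uniformly in
  t, so it can be integrated against |f|. The radius Im z / 5 matches the hypothesis of
  \<open>ln_cmod_expansion\<close>, because |z - t| >= Im z.\<close>

lemma pot_has_derivative:
  assumes z: "z \<in> upper_half"
  shows "(pot has_derivative (\<lambda>h. field z \<bullet> h)) (at z)"
proof (rule has_derivativeI_sandwich)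
  let ?y = "Im z"
  have y: "0 < ?y" using z by (simp add: upper_half_def)
  show "0 < ?y / 5" using y by simp
  show "bounded_linear (\<lambda>h. field z \<bullet> h)" by (rule bounded_linear_inner_right)
  let ?C = "6 / ?y\<^sup>2 * (\<integral>t. \<bar>f t\<bar> \<partial>lborel)"
  show "((\<lambda>y. ?C * norm (y - z)) \<longlongrightarrow> 0) (at z)"
    using y by (auto intro!: tendsto_eq_intros)
  fix w assume w: "w \<noteq> z" "dist w z < ?y / 5"
  define h where "h = w - z"
  have h: "w = z + h" "h \<noteq> 0" "5 * cmod h < ?y" using w by (auto simp: h_def dist_norm)
  have wH: "w \<in> upper_half"
  proof -
    have "\<bar>Im h\<bar> \<le> cmod h" by (rule abs_Im_le_cmod)
    then have "- Im h < ?y" using h(3) norm_ge_zero[of h] by linarith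
    then show ?thesis using h(1) by (simp add: upper_half_def)
  qed
  let ?r = "\<lambda>t. f t * (ln (cmod (w - of_real t)) - ln (cmod (z - of_real t)) - kern z t \<bullet> h)"
  have ir: "integrable lborel ?r"
    using integrable_ln_kernel[OF wH] integrable_ln_kernel[OF z] integrable_inner_left[OF integrable_kern[OF z], of h]
    by (simp add: right_diff_distrib)
  have "(\<integral>t. ?r t \<partial>lborel) = (\<integral>t. f t * ln (cmod (w - of_real t)) \<partial>lborel) - (\<integral>t. f t * ln (cmod (z - of_real t)) \<partial>lborel)
      - (\<integral>t. (f t *\<^sub>R kern z t) \<bullet> h \<partial>lborel)"
    using integrable_ln_kernel[OF wH] integrable_ln_kernel[OF z] integrable_inner_left[OF integrable_kern[OF z], of h]
    by (simp add: right_diff_distrib)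
  also have "(\<integral>t. (f t *\<^sub>R kern z t) \<bullet> h \<partial>lborel) = (\<integral>t. f t *\<^sub>R kern z t \<partial>lborel) \<bullet> h"
    by (rule integral_inner_left) (rule integrable_kern[OF z])
  finally have r: "(\<integral>t. ?r t \<partial>lborel) = (\<integral>t. f t * ln (cmod (w - of_real t)) \<partial>lborel)
      - (\<integral>t. f t * ln (cmod (z - of_real t)) \<partial>lborel) - (\<integral>t. f t *\<^sub>R kern z t \<partial>lborel) \<bullet> h" .
  have eq: "pot w - pot z - field z \<bullet> h = - (1 / pi) * (\<integral>t. ?r t \<partial>lborel)"
    unfolding r using z wH by (simp add: pot_def field_def algebra_simps diff_divide_distrib add_divide_distrib)
  have "\<bar>\<integral>t. ?r t \<partial>lborel\<bar> \<le> (\<integral>t. 6 * (cmod h)\<^sup>2 / ?y\<^sup>2 * \<bar>f t\<bar> \<partial>lborel)"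
  proof (rule order_trans[OF integral_abs_bound], rule integral_mono)
    show "integrable lborel (\<lambda>t. \<bar>?r t\<bar>)" using ir by auto
    show "integrable lborel (\<lambda>t. 6 * (cmod h)\<^sup>2 / ?y\<^sup>2 * \<bar>f t\<bar>)" using integrable_f by auto
    fix t
    let ?\<xi> = "z - of_real t"
    have yt: "?y \<le> cmod ?\<xi>" using abs_Im_le_cmod[of ?\<xi>] by simp
    have "\<bar>ln (cmod (?\<xi> + h)) - ln (cmod ?\<xi>) - kern z t \<bullet> h\<bar> \<le> 6 * (cmod h)\<^sup>2 / (cmod ?\<xi>)\<^sup>2"
      unfolding kern_def by (rule ln_cmod_expansion) (use y yt h in auto)
    also have "\<dots> \<le> 6 * (cmod h)\<^sup>2 / ?y\<^sup>2"
      using y yt by (intro divide_left_mono mult_pos_pos power_mono) auto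
    finally show "\<bar>?r t\<bar> \<le> 6 * (cmod h)\<^sup>2 / ?y\<^sup>2 * \<bar>f t\<bar>"
      unfolding abs_mult h(1) by (subst mult.commute, intro mult_right_mono) (auto simp: algebra_simps)
  qed
  also have "\<dots> = ?C * (cmod h)\<^sup>2" by simp
  finally have b: "\<bar>\<integral>t. ?r t \<partial>lborel\<bar> \<le> ?C * (cmod h)\<^sup>2" .
  have "norm (pot w - pot z - field z \<bullet> h) \<le> 1 * (?C * (cmod h)\<^sup>2)"
    unfolding eq real_norm_def abs_mult by (rule mult_mono[OF _ b]) (use pi_ge_two in auto)
  then have "norm (pot w - pot z - field z \<bullet> h) / norm h \<le> ?C * (cmod h)\<^sup>2 / norm h"
    by (intro divide_right_mono) auto
  also have "\<dots> = ?C * norm h" using h(2) by (simp add: power2_eq_square)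
  finally show "norm (pot w - pot z - field z \<bullet> (w - z)) / norm (w - z) \<le> ?C * norm (w - z)"
    unfolding h_def .
qed

lemma field_measurable: "(\<lambda>z. indicator upper_half z *\<^sub>R field z) \<in> borel_measurable borel"
  by (rule borel_measurable_indicator_grad[OF pot_has_derivative])

lemma cmod_kern: "cmod (kern z t) = 1 / cmod (z - of_real t)"
  by (cases "z = of_real t") (simp_all add: kern_def power2_eq_square divide_inverse)

lemma far_distance:
  assumes "2 \<le> cmod z" "t \<in> {-1..1}" shows "cmod z / 2 \<le> cmod (z - of_real t)"
proof -
  have "cmod z - \<bar>t\<bar> \<le> cmod (z - of_real t)"
    using norm_triangle_ineq2[of z "of_real t"] by simp
  then show ?thesis using assms by (auto simp: abs_le_iff)
qed

text \<open>Mean zero allows ln |z| to be subtracted from the kernel, and on the support of f the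
  difference of the logarithms is at most 2 / |z|.\<close>

lemma pot_far:
  assumes z: "z \<in> upper_half" "2 \<le> cmod z"
  shows "\<bar>pot z\<bar> \<le> 2 * (\<integral>t. \<bar>f t\<bar> \<partial>lborel) / cmod z"
proof -
  have i: "integrable lborel (\<lambda>t. f t * (ln (cmod (z - of_real t)) - ln (cmod z)))"
    using integrable_ln_kernel[OF z(1)] integrable_f by (simp add: right_diff_distrib)
  have "pot z = - (1 / pi) * (\<integral>t. f t * (ln (cmod (z - of_real t)) - ln (cmod z)) \<partial>lborel)"
    using integrable_ln_kernel[OF z(1)] integrable_f mean_zero z by (simp add: right_diff_distrib pot_def)
  moreover have "\<bar>\<integral>t. f t * (ln (cmod (z - of_real t)) - ln (cmod z)) \<partial>lborel\<bar> \<le> (\<integral>t. 2 / cmod z * \<bar>f t\<bar> \<partial>lborel)"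
  proof (rule order_trans[OF integral_abs_bound], rule integral_mono)
    show "integrable lborel (\<lambda>t. \<bar>f t * (ln (cmod (z - of_real t)) - ln (cmod z))\<bar>)" using i by auto
    show "integrable lborel (\<lambda>t. 2 / cmod z * \<bar>f t\<bar>)" using integrable_f by auto
    fix t
    show "\<bar>f t * (ln (cmod (z - of_real t)) - ln (cmod z))\<bar> \<le> 2 / cmod z * \<bar>f t\<bar>"
    proof (cases "t \<in> {-1..1}")
      case True
      let ?a = "cmod (z - of_real t)" and ?b = "cmod z"
      have ab: "?b / 2 \<le> ?a" "0 < ?b" using far_distance[OF z(2) True] z(2) by auto
      then have a0: "0 < ?a" by linarith
      have d: "\<bar>?a - ?b\<bar> \<le> 1" using norm_triangle_ineq3[of "z - of_real t" z] True by auto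
      have "ln ?a - ln ?b = ln (?a / ?b)" "ln ?b - ln ?a = ln (?b / ?a)" using a0 ab by (simp_all add: ln_div)
      moreover have "ln (?a / ?b) \<le> ?a / ?b - 1" "ln (?b / ?a) \<le> ?b / ?a - 1"
        using a0 ab by (auto intro!: ln_le_minus_one)
      moreover have "?a / ?b - 1 = (?a - ?b) / ?b" "?b / ?a - 1 = (?b - ?a) / ?a" using a0 ab by (simp_all add: field_simps)
      moreover have "(?a - ?b) / ?b \<le> 1 / ?b" "(?b - ?a) / ?a \<le> 1 / ?a"
        using d a0 ab by (auto intro!: divide_right_mono)
      moreover have "1 / ?a \<le> 1 / (?b / 2)" using ab by (intro frac_le) auto
      moreover have "0 < 1 / ?b" using ab by simp
      ultimately have "\<bar>ln ?a - ln ?b\<bar> \<le> 2 / ?b" by (intro abs_leI) (simp_all, linarith?)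
      then show ?thesis unfolding abs_mult by (subst mult.commute) (intro mult_right_mono, auto)
    qed (simp add: supp)
  qed
  moreover have "\<bar>- (1 / pi)\<bar> \<le> 1" using pi_ge_two by simp
  ultimately have "\<bar>pot z\<bar> \<le> 1 * (\<integral>t. 2 / cmod z * \<bar>f t\<bar> \<partial>lborel)"
    by (simp only: abs_mult) (rule mult_mono, auto)
  then show ?thesis by simp
qed

lemma pot_tendsto_0: "filterlim pot (nhds 0) (inf at_infinity (principal upper_half))"
proof (rule Lim_null_comparison)
  show "eventually (\<lambda>z. norm (pot z) \<le> 2 * (\<integral>t. \<bar>f t\<bar> \<partial>lborel) / cmod z) (inf at_infinity (principal upper_half))"
    using pot_far by (auto simp: eventually_inf_principal eventually_at_infinity intro!: exI[of _ 2])
  have "((\<lambda>z::complex. 2 * (\<integral>t. \<bar>f t\<bar> \<partial>lborel) / cmod z) \<longlongrightarrow> 0) at_infinity"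
    by (rule real_tendsto_divide_at_top[OF tendsto_const filterlim_norm_at_top])
  then show "((\<lambda>z::complex. 2 * (\<integral>t. \<bar>f t\<bar> \<partial>lborel) / cmod z) \<longlongrightarrow> 0) (inf at_infinity (principal upper_half))"
    by (rule tendsto_mono[OF inf_le1])
qed

text \<open>Subtracting z / |z|^2 from the kernel, which mean zero allows, improves the decay from
  1/|z| to 1/|z|^2; the former would not be square integrable at infinity.\<close>

lemma field_far:
  assumes z: "z \<in> upper_half" "2 \<le> cmod z"
  shows "cmod (field z) \<le> 2 * (\<integral>t. \<bar>f t\<bar> \<partial>lborel) / (cmod z)\<^sup>2"
proof -
  let ?k0 = "z /\<^sub>R (cmod z)\<^sup>2"
  have i: "integrable lborel (\<lambda>t. f t *\<^sub>R (kern z t - ?k0))"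
    using integrable_kern[OF z(1)] integrable_f by (simp add: scaleR_diff_right)
  have "field z = - (1 / pi) *\<^sub>R (\<integral>t. f t *\<^sub>R (kern z t - ?k0) \<partial>lborel)"
  proof -
    have "(\<integral>t. f t *\<^sub>R (kern z t - ?k0) \<partial>lborel) = (\<integral>t. f t *\<^sub>R kern z t \<partial>lborel) - (\<integral>t. f t *\<^sub>R ?k0 \<partial>lborel)"
      unfolding scaleR_diff_right
      by (rule Bochner_Integration.integral_diff[OF integrable_kern[OF z(1)]]) (use integrable_f in auto)
    also have "(\<integral>t. f t *\<^sub>R ?k0 \<partial>lborel) = 0"
      using integrable_f mean_zero by (subst integral_scaleR_left) auto
    finally show ?thesis by (simp add: field_def)
  qed
  moreover have "norm (\<integral>t. f t *\<^sub>R (kern z t - ?k0) \<partial>lborel) \<le> (\<integral>t. 2 / (cmod z)\<^sup>2 * \<bar>f t\<bar> \<partial>lborel)"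
  proof (rule order_trans[OF integral_norm_bound], rule integral_mono)
    show "integrable lborel (\<lambda>t. norm (f t *\<^sub>R (kern z t - ?k0)))" by (rule integrable_norm[OF i])
    show "integrable lborel (\<lambda>t. 2 / (cmod z)\<^sup>2 * \<bar>f t\<bar>)" using integrable_f by auto
    fix t
    show "norm (f t *\<^sub>R (kern z t - ?k0)) \<le> 2 / (cmod z)\<^sup>2 * \<bar>f t\<bar>"
    proof (cases "t \<in> {-1..1}")
      case True
      let ?a = "cmod (z - of_real t)" and ?b = "cmod z"
      have ab: "?b / 2 \<le> ?a" "0 < ?b" using far_distance[OF z(2) True] z(2) by auto
      then have a0: "0 < ?a" by linarith
      have inv: "v /\<^sub>R (cmod v)\<^sup>2 = inverse (cnj v)" for v
      proof (cases "v = 0")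
        case False
        then have "inverse (cnj v) = v / (v * cnj v)" by (simp add: field_simps)
        also have "\<dots> = v /\<^sub>R (cmod v)\<^sup>2"
          unfolding complex_norm_square[symmetric] by (simp add: scaleR_conv_of_real divide_inverse mult.commute)
        finally show ?thesis by simp
      qed simp
      have cz: "cnj z - of_real t = cnj (z - of_real t)" by simp
      have n: "cmod (cnj z - of_real t) = ?a" unfolding cz by (rule complex_mod_cnj)
      have nz: "cnj z - of_real t \<noteq> 0" "cnj z \<noteq> 0"
        unfolding cz complex_cnj_zero_iff using a0 ab by auto
      have "kern z t - ?k0 = inverse (cnj z - of_real t) - inverse (cnj z)"
        unfolding kern_def inv by simp
      also have "\<dots> = inverse (cnj z - of_real t) * of_real t * inverse (cnj z)"
        using inverse_diff_inverse[OF nz] by simp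
      finally have "norm (kern z t - ?k0) = \<bar>t\<bar> * (1 / ?a) * (1 / ?b)"
        by (simp add: norm_mult norm_inverse divide_inverse n)
      also have "\<dots> \<le> 1 * (1 / (?b / 2)) * (1 / ?b)"
        using ab a0 True by (intro mult_mono divide_left_mono) auto
      finally have "norm (kern z t - ?k0) \<le> 2 / ?b\<^sup>2" by (simp add: power2_eq_square)
      then show ?thesis unfolding norm_scaleR by (subst mult.commute) (intro mult_right_mono, auto)
    qed (simp add: supp)
  qed
  moreover have "\<bar>- (1 / pi)\<bar> \<le> 1" using pi_ge_two by simp
  ultimately have "cmod (field z) \<le> 1 * (\<integral>t. 2 / (cmod z)\<^sup>2 * \<bar>f t\<bar> \<partial>lborel)"
    by (simp only: norm_scaleR) (rule mult_mono, auto)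
  then show ?thesis by simp
qed

text \<open>Cauchy-Schwarz in t with 1/|z - t| split as |z - t|^(-3/4) times |z - t|^(-1/4). The
  square of the second factor has a bounded integral over t in [-1,1], and the square of the first,
  |z - t|^(-3/2), is locally integrable in z, so only the L^2 norm of f remains. Keeping the whole
  kernel in one factor would produce |z - t|^(-2), which is not locally integrable.\<close>

lemma field_L2_near:
  "(\<integral>\<^sup>+z. indicator upper_half z * indicator (ball 0 2) z * ennreal ((cmod (field z))\<^sup>2) \<partial>lborel) < \<infinity>"
proof -
  have [measurable]: "ball (0::complex) 2 \<in> sets borel" by simp
  let ?q = "\<lambda>z t. ennreal ((f t)\<^sup>2) * ennreal (1 / (cmod (z - of_real t) * sqrt (cmod (z - of_real t))))"
  have pw: "ennreal ((cmod (field z))\<^sup>2) \<le> 6 * (\<integral>\<^sup>+t. ?q z t \<partial>lborel)" if z: "z \<in> upper_half" for z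
  proof -
    let ?F = "\<lambda>t. ennreal (\<bar>f t\<bar> / sqrt (cmod (z - of_real t) * sqrt (cmod (z - of_real t))))"
    let ?G = "\<lambda>t. ennreal (1 / sqrt (sqrt (cmod (z - of_real t)))) * indicator {-1..1} t"
    have pos: "0 < cmod (z - of_real t)" for t using upper_half_minus_real[OF z] by simp
    have "cmod (field z) = (1 / pi) * norm (\<integral>t. f t *\<^sub>R kern z t \<partial>lborel)" by (simp add: field_def)
    also have "\<dots> \<le> 1 * norm (\<integral>t. f t *\<^sub>R kern z t \<partial>lborel)" using pi_ge_two by (intro mult_right_mono) auto
    finally have "ennreal (cmod (field z)) \<le> ennreal (norm (\<integral>t. f t *\<^sub>R kern z t \<partial>lborel))" by (simp add: ennreal_leI)
    also have "\<dots> \<le> (\<integral>\<^sup>+t. ennreal (norm (f t *\<^sub>R kern z t)) \<partial>lborel)"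
      by (rule integral_norm_bound_ennreal[OF integrable_kern[OF z]])
    also have "\<dots> = (\<integral>\<^sup>+t. ?F t * ?G t \<partial>lborel)"
    proof (rule nn_integral_cong)
      fix t
      have "sqrt (r * sqrt r) * sqrt (sqrt r) = r" if "0 < r" for r :: real
        using that by (simp flip: real_sqrt_mult add: mult.assoc)
      from this[OF pos[of t]] have e: "\<bar>f t\<bar> / sqrt (cmod (z - of_real t) * sqrt (cmod (z - of_real t))) * (1 / sqrt (sqrt (cmod (z - of_real t))))
          = \<bar>f t\<bar> / cmod (z - of_real t)" by simp
      show "ennreal (norm (f t *\<^sub>R kern z t)) = ?F t * ?G t"
      proof (cases "t \<in> {-1..1}")
        case True
        then have "?F t * ?G t = ennreal (\<bar>f t\<bar> / sqrt (cmod (z - of_real t) * sqrt (cmod (z - of_real t))) * (1 / sqrt (sqrt (cmod (z - of_real t)))))"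
          by (subst ennreal_mult) auto
        then have "?F t * ?G t = ennreal (\<bar>f t\<bar> / cmod (z - of_real t))"
          unfolding e .
        then show ?thesis by (simp add: cmod_kern)
      qed (simp add: supp)
    qed
    finally have "(ennreal (cmod (field z)))\<^sup>2 \<le> (\<integral>\<^sup>+t. ?F t * ?G t \<partial>lborel)\<^sup>2" by (rule power_mono) simp
    also have "\<dots> \<le> (\<integral>\<^sup>+t. ?F t ^ 2 \<partial>lborel) * (\<integral>\<^sup>+t. ?G t ^ 2 \<partial>lborel)"
      by (rule Cauchy_Schwarz_nn_integral) measurable
    also have "(\<integral>\<^sup>+t. ?F t ^ 2 \<partial>lborel) = (\<integral>\<^sup>+t. ?q z t \<partial>lborel)"
    proof (rule nn_integral_cong)
      fix t
      show "?F t ^ 2 = ?q z t"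
        using pos[of t] by (simp add: ennreal_power power_divide flip: ennreal_mult)
    qed
    finally have le: "(ennreal (cmod (field z)))\<^sup>2 \<le> (\<integral>\<^sup>+t. ?q z t \<partial>lborel) * (\<integral>\<^sup>+t. ?G t ^ 2 \<partial>lborel)" .
    have "(\<integral>\<^sup>+t. ?G t ^ 2 \<partial>lborel) \<le> (\<integral>\<^sup>+t. ennreal (1 / sqrt \<bar>Re z - t\<bar>) * indicator {-1..1} t \<partial>lborel)"
    proof (rule nn_integral_mono_AE)
      show "AE t in lborel. ?G t ^ 2 \<le> ennreal (1 / sqrt \<bar>Re z - t\<bar>) * indicator {-1..1} t"
        using AE_lborel_singleton[of "Re z"]
      proof eventually_elim
        case (elim t)
        have "\<bar>Re z - t\<bar> \<le> cmod (z - of_real t)" using abs_Re_le_cmod[of "z - of_real t"] by simp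
        then have "1 / sqrt (cmod (z - of_real t)) \<le> 1 / sqrt \<bar>Re z - t\<bar>"
          using elim by (intro frac_le) auto
        moreover have "?G t ^ 2 = ennreal (1 / sqrt (cmod (z - of_real t))) * indicator {-1..1} t"
          by (simp add: power_mult_distrib ennreal_power power_divide split: split_indicator)
        ultimately show ?case by (auto intro!: mult_right_mono ennreal_leI)
      qed
    qed
    also have "\<dots> \<le> 6" by (rule nn_integral_inverse_sqrt_le)
    finally have "(\<integral>\<^sup>+t. ?q z t \<partial>lborel) * (\<integral>\<^sup>+t. ?G t ^ 2 \<partial>lborel) \<le> (\<integral>\<^sup>+t. ?q z t \<partial>lborel) * 6"
      by (rule mult_left_mono) simp
    with le have "(ennreal (cmod (field z)))\<^sup>2 \<le> (\<integral>\<^sup>+t. ?q z t \<partial>lborel) * 6" by (rule order_trans)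
    then show ?thesis by (simp only: ennreal_power[OF norm_ge_zero] mult.commute)
  qed
  have "(\<integral>\<^sup>+z. indicator upper_half z * indicator (ball 0 2) z * ennreal ((cmod (field z))\<^sup>2) \<partial>lborel)
      \<le> (\<integral>\<^sup>+z. (\<integral>\<^sup>+t. 6 * (indicator upper_half z * indicator (ball 0 2) z * ?q z t) \<partial>lborel) \<partial>lborel)"
  proof (rule nn_integral_mono)
    fix z
    have "indicator upper_half z * indicator (ball 0 2) z * ennreal ((cmod (field z))\<^sup>2)
        \<le> indicator upper_half z * indicator (ball 0 2) z * (6 * (\<integral>\<^sup>+t. ?q z t \<partial>lborel))"
      using pw[of z] by (auto split: split_indicator)
    also have "\<dots> = (\<integral>\<^sup>+t. 6 * (indicator upper_half z * indicator (ball 0 2) z * ?q z t) \<partial>lborel)"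
      by (cases "z \<in> upper_half \<and> z \<in> ball 0 2") (auto simp: nn_integral_cmult)
    finally show "indicator upper_half z * indicator (ball 0 2) z * ennreal ((cmod (field z))\<^sup>2)
        \<le> (\<integral>\<^sup>+t. 6 * (indicator upper_half z * indicator (ball 0 2) z * ?q z t) \<partial>lborel)" .
  qed
  also have "\<dots> = (\<integral>\<^sup>+t. (\<integral>\<^sup>+z. 6 * (indicator upper_half z * indicator (ball 0 2) z * ?q z t) \<partial>lborel) \<partial>lborel)"
    by (rule lborel_pair.Fubini') (simp add: split_def)
  also have "\<dots> \<le> (\<integral>\<^sup>+t. (6 * ennreal (2 * pi * sqrt 3)) * ennreal ((f t)\<^sup>2) \<partial>lborel)"
  proof (rule nn_integral_mono)
    fix t
    show "(\<integral>\<^sup>+z. 6 * (indicator upper_half z * indicator (ball 0 2) z * ?q z t) \<partial>lborel)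
        \<le> (6 * ennreal (2 * pi * sqrt 3)) * ennreal ((f t)\<^sup>2)"
    proof (cases "t \<in> {-1..1}")
      case True
      let ?k = "\<lambda>z. ennreal (1 / (cmod (z - of_real t) * sqrt (cmod (z - of_real t))))
            * indicator {..<3} (cmod (z - of_real t)) * indicator upper_half z"
      have "(\<integral>\<^sup>+z. 6 * (indicator upper_half z * indicator (ball 0 2) z * ?q z t) \<partial>lborel)
         \<le> (\<integral>\<^sup>+z. (6 * ennreal ((f t)\<^sup>2)) * ?k z \<partial>lborel)"
      proof (rule nn_integral_mono)
        fix z :: complex
        have "cmod (z - of_real t) < 3" if "z \<in> ball 0 2"
          using norm_triangle_ineq4[of z "of_real t"] that True by auto
        then show "6 * (indicator upper_half z * indicator (ball 0 2) z * ?q z t) \<le> (6 * ennreal ((f t)\<^sup>2)) * ?k z"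
          by (auto split: split_indicator simp: mult_ac)
      qed
      also have "\<dots> = (6 * ennreal ((f t)\<^sup>2)) * ennreal (2 * pi * sqrt 3)"
        by (subst nn_integral_cmult) (simp_all add: nn_integral_half_plane_inverse_three_halves)
      finally show ?thesis by (simp add: mult_ac)
    qed (simp add: supp)
  qed
  also have "\<dots> = (6 * ennreal (2 * pi * sqrt 3)) * (\<integral>\<^sup>+t. ennreal ((f t)\<^sup>2) \<partial>lborel)"
    by (rule nn_integral_cmult) simp
  also have "\<dots> < \<infinity>"
    using integrable_f2 by (simp add: integrable_iff_bounded ennreal_mult_less_top)
  finally show ?thesis .
qed

lemma field_L2: "set_integrable lborel upper_half (\<lambda>z. (cmod (field z))\<^sup>2)"
  unfolding set_integrable_def
proof (rule integrableI_bounded)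
  let ?C = "2 * (\<integral>t. \<bar>f t\<bar> \<partial>lborel)"
  have C: "0 \<le> ?C" by simp
  have "(\<lambda>z. indicator upper_half z *\<^sub>R (cmod (field z))\<^sup>2) = (\<lambda>z. (cmod (indicator upper_half z *\<^sub>R field z))\<^sup>2)"
    by (auto simp: fun_eq_iff split: split_indicator)
  then show m: "(\<lambda>z. indicator upper_half z *\<^sub>R (cmod (field z))\<^sup>2) \<in> borel_measurable lborel"
    using measurable_compose[OF field_measurable, of "\<lambda>w. (cmod w)\<^sup>2" borel] by simp
  have m1 [measurable]: "(\<lambda>z. indicator upper_half z * indicator (ball 0 2) z * ennreal ((cmod (field z))\<^sup>2)) \<in> borel_measurable borel"
  proof -
    have "(\<lambda>z. indicator (ball 0 2) z * ennreal (indicator upper_half z *\<^sub>R (cmod (field z))\<^sup>2)) \<in> borel_measurable borel"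
      using m by (intro borel_measurable_times_ennreal measurable_compose[OF _ measurable_ennreal] borel_measurable_indicator) auto
    also have "(\<lambda>z. indicator (ball 0 2) z * ennreal (indicator upper_half z *\<^sub>R (cmod (field z))\<^sup>2))
       = (\<lambda>z. indicator upper_half z * indicator (ball 0 2) z * ennreal ((cmod (field z))\<^sup>2))"
      by (auto simp: fun_eq_iff split: split_indicator)
    finally show ?thesis .
  qed
  let ?k = "\<lambda>z. ennreal (1 / (cmod (z - of_real 0))^3) * indicator {2..} (cmod (z - of_real 0)) * indicator upper_half z"
  have "(\<integral>\<^sup>+z. ennreal (norm (indicator upper_half z *\<^sub>R (cmod (field z))\<^sup>2)) \<partial>lborel)
     \<le> (\<integral>\<^sup>+z. indicator upper_half z * indicator (ball 0 2) z * ennreal ((cmod (field z))\<^sup>2) + ennreal (?C\<^sup>2) * ?k z \<partial>lborel)"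
  proof (rule nn_integral_mono)
    fix z
    show "ennreal (norm (indicator upper_half z *\<^sub>R (cmod (field z))\<^sup>2))
       \<le> indicator upper_half z * indicator (ball 0 2) z * ennreal ((cmod (field z))\<^sup>2) + ennreal (?C\<^sup>2) * ?k z"
    proof (cases "z \<in> upper_half \<and> 2 \<le> cmod z")
      case True
      then have "(cmod (field z))\<^sup>2 \<le> (?C / (cmod z)\<^sup>2)\<^sup>2"
        using field_far[of z] by (intro power_mono) auto
      also have "\<dots> = ?C\<^sup>2 * (1 / (cmod z)^4)" by (simp add: power_divide)
      also have "\<dots> \<le> ?C\<^sup>2 * (1 / (cmod z)^3)"
        using True by (intro mult_left_mono frac_le power_increasing) auto
      finally have "ennreal ((cmod (field z))\<^sup>2) \<le> ennreal (?C\<^sup>2) * ennreal (1 / (cmod z)^3)"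
        by (simp add: ennreal_leI flip: ennreal_mult)
      then show ?thesis using True by simp
    qed (auto split: split_indicator)
  qed
  also have "\<dots> = (\<integral>\<^sup>+z. indicator upper_half z * indicator (ball 0 2) z * ennreal ((cmod (field z))\<^sup>2) \<partial>lborel)
      + ennreal (?C\<^sup>2) * ennreal (pi / 2)"
    using nn_integral_half_plane_inverse_cube[of 2 0] by (subst nn_integral_add) (auto simp: nn_integral_cmult)
  also have "\<dots> < \<infinity>"
    using field_L2_near by (simp add: ennreal_mult_less_top)
  finally show "(\<integral>\<^sup>+z. ennreal (norm (indicator upper_half z *\<^sub>R (cmod (field z))\<^sup>2)) \<partial>lborel) < \<infinity>" .
qed

text \<open>Fubini against the kernel: for each t in the interval the integral over z equals pi
  times \<zeta>i - \<zeta>0 t up to the charge factor, the constant \<zeta>i drops out because the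
  charge has mean zero, and the factor -1/pi in \<open>field\<close> does the rest. The bound
  uniform in t supplies absolute integrability. The truncated profile satisfies these hypotheses
  although it is not a test function.\<close>

lemma pairing:
  fixes \<zeta> :: "complex \<Rightarrow> real" and G :: "complex \<Rightarrow> complex"
  assumes der: "\<And>z. z \<in> upper_half \<Longrightarrow> (\<zeta> has_derivative (\<lambda>h. G z \<bullet> h)) (at z)"
    and cont: "continuous_on upper_half G"
    and bound: "\<And>t. t \<in> {-1..1} \<Longrightarrow>
      (\<integral>\<^sup>+z. ennreal (cmod (G z) / cmod (z - of_real t)) * indicator upper_half z \<partial>lborel) \<le> ennreal K"
    and lim0: "\<And>t. t \<in> {-1..1} \<Longrightarrow> (\<zeta> \<longlongrightarrow> \<zeta>0 t) (at (of_real t) within upper_half)"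
    and limi: "(\<zeta> \<longlongrightarrow> \<zeta>i) (inf at_infinity (principal upper_half))"
  shows "(LINT z:upper_half|lborel. field z \<bullet> G z) = (\<integral>t. f t * \<zeta>0 t \<partial>lborel)"
proof -
  define Gt where "Gt z = indicator upper_half z *\<^sub>R G z" for z
  have [measurable]: "Gt \<in> borel_measurable borel"
    unfolding Gt_def[abs_def] by (rule borel_measurable_continuous_on_indicator) (use cont in auto)
  define Q where "Q t z = f t * (Gt z \<bullet> kern z t)" for t z
  have [measurable]: "(\<lambda>p. Q (fst p) (snd p)) \<in> borel_measurable (lborel \<Otimes>\<^sub>M lborel)"
    unfolding Q_def by measurable
  have bt: "(\<integral>\<^sup>+z. ennreal \<bar>Gt z \<bullet> kern z t\<bar> \<partial>lborel) \<le> ennreal K" if "t \<in> {-1..1}" for t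
  proof (rule order_trans[OF nn_integral_mono bound[OF that]])
    fix z
    have "\<bar>Gt z \<bullet> kern z t\<bar> \<le> cmod (Gt z) * cmod (kern z t)" by (rule Cauchy_Schwarz_ineq2)
    then show "ennreal \<bar>Gt z \<bullet> kern z t\<bar> \<le> ennreal (cmod (G z) / cmod (z - of_real t)) * indicator upper_half z"
      by (auto simp: Gt_def cmod_kern ennreal_leI split: split_indicator)
  qed
  have Q: "integrable (lborel \<Otimes>\<^sub>M lborel) (\<lambda>p. Q (fst p) (snd p))"
  proof (rule integrableI_bounded)
    have "(\<integral>\<^sup>+p. ennreal (norm (Q (fst p) (snd p))) \<partial>(lborel \<Otimes>\<^sub>M lborel))
       = (\<integral>\<^sup>+t. (\<integral>\<^sup>+z. ennreal \<bar>f t\<bar> * ennreal \<bar>Gt z \<bullet> kern z t\<bar> \<partial>lborel) \<partial>lborel)"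
      by (subst lborel.nn_integral_fst[symmetric]) (simp_all add: Q_def abs_mult ennreal_mult)
    also have "\<dots> \<le> (\<integral>\<^sup>+t. ennreal \<bar>f t\<bar> * ennreal K \<partial>lborel)"
    proof (rule nn_integral_mono)
      fix t
      have "(\<integral>\<^sup>+z. ennreal \<bar>f t\<bar> * ennreal \<bar>Gt z \<bullet> kern z t\<bar> \<partial>lborel)
         = ennreal \<bar>f t\<bar> * (\<integral>\<^sup>+z. ennreal \<bar>Gt z \<bullet> kern z t\<bar> \<partial>lborel)"
        by (rule nn_integral_cmult) measurable
      then show "(\<integral>\<^sup>+z. ennreal \<bar>f t\<bar> * ennreal \<bar>Gt z \<bullet> kern z t\<bar> \<partial>lborel) \<le> ennreal \<bar>f t\<bar> * ennreal K"
        using bt[of t] supp[of t] by (cases "t \<in> {-1..1}") (auto intro: mult_left_mono)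
    qed
    also have "\<dots> = (\<integral>\<^sup>+t. ennreal \<bar>f t\<bar> \<partial>lborel) * ennreal K" by (rule nn_integral_multc) simp
    also have "\<dots> < \<infinity>"
      using integrable_f by (simp add: integrable_iff_bounded ennreal_mult_less_top)
    finally show "(\<integral>\<^sup>+p. ennreal (norm (Q (fst p) (snd p))) \<partial>(lborel \<Otimes>\<^sub>M lborel)) < \<infinity>" .
  qed simp
  have inner: "(\<integral>z. Q t z \<partial>lborel) = f t * (pi * (\<zeta>i - \<zeta>0 t))" for t
  proof (cases "t \<in> {-1..1}")
    case True
    have "set_integrable lborel upper_half (\<lambda>z. cmod (G z) / cmod (z - of_real t))"
      unfolding set_integrable_def
    proof (rule integrableI_bounded)
      have "(\<lambda>z. cmod (Gt z) / cmod (z - of_real t)) \<in> borel_measurable lborel" by measurable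
      also have "(\<lambda>z. cmod (Gt z) / cmod (z - of_real t)) = (\<lambda>z. indicator upper_half z *\<^sub>R (cmod (G z) / cmod (z - of_real t)))"
        by (auto simp: Gt_def fun_eq_iff split: split_indicator)
      finally show "(\<lambda>z. indicator upper_half z *\<^sub>R (cmod (G z) / cmod (z - of_real t))) \<in> borel_measurable lborel" .
      have "(\<integral>\<^sup>+z. ennreal (norm (indicator upper_half z *\<^sub>R (cmod (G z) / cmod (z - of_real t)))) \<partial>lborel)
         = (\<integral>\<^sup>+z. ennreal (cmod (G z) / cmod (z - of_real t)) * indicator upper_half z \<partial>lborel)"
        by (intro nn_integral_cong) (auto split: split_indicator)
      also have "\<dots> < \<infinity>" using bound[OF True] by (auto intro: le_less_trans)
      finally show "(\<integral>\<^sup>+z. ennreal (norm (indicator upper_half z *\<^sub>R (cmod (G z) / cmod (z - of_real t)))) \<partial>lborel) < \<infinity>" .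
    qed
    note E = set_integral_grad_inner_kernel[OF der cont this lim0[OF True] limi]
    have "(\<lambda>z. Gt z \<bullet> kern z t)
        = (\<lambda>z. indicator upper_half z *\<^sub>R (G z \<bullet> ((z - of_real t) /\<^sub>R (cmod (z - of_real t))\<^sup>2)))"
      by (auto simp: fun_eq_iff Gt_def kern_def split: split_indicator)
    with E have "(\<integral>z. Gt z \<bullet> kern z t \<partial>lborel) = pi * (\<zeta>i - \<zeta>0 t)"
      by (simp only: set_lebesgue_integral_def)
    then show ?thesis unfolding Q_def by simp
  qed (simp add: Q_def supp)
  have "integrable lborel (\<lambda>t. (1 / pi) * (\<integral>z. Q t z \<partial>lborel))"
    using lborel_pair.integrable_fst[of Q] Q by (simp add: split_def)
  then have "integrable lborel (\<lambda>t. \<zeta>i * f t - (1 / pi) * (\<integral>z. Q t z \<partial>lborel))"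
    using integrable_f by (intro Bochner_Integration.integrable_diff) auto
  also have "(\<lambda>t. \<zeta>i * f t - (1 / pi) * (\<integral>z. Q t z \<partial>lborel)) = (\<lambda>t. f t * \<zeta>0 t)"
    unfolding inner by (auto simp: fun_eq_iff algebra_simps)
  finally have i0: "integrable lborel (\<lambda>t. f t * \<zeta>0 t)" .
  have "(LINT z:upper_half|lborel. field z \<bullet> G z) = (\<integral>z. - (1 / pi) * (\<integral>t. Q t z \<partial>lborel) \<partial>lborel)"
    unfolding set_lebesgue_integral_def
  proof (rule Bochner_Integration.integral_cong[OF refl])
    fix z
    show "indicator upper_half z *\<^sub>R (field z \<bullet> G z) = - (1 / pi) * (\<integral>t. Q t z \<partial>lborel)"
    proof (cases "z \<in> upper_half")
      case True
      have "(\<integral>t. Q t z \<partial>lborel) = (\<integral>t. (f t *\<^sub>R kern z t) \<bullet> G z \<partial>lborel)"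
        using True by (simp add: Q_def Gt_def inner_commute)
      also have "\<dots> = (\<integral>t. f t *\<^sub>R kern z t \<partial>lborel) \<bullet> G z"
        by (rule integral_inner_left) (rule integrable_kern[OF True])
      finally show ?thesis using True by (simp add: field_def)
    qed (simp add: Q_def Gt_def)
  qed
  also have "\<dots> = - (1 / pi) * (\<integral>z. (\<integral>t. Q t z \<partial>lborel) \<partial>lborel)" by (rule integral_mult_right_zero)
  also have "(\<integral>z. (\<integral>t. Q t z \<partial>lborel) \<partial>lborel) = (\<integral>t. (\<integral>z. Q t z \<partial>lborel) \<partial>lborel)"
    by (rule lborel_pair.Fubini_integral) (use Q in \<open>simp add: split_def\<close>)
  also have "\<dots> = (\<integral>t. pi * \<zeta>i * f t - pi * (f t * \<zeta>0 t) \<partial>lborel)"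
    unfolding inner by (intro Bochner_Integration.integral_cong) (auto simp: algebra_simps)
  also have "\<dots> = - pi * (\<integral>t. f t * \<zeta>0 t \<partial>lborel)"
    using i0 integrable_f mean_zero by (subst Bochner_Integration.integral_diff) auto
  finally show ?thesis by simp
qed

lemma pairing_test_fun:
  assumes t: "test_fun \<zeta>"
  shows "(LINT z:upper_half|lborel. field z \<bullet> grad \<zeta> z) = (\<integral>t. f t * \<zeta> (of_real t) \<partial>lborel)"
proof -
  note td = test_fun_has_derivative[OF t]
  obtain \<rho> where \<rho>: "0 < \<rho>" "\<And>z. \<rho> < cmod z \<Longrightarrow> \<zeta> z = 0 \<and> grad \<zeta> z = 0" using td(3) by blast
  have "compact (grad \<zeta> ` cball 0 \<rho>)"
    by (intro compact_continuous_image) (auto intro: continuous_on_subset[OF td(2)])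
  from compact_imp_bounded[OF this] obtain B where B: "\<forall>x\<in>grad \<zeta> ` cball 0 \<rho>. norm x \<le> B"
    unfolding bounded_iff by blast
  have gB: "cmod (grad \<zeta> z) \<le> \<bar>B\<bar>" for z
  proof (cases "cmod z \<le> \<rho>")
    case True
    then have "cmod (grad \<zeta> z) \<le> B" using B by auto
    then show ?thesis by linarith
  qed (use \<rho>(2)[of z] in auto)
  show ?thesis
  proof (rule pairing)
    show "continuous_on upper_half (grad \<zeta>)" using td(2) by (rule continuous_on_subset) simp
    show "(\<zeta> has_derivative (\<lambda>h. grad \<zeta> z \<bullet> h)) (at z)" for z by (rule td(1))
    have "isCont \<zeta> z" for z using td(1)[of z] by (rule has_derivative_continuous)
    then show "(\<zeta> \<longlongrightarrow> \<zeta> (of_real t)) (at (of_real t) within upper_half)" for t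
      by (auto simp: isCont_def intro: tendsto_within_subset)
    show "(\<zeta> \<longlongrightarrow> 0) (inf at_infinity (principal upper_half))"
    proof (rule tendsto_mono[OF inf_le1 tendsto_eventually])
      show "eventually (\<lambda>z. \<zeta> z = 0) at_infinity"
        unfolding eventually_at_infinity by (rule exI[of _ "\<rho> + 1"]) (use \<rho>(2) in auto)
    qed
    fix t :: real assume t: "t \<in> {-1..1}"
    let ?k = "\<lambda>z. ennreal (1 / cmod (z - of_real t)) * indicator {..\<rho> + 1} (cmod (z - of_real t)) * indicator upper_half z"
    have "(\<integral>\<^sup>+z. ennreal (cmod (grad \<zeta> z) / cmod (z - of_real t)) * indicator upper_half z \<partial>lborel)
       \<le> (\<integral>\<^sup>+z. ennreal \<bar>B\<bar> * ?k z \<partial>lborel)"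
    proof (rule nn_integral_mono)
      fix z
      show "ennreal (cmod (grad \<zeta> z) / cmod (z - of_real t)) * indicator upper_half z \<le> ennreal \<bar>B\<bar> * ?k z"
      proof (cases "cmod z \<le> \<rho>")
        case True
        then have "cmod (z - of_real t) \<le> \<rho> + 1" using norm_triangle_ineq4[of z "of_real t"] t by auto
        moreover have "ennreal (cmod (grad \<zeta> z) / cmod (z - of_real t)) \<le> ennreal (\<bar>B\<bar> * (1 / cmod (z - of_real t)))"
          using divide_right_mono[OF gB[of z] norm_ge_zero[of "z - of_real t"]] by (intro ennreal_leI) simp
        ultimately show ?thesis
          unfolding ennreal_mult[OF abs_ge_zero divide_nonneg_nonneg[OF zero_le_one norm_ge_zero]]
          by (auto split: split_indicator)
      qed (use \<rho>(2)[of z] in auto)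
    qed
    also have "\<dots> = ennreal (\<bar>B\<bar> * (pi * (\<rho> + 1)))"
      using \<rho>(1) by (subst nn_integral_cmult) (simp_all add: nn_integral_half_plane_inverse ennreal_mult)
    finally show "(\<integral>\<^sup>+z. ennreal (cmod (grad \<zeta> z) / cmod (z - of_real t)) * indicator upper_half z \<partial>lborel)
        \<le> ennreal (\<bar>B\<bar> * (pi * (\<rho> + 1)))" .
  qed
qed

lemma is_stray_potential_pot:
  assumes "\<And>t. t \<in> {-1..1} \<Longrightarrow> f t = Re (m' t)"
  shows "is_stray_potential m' pot"
  unfolding is_stray_potential_def
proof (intro conjI allI impI ballI)
  have g: "grad pot z = field z" if "z \<in> upper_half" for z
    by (rule grad_eqI[OF pot_has_derivative[OF that]])
  show "pot z = 0" if "z \<notin> upper_half" for z using that by (simp add: pot_def)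
  show "pot differentiable (at z)" if "z \<in> upper_half" for z
    using pot_has_derivative[OF that] by (auto simp: differentiable_def)
  show "set_integrable lborel upper_half (\<lambda>z. (norm (grad pot z))\<^sup>2)"
    using field_L2 g by (subst set_integrable_cong[OF refl refl, of _ _ "\<lambda>z. (cmod (field z))\<^sup>2"]) auto
  show "filterlim pot (nhds 0) (inf at_infinity (principal upper_half))" by (rule pot_tendsto_0)
  fix \<zeta> :: "complex \<Rightarrow> real" assume "test_fun \<zeta>"
  have "(LINT z:upper_half|lborel. grad pot z \<bullet> grad \<zeta> z) = (LINT z:upper_half|lborel. field z \<bullet> grad \<zeta> z)"
    using g by (intro set_lebesgue_integral_cong) auto
  also have "\<dots> = (\<integral>t. f t * \<zeta> (of_real t) \<partial>lborel)" by (rule pairing_test_fun) fact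
  also have "\<dots> = (LINT x:{-1..1}|lborel. Re (m' x) * \<zeta> (of_real x))"
    unfolding set_lebesgue_integral_def
    using assms supp by (intro Bochner_Integration.integral_cong) (auto split: split_indicator)
  finally show "(LINT z:upper_half|lborel. grad pot z \<bullet> grad \<zeta> z) = (LINT x:{-1..1}|lborel. Re (m' x) * \<zeta> (of_real x))" .
qed

end

section \<open>The profile functions\<close>

lemma upper_half_minus_inverse: "z \<in> upper_half \<Longrightarrow> - 1 / z \<in> upper_half"
  by (auto simp: upper_half_def Im_divide intro!: divide_pos_pos)
    (metis less_irrefl sum_power2_gt_zero_iff)

text \<open>Im (cos \<theta>) is sin (Re \<theta>) times sinh (- Im \<theta>), and the sine is
  positive for 0 < Re \<theta> < pi, so the sign of Im v decides the sign of Im (Arccos v).\<close>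

lemma Arccos_upper_half:
  assumes "v \<in> upper_half"
  shows "0 < Re (Arccos v)" "Re (Arccos v) < pi" "Im (Arccos v) < 0"
proof -
  have "0 \<le> Re (csqrt (1 - v\<^sup>2))"
    using csqrt_principal[of "1 - v\<^sup>2"] by (auto simp del: csqrt.simps)
  then have "0 < Im (v + \<i> * csqrt (1 - v\<^sup>2))"
    using assms by (simp add: upper_half_def del: csqrt.simps)
  from Im_Ln_pos_lt_imp[OF this] show r: "0 < Re (Arccos v)" "Re (Arccos v) < pi"
    by (simp_all add: Re_Arccos)
  have "Im v = sin (Re (Arccos v)) * ((exp (- Im (Arccos v)) - exp (Im (Arccos v))) / 2)"
    using Im_cos[of "Arccos v"] by simp
  then have "0 < sin (Re (Arccos v)) * ((exp (- Im (Arccos v)) - exp (Im (Arccos v))) / 2)"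
    using assms unfolding upper_half_def by simp
  moreover have "0 < sin (Re (Arccos v))" using r by (rule sin_gt_zero)
  ultimately have "0 < (exp (- Im (Arccos v)) - exp (Im (Arccos v))) / 2"
    by (simp add: zero_less_mult_iff)
  then show "Im (Arccos v) < 0" by simp
qed

lemma inj_on_Fmap: "inj_on Fmap strip"
proof (rule inj_onI)
  fix w1 w2 assume w: "w1 \<in> strip" "w2 \<in> strip" "Fmap w1 = Fmap w2"
  have A: "Arccos (cosh w) = - (\<i> * w)" if "w \<in> strip" for w
  proof -
    have "cosh w = cos (- (\<i> * w))" by (simp add: cosh_conv_cos)
    then show ?thesis using Arccos_cos[of "- (\<i> * w)"] that by (simp add: strip_def)
  qed
  have "cosh w1 = cosh w2" using w(3) by (simp add: Fmap_def)
  then have "Arccos (cosh w1) = Arccos (cosh w2)" by (rule arg_cong)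
  then have "- (\<i> * w1) = - (\<i> * w2)" unfolding A[OF w(1)] A[OF w(2)] .
  then show "w1 = w2" by simp
qed

text \<open>Since cosh (i \<theta>) = cos \<theta>, the preimage of z under \<open>Fmap\<close> is i
  times Arccos (-1/z). This replaces the abstract inverse by an explicit function.\<close>

lemma u0_eq: "z \<in> upper_half \<Longrightarrow> u0 z = pi / 2 - Re (Arccos (- 1 / z))"
proof -
  assume z: "z \<in> upper_half"
  let ?v = "- 1 / z"
  have z0: "z \<noteq> 0" using z by (auto simp: upper_half_def)
  note A = Arccos_upper_half[OF upper_half_minus_inverse[OF z]]
  have "cosh (\<i> * Arccos ?v) = cos (\<i> * (\<i> * Arccos ?v))" by (rule cosh_conv_cos)
  also have "\<i> * (\<i> * Arccos ?v) = - Arccos ?v" by (simp add: mult.assoc[symmetric])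
  also have "cos (- Arccos ?v) = ?v" by (simp only: cos_minus cos_Arccos)
  finally have "Fmap (\<i> * Arccos ?v) = z" using z0 by (simp add: Fmap_def)
  moreover have "\<i> * Arccos ?v \<in> strip" using A by (simp add: strip_def)
  ultimately have "the_inv_into strip Fmap z = \<i> * Arccos ?v"
    by (intro the_inv_into_f_eq inj_on_Fmap)
  then show ?thesis by (simp add: u0_def)
qed

text \<open>The two moduli are cosh (Im \<theta>) + cos (Re \<theta>) and cosh (Im \<theta>) - cos
  (Re \<theta>): cosine maps lines of constant real part to branches of hyperbolas with foci 1 and
  -1. In the proof \<open>ch\<close> is cosh (Im \<theta>) and \<open>sh\<close> is sinh (- Im
  \<theta>).\<close>

lemma cos_Re_eq: "2 * cos (Re \<theta>) = cmod (cos \<theta> + 1) - cmod (cos \<theta> - 1)"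
proof -
  define c where "c = cos (Re \<theta>)"
  define ch where "ch = (exp (Im \<theta>) + exp (- Im \<theta>)) / 2"
  define sh where "sh = (exp (- Im \<theta>) - exp (Im \<theta>)) / 2"
  define s where "s = sin (Re \<theta>)"
  have cs: "s\<^sup>2 = 1 - c\<^sup>2" by (simp add: s_def c_def sin_squared_eq)
  have "exp (Im \<theta>) * exp (- Im \<theta>) = 1" by (simp flip: exp_add)
  then have hyp: "sh\<^sup>2 = ch\<^sup>2 - 1" by (simp add: sh_def ch_def power2_eq_square field_simps)
  have ch1: "1 \<le> ch"
  proof -
    have "0 \<le> sh\<^sup>2" by simp
    then have "1\<^sup>2 \<le> ch\<^sup>2" using hyp by simp
    moreover have "0 \<le> ch" by (simp add: ch_def)
    ultimately show ?thesis by (rule power2_le_imp_le)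
  qed
  have R: "Re (cos \<theta>) = c * ch" and I: "Im (cos \<theta>) = s * sh"
    by (simp_all add: Re_cos Im_cos c_def ch_def s_def sh_def)
  have c1: "\<bar>c\<bar> \<le> 1" by (simp add: c_def)
  have "(cmod (cos \<theta> + 1))\<^sup>2 = (c * ch + 1)\<^sup>2 + s\<^sup>2 * sh\<^sup>2"
    unfolding cmod_power2 by (simp add: R I power_mult_distrib)
  also have "\<dots> = (ch + c)\<^sup>2" unfolding cs hyp by (simp add: power2_eq_square algebra_simps)
  finally have p: "cmod (cos \<theta> + 1) = ch + c"
    by (rule power2_eq_imp_eq) (use ch1 c1 in auto)
  have "(cmod (cos \<theta> - 1))\<^sup>2 = (c * ch - 1)\<^sup>2 + s\<^sup>2 * sh\<^sup>2"
    unfolding cmod_power2 by (simp add: R I power_mult_distrib)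
  also have "\<dots> = (ch - c)\<^sup>2" unfolding cs hyp by (simp add: power2_eq_square algebra_simps)
  finally have m: "cmod (cos \<theta> - 1) = ch - c"
    by (rule power2_eq_imp_eq) (use ch1 c1 in auto)
  show ?thesis using p m by (simp add: c_def)
qed

text \<open>Since \<open>F w = - 1 / cosh w\<close>, the point \<open>Vb b z\<close> is \<open>cosh w\<close> for \<open>F w = \<Phi>\<^sub>-\<^sub>b z\<close>, and \<open>rb b z\<close> is the
  resulting value of \<open>sin (u\<^sub>b z)\<close>.\<close>

definition Vb :: "real \<Rightarrow> complex \<Rightarrow> complex" where
  "Vb b z = (of_real b * z - 1) / (z - of_real b)"

text \<open>The gradient of \<open>ub b\<close>. A conjugate appears because the real part of F' h
  is the inner product of h with the conjugate of F'.\<close>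

definition gub :: "real \<Rightarrow> complex \<Rightarrow> complex" where
  "gub b z = cnj (inverse (sin (Arccos (Vb b z))) * (of_real (1 - b\<^sup>2) / (z - of_real b)\<^sup>2))"

definition rb :: "real \<Rightarrow> complex \<Rightarrow> real" where
  "rb b z = ((1 + b) * cmod (z - 1) - (1 - b) * cmod (z + 1)) / (2 * cmod (z - of_real b))"

lemma Vb_upper_half:
  assumes "\<bar>b\<bar> < 1" "z \<in> upper_half" shows "Vb b z \<in> upper_half"
proof -
  have z: "z - of_real b \<noteq> 0" using assms(2) by (rule upper_half_minus_real)
  define c where "c = 1 - b\<^sup>2"
  \<comment> \<open>\<open>Vb b\<close> is a translate of a positive multiple of -1 / (z - b), hence
    preserves the half plane.\<close>
  have "Vb b z = of_real b + of_real c * (- 1 / (z - of_real b))"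
    using z by (simp add: Vb_def c_def field_simps power2_eq_square)
  moreover have "- 1 / (z - of_real b) \<in> upper_half"
    by (rule upper_half_minus_inverse) (use assms in \<open>simp add: upper_half_def\<close>)
  moreover have "0 < c" using assms(1) by (simp add: c_def abs_square_less_1)
  moreover have "Im (of_real b + of_real c * v) = c * Im v" for v by simp
  ultimately show ?thesis unfolding upper_half_def mem_Collect_eq by (metis mult_pos_pos)
qed

lemma Phi_upper_half:
  assumes "\<bar>b\<bar> < 1" "z \<in> upper_half"
  shows "Phi (- b) z \<in> upper_half" "- 1 / Phi (- b) z = Vb b z"
proof -
  show e: "- 1 / Phi (- b) z = Vb b z"
    by (simp add: Phi_def Vb_def minus_divide_left)
  then have "Phi (- b) z = - 1 / Vb b z"
    by (simp flip: e)
  then show "Phi (- b) z \<in> upper_half"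
    using upper_half_minus_inverse[OF Vb_upper_half[OF assms]] by simp
qed

lemma ub_eq:
  assumes "\<bar>b\<bar> < 1" "z \<in> upper_half"
  shows "ub b z = pi / 2 - Re (Arccos (Vb b z))"
  using u0_eq[OF Phi_upper_half(1)[OF assms]] Phi_upper_half(2)[OF assms] by (simp add: ub_def)

text \<open>For real z in (-1,1) other than b the value \<open>Vb b z\<close> is real of modulus
  above 1 and lies on a branch cut of \<open>Arccos\<close>. The form with arcsin of
  \<open>rb\<close>, which is continuous up to the real line away from b, makes the boundary values
  accessible.\<close>

lemma ub_eq_arcsin:
  assumes b: "\<bar>b\<bar> < 1" and z: "z \<in> upper_half"
  shows "ub b z = arcsin (rb b z)" "\<bar>rb b z\<bar> \<le> 1" "\<bar>ub b z\<bar> \<le> pi / 2"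
proof -
  let ?\<theta> = "Arccos (Vb b z)"
  note A = Arccos_upper_half[OF Vb_upper_half[OF b z]]
  have zb: "z - of_real b \<noteq> 0" using z by (rule upper_half_minus_real)
  have b1: "0 < 1 + b" "0 < 1 - b" using b by auto
  have "Vb b z + 1 = of_real (1 + b) * (z - 1) / (z - of_real b)"
    "Vb b z - 1 = - (of_real (1 - b) * (z + 1) / (z - of_real b))"
    using zb by (simp_all add: Vb_def field_simps)
  then have "cmod (Vb b z + 1) = (1 + b) * cmod (z - 1) / cmod (z - of_real b)"
    "cmod (Vb b z - 1) = (1 - b) * cmod (z + 1) / cmod (z - of_real b)"
    using b1 by (simp_all only: norm_minus_cancel norm_mult norm_divide norm_of_real abs_of_pos)
  with cos_Re_eq[of ?\<theta>] have c: "cos (Re ?\<theta>) = rb b z"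
    by (simp add: rb_def diff_divide_distrib)
  then show "\<bar>rb b z\<bar> \<le> 1" by (metis abs_cos_le_one)
  have "arcsin (sin (pi / 2 - Re ?\<theta>)) = pi / 2 - Re ?\<theta>"
    by (rule arcsin_sin) (use A in auto)
  moreover have "sin (pi / 2 - Re ?\<theta>) = rb b z" using c by (simp add: cos_sin_eq)
  ultimately show "ub b z = arcsin (rb b z)"
    by (simp add: ub_eq[OF b z])
  show "\<bar>ub b z\<bar> \<le> pi / 2" unfolding ub_eq[OF b z] using A by (intro abs_leI) linarith+
qed

lemma ub_has_derivative:
  assumes b: "\<bar>b\<bar> < 1" and z: "z \<in> upper_half"
  shows "(ub b has_derivative (\<lambda>h. gub b z \<bullet> h)) (at z)"
proof -
  have zb: "z - of_real b \<noteq> 0" using z by (rule upper_half_minus_real)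
  note V = Vb_upper_half[OF b z]
  have dV: "(Vb b has_field_derivative (of_real (1 - b\<^sup>2) / (z - of_real b)\<^sup>2)) (at z)"
    unfolding Vb_def[abs_def] using zb
    by (auto intro!: derivative_eq_intros simp: power2_eq_square field_simps)
  have "(Arccos has_field_derivative - inverse (sin (Arccos (Vb b z)))) (at (Vb b z))"
    by (rule has_field_derivative_Arccos) (use V in \<open>simp add: upper_half_def\<close>)
  from DERIV_chain2[OF this dV]
  have "((\<lambda>z. Arccos (Vb b z)) has_field_derivative - inverse (sin (Arccos (Vb b z))) * (of_real (1 - b\<^sup>2) / (z - of_real b)\<^sup>2)) (at z)" .
  then have "((\<lambda>z. Arccos (Vb b z)) has_derivative (\<lambda>h. - cnj (gub b z) * h)) (at z)"
    unfolding has_field_derivative_def by (rule has_derivative_eq_rhs) (simp add: gub_def fun_eq_iff)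
  then have "((\<lambda>z. pi / 2 - Re (Arccos (Vb b z))) has_derivative (\<lambda>h. 0 - Re (- cnj (gub b z) * h))) (at z)"
    by (intro has_derivative_diff has_derivative_const bounded_linear.has_derivative[OF bounded_linear_Re])
  moreover have "(\<lambda>h. 0 - Re (- cnj (gub b z) * h)) = (\<lambda>h. gub b z \<bullet> h)"
    by (auto simp: inner_complex_def)
  ultimately have "((\<lambda>z. pi / 2 - Re (Arccos (Vb b z))) has_derivative (\<lambda>h. gub b z \<bullet> h)) (at z)" by simp
  then show ?thesis
    by (rule has_derivative_transform_within_open[OF _ open_upper_half z]) (simp add: ub_eq[OF b])
qed

text \<open>From 1 - (Vb b z)^2 = - (1 - b^2) (1 - z^2) / (z - b)^2. The formula exhibits the
  singularities: 1/|z - b| at the wall, the source of the logarithm, and the inverse square root of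
  the distance at the ends 1 and -1, which is square integrable.\<close>

lemma cmod_gub:
  assumes b: "\<bar>b\<bar> < 1" and z: "z \<in> upper_half"
  shows "cmod (gub b z) = sqrt (1 - b\<^sup>2) / (cmod (z - of_real b) * sqrt (cmod (1 - z\<^sup>2)))"
proof -
  have zb: "z - of_real b \<noteq> 0" using z by (rule upper_half_minus_real)
  have b2: "0 < 1 - b\<^sup>2" using b by (simp add: abs_square_less_1)
  let ?s = "sin (Arccos (Vb b z))"
  have "?s\<^sup>2 = 1 - (Vb b z)\<^sup>2" by (simp add: sin_squared_eq)
  also have "\<dots> = - (of_real (1 - b\<^sup>2) * (1 - z\<^sup>2) / (z - of_real b)\<^sup>2)"
  proof -
    have "1 - (Vb b z)\<^sup>2 = ((z - of_real b)\<^sup>2 - (of_real b * z - 1)\<^sup>2) / (z - of_real b)\<^sup>2"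
    proof -
      have "1 - X / D = (D - X) / D" if "D \<noteq> 0" for X D :: complex
        using that by (simp add: diff_divide_distrib)
      then show ?thesis unfolding Vb_def power_divide using zb by simp
    qed
    also have "(z - of_real b)\<^sup>2 - (of_real b * z - 1)\<^sup>2 = - (of_real (1 - b\<^sup>2) * (1 - z\<^sup>2))"
      by (simp add: power2_eq_square algebra_simps)
    finally show ?thesis by simp
  qed
  finally have "cmod (?s\<^sup>2) = (1 - b\<^sup>2) * cmod (1 - z\<^sup>2) / (cmod (z - of_real b))\<^sup>2"
    using b2 by (simp only: norm_minus_cancel norm_mult norm_divide norm_of_real abs_of_pos norm_power)
  then have "sqrt ((cmod ?s)\<^sup>2) = sqrt ((1 - b\<^sup>2) * cmod (1 - z\<^sup>2) / (cmod (z - of_real b))\<^sup>2)"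
    by (simp add: norm_power)
  then have s: "cmod ?s = sqrt (1 - b\<^sup>2) * sqrt (cmod (1 - z\<^sup>2)) / cmod (z - of_real b)"
    by (simp add: real_sqrt_mult real_sqrt_divide)
  have "cmod (gub b z) = (1 - b\<^sup>2) / (cmod ?s * (cmod (z - of_real b))\<^sup>2)"
    using b2 by (simp only: gub_def complex_mod_cnj norm_mult norm_inverse norm_divide norm_of_real abs_of_pos norm_power)
      (simp add: divide_inverse)
  also have "\<dots> = (1 - b\<^sup>2) / (sqrt (1 - b\<^sup>2) * sqrt (cmod (1 - z\<^sup>2)) * cmod (z - of_real b))"
    using zb by (simp add: s power2_eq_square)
  also have "\<dots> = sqrt (1 - b\<^sup>2) / (cmod (z - of_real b) * sqrt (cmod (1 - z\<^sup>2)))"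
  proof -
    have "x / (s * q * c) = s / (c * q)" if "x = s * s" "0 < s" for x s q c :: real
      using that by simp
    from this[of "1 - b\<^sup>2" "sqrt (1 - b\<^sup>2)"] b2 show ?thesis by simp
  qed
  finally show ?thesis .
qed

lemma continuous_on_gub:
  assumes b: "\<bar>b\<bar> < 1" shows "continuous_on upper_half (gub b)"
proof (rule continuous_at_imp_continuous_on, rule ballI)
  fix z assume z: "z \<in> upper_half"
  have zb: "z - of_real b \<noteq> 0" using z by (rule upper_half_minus_real)
  note V = Vb_upper_half[OF b z]
  have "isCont (Vb b) z" unfolding Vb_def[abs_def] using zb by (intro continuous_intros) auto
  then have A: "isCont (\<lambda>z. Arccos (Vb b z)) z"
    by (rule isCont_Arccos') (use V in \<open>simp add: upper_half_def\<close>)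
  have "(Vb b z)\<^sup>2 \<noteq> 1" using V by (auto simp: upper_half_def power2_eq_1_iff)
  then have "sin (Arccos (Vb b z)) \<noteq> 0" by (rule sin_Arccos_nonzero)
  then show "isCont (gub b) z"
    unfolding gub_def[abs_def] using zb A by (intro continuous_intros isCont_sin') auto
qed

text \<open>On the interval \<open>rb b\<close> takes only the values 1 to the left of b and -1 to
  the right of it, and arcsin is continuous on [-1,1] including these end points.\<close>

lemma ub_tendsto_real:
  assumes b: "\<bar>b\<bar> < 1" and t: "t \<in> {-1..1}" "t \<noteq> b"
  shows "(ub b \<longlongrightarrow> (if t < b then pi / 2 else - pi / 2)) (at (of_real t) within upper_half)"
proof -
  have n: "cmod (of_real t - 1) = 1 - t" "cmod (of_real t + 1) = 1 + t" "cmod (of_real t - of_real b) = \<bar>t - b\<bar>"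
    using t norm_of_real[of "t - 1", where 'a = complex] norm_of_real[of "t + 1", where 'a = complex]
      norm_of_real[of "t - b", where 'a = complex] by auto
  have r: "rb b (of_real t) = (if t < b then 1 else - 1)"
    using t unfolding rb_def n by (auto simp: field_simps)
  have "(rb b \<longlongrightarrow> rb b (of_real t)) (at (of_real t) within upper_half)"
    unfolding rb_def[abs_def] using t by (intro tendsto_intros) auto
  then have lim: "((\<lambda>z. arcsin (rb b z)) \<longlongrightarrow> arcsin (rb b (of_real t))) (at (of_real t) within upper_half)"
    by (rule continuous_on_tendsto_compose[OF continuous_on_arcsin'])
      (use ub_eq_arcsin(2)[OF b] r in \<open>auto simp: eventually_at_filter abs_le_iff\<close>)
  have eq: "arcsin (rb b (of_real t)) = (if t < b then pi / 2 else - pi / 2)"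
    unfolding r by simp
  show ?thesis
    by (rule Lim_transform_eventually[OF lim[unfolded eq]])
      (simp add: eventually_at_filter ub_eq_arcsin(1)[OF b])
qed

text \<open>Both quotients of distances in \<open>rb\<close> tend to 1, which leaves ((1 + b) - (1 -
  b)) / 2 = b. The nonzero limit arcsin b is what the truncated profile subtracts.\<close>

lemma ub_tendsto_infinity:
  assumes b: "\<bar>b\<bar> < 1"
  shows "(ub b \<longlongrightarrow> arcsin b) (inf at_infinity (principal upper_half))"
proof -
  let ?F = "inf at_infinity (principal upper_half)"
  have q: "((\<lambda>z. cmod (z - c) / cmod (z - of_real b)) \<longlongrightarrow> 1) ?F" for c :: complex
  proof -
    have "((\<lambda>z. cmod (1 + (of_real b - c) / (z - of_real b))) \<longlongrightarrow> cmod (1 + 0)) ?F"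
    proof (intro tendsto_intros)
      have "filterlim (\<lambda>z. - of_real b + z :: complex) at_infinity at_infinity"
        by (rule tendsto_add_filterlim_at_infinity[OF tendsto_const filterlim_ident])
      then have "((\<lambda>z. (of_real b - c) / (- of_real b + z)) \<longlongrightarrow> 0) at_infinity"
        by (rule tendsto_divide_0[OF tendsto_const])
      then show "((\<lambda>z. (of_real b - c) / (z - of_real b)) \<longlongrightarrow> 0) ?F"
        by (intro tendsto_mono[OF inf_le1]) (simp add: add.commute)
    qed
    moreover have "eventually (\<lambda>z. cmod (1 + (of_real b - c) / (z - of_real b)) = cmod (z - c) / cmod (z - of_real b)) ?F"
      unfolding eventually_inf_principal
    proof (intro always_eventually allI impI)
      fix z assume "z \<in> upper_half"
      then have "z - of_real b \<noteq> 0" by (rule upper_half_minus_real)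
      then have "1 + (of_real b - c) / (z - of_real b) = (z - c) / (z - of_real b)" by (simp add: field_simps)
      then show "cmod (1 + (of_real b - c) / (z - of_real b)) = cmod (z - c) / cmod (z - of_real b)"
        by (simp add: norm_divide)
    qed
    ultimately show ?thesis by (simp add: tendsto_cong)
  qed
  have "((\<lambda>z. (1 + b) / 2 * (cmod (z - 1) / cmod (z - of_real b)) - (1 - b) / 2 * (cmod (z - (- 1)) / cmod (z - of_real b)))
      \<longlongrightarrow> (1 + b) / 2 * 1 - (1 - b) / 2 * 1) ?F"
    by (intro tendsto_intros q)
  moreover have "(\<lambda>z. (1 + b) / 2 * (cmod (z - 1) / cmod (z - of_real b)) - (1 - b) / 2 * (cmod (z - (- 1)) / cmod (z - of_real b))) = rb b"
  proof -
    have "p / 2 * (A / D) - q / 2 * (B / D) = (p * A - q * B) / (2 * D)" for p q A B D :: real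
      by (simp add: diff_divide_distrib)
    then show ?thesis by (intro ext) (simp only: rb_def diff_minus_eq_add)
  qed
  moreover have "(1 + b) / 2 * 1 - (1 - b) / 2 * 1 = b" by (simp add: field_simps)
  ultimately have "(rb b \<longlongrightarrow> b) ?F" by simp
  then have "((\<lambda>z. arcsin (rb b z)) \<longlongrightarrow> arcsin b) ?F"
    by (rule continuous_on_tendsto_compose[OF continuous_on_arcsin'])
      (use ub_eq_arcsin(2)[OF b] b in \<open>auto simp: eventually_inf_principal abs_le_iff\<close>)
  then show ?thesis
    by (rule Lim_transform_eventually)
      (auto simp: eventually_inf_principal ub_eq_arcsin(1)[OF b])
qed

section \<open>Energy of the truncated profile\<close>

text \<open>The term 2/R comes from the gradient of \<open>ub\<close>. The other one comes from the
  cut-off: pi/2 bounds |ub|, 1/step_mass bounds \<open>step'\<close>, and 4 arises from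
  differentiating the scaled squared distance.\<close>

definition profile_const :: "real \<Rightarrow> real" where
  "profile_const R = 2 / R + 2 * pi / step_mass"

section \<open>Pointwise bounds for the gradient of a single profile\<close>

lemma cmod_one_minus_square: "cmod (1 - z\<^sup>2) = cmod (z - 1) * cmod (z + 1)"
proof -
  have "1 - z\<^sup>2 = - ((z - 1) * (z + 1))" by (simp add: power2_eq_square algebra_simps)
  then show ?thesis by (simp only: norm_minus_cancel norm_mult)
qed

lemma gub_square:
  assumes "\<bar>b\<bar> < 1" "z \<in> upper_half"
  shows "(cmod (gub b z))\<^sup>2 = (1 - b\<^sup>2) / ((cmod (z - of_real b))\<^sup>2 * cmod (1 - z\<^sup>2))"
proof -
  have "0 \<le> 1 - b\<^sup>2" using assms(1) by (simp add: abs_square_le_1)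
  then show ?thesis by (simp add: cmod_gub[OF assms] power_divide power_mult_distrib)
qed

lemma ends_far:
  assumes "R \<le> 1 - \<bar>b\<bar>" "cmod (z - of_real b) \<le> R / 2"
  shows "R / 2 \<le> cmod (z - 1)" "R / 2 \<le> cmod (z + 1)"
proof -
  have "cmod (of_real b - 1) = 1 - b" "cmod (of_real b + 1) = 1 + b" if "\<bar>b\<bar> \<le> 1"
    using norm_of_real[of "b - 1", where 'a = complex] norm_of_real[of "b + 1", where 'a = complex] that by auto
  moreover have "\<bar>b\<bar> \<le> 1" using assms norm_ge_zero[of "z - of_real b"] by linarith
  ultimately have e: "cmod (of_real b - 1) = 1 - b" "cmod (of_real b + 1) = 1 + b" by auto
  have "cmod (of_real b - 1) \<le> cmod (z - 1) + cmod (z - of_real b)"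
    using norm_triangle_ineq4[of "z - 1" "z - of_real b"] by (simp add: algebra_simps)
  then show "R / 2 \<le> cmod (z - 1)" unfolding e using assms by linarith
  have "cmod (of_real b + 1) \<le> cmod (z + 1) + cmod (z - of_real b)"
    using norm_triangle_ineq4[of "z + 1" "z - of_real b"] by (simp add: algebra_simps)
  then show "R / 2 \<le> cmod (z + 1)" unfolding e using assms by linarith
qed

lemma gub_le:
  assumes b: "\<bar>b\<bar> < 1" and z: "z \<in> upper_half" and R: "0 < R"
    and e: "R / 2 \<le> cmod (z - 1)" "R / 2 \<le> cmod (z + 1)"
  shows "cmod (gub b z) \<le> 2 / R / cmod (z - of_real b)"
proof -
  have "(R / 2)\<^sup>2 \<le> cmod (1 - z\<^sup>2)"
    unfolding cmod_one_minus_square power2_eq_square[of "R / 2"] by (rule mult_mono) (use e R in auto)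
  then have s: "R / 2 \<le> sqrt (cmod (1 - z\<^sup>2))" using R by (intro real_le_rsqrt)
  have zb: "0 < cmod (z - of_real b)" using upper_half_minus_real[OF z] by simp
  have "sqrt (1 - b\<^sup>2) \<le> 1" by simp
  then have "cmod (gub b z) \<le> 1 / (cmod (z - of_real b) * (R / 2))"
    unfolding cmod_gub[OF b z] using s zb R b
    by (intro frac_le mult_left_mono mult_pos_pos) auto
  then show ?thesis by (simp add: mult.commute)
qed

text \<open>The coefficient 1 of the leading term has to be exact for the sharp constant in front of
  the logarithm. It comes from 1 - b^2 <= |1 - z^2| + 3 |z - b|, and the remainder is only of order
  1/|z - b| because |1 - z^2| >= R^2/4 near b.\<close>

lemma gub_square_near:
  assumes b: "R \<le> 1 - \<bar>b\<bar>" and z: "z \<in> upper_half" and R: "0 < R" "R \<le> 1 / 2"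
    and n: "cmod (z - of_real b) \<le> R / 2"
  shows "(cmod (gub b z))\<^sup>2 \<le> 1 / (cmod (z - of_real b))\<^sup>2 + 12 / R\<^sup>2 * (1 / cmod (z - of_real b))"
proof -
  have b1: "\<bar>b\<bar> < 1" using b R by linarith
  let ?x = "cmod (z - of_real b)" and ?w = "cmod (1 - z\<^sup>2)"
  have x: "0 < ?x" using upper_half_minus_real[OF z] by simp
  note e = ends_far[OF b n]
  have "(R / 2)\<^sup>2 \<le> ?w"
    unfolding cmod_one_minus_square power2_eq_square[of "R / 2"] by (rule mult_mono) (use e R in auto)
  moreover have "0 < (R / 2)\<^sup>2" using R by simp
  ultimately have w: "R\<^sup>2 / 4 \<le> ?w" "0 < ?w" by (auto simp: power_divide)
  have "cmod (z + of_real b) = cmod ((z - of_real b) + 2 * of_real b)"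
    by (rule arg_cong[of _ _ cmod]) simp
  also have "\<dots> \<le> ?x + cmod (2 * of_real b)" by (rule norm_triangle_ineq)
  also have "\<dots> \<le> 3" using n R b1 by (simp add: norm_mult)
  finally have zb: "cmod (z + of_real b) \<le> 3" .
  have "1 - b\<^sup>2 = cmod (of_real (1 - b\<^sup>2))"
    using b1 by (simp only: norm_of_real) (simp add: abs_square_le_1)
  also have "of_real (1 - b\<^sup>2) = (1 - z\<^sup>2) + (z - of_real b) * (z + of_real b)"
    by (simp add: power2_eq_square algebra_simps)
  also have "cmod \<dots> \<le> ?w + ?x * cmod (z + of_real b)"
    by (rule order_trans[OF norm_triangle_ineq]) (simp add: norm_mult)
  also have "\<dots> \<le> ?w + ?x * 3" using zb x by simp
  finally have "1 - b\<^sup>2 \<le> ?w + 3 * ?x" by simp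
  then have "(cmod (gub b z))\<^sup>2 \<le> (?w + 3 * ?x) / (?x\<^sup>2 * ?w)"
    unfolding gub_square[OF b1 z] using x w by (intro divide_right_mono) auto
  also have "\<dots> = 1 / ?x\<^sup>2 + 3 / ?w * (1 / ?x)" using x w by (simp add: field_simps power2_eq_square)
  also have "3 / ?w \<le> 3 / (R\<^sup>2 / 4)" using w R by (intro divide_left_mono) auto
  then have "1 / ?x\<^sup>2 + 3 / ?w * (1 / ?x) \<le> 1 / ?x\<^sup>2 + 3 / (R\<^sup>2 / 4) * (1 / ?x)"
    using x by (intro add_left_mono mult_right_mono) auto
  finally show ?thesis by simp
qed

text \<open>A majorant of \<open>\<bar>grad u\<^sub>b\<bar>\<^sup>2\<close> away from \<open>b\<close> whose integral does not depend on \<open>b\<close>.\<close>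

definition end_majorant :: "real \<Rightarrow> complex \<Rightarrow> real \<Rightarrow> ennreal" where
  "end_majorant R z t = ennreal (1 / (cmod (z - of_real t))^3) * indicator {R / 2..} (cmod (z - of_real t))
     + ennreal (4 / R\<^sup>2) * (ennreal (1 / cmod (z - of_real t)) * indicator {..R / 2} (cmod (z - of_real t)))"

lemma mult_square_le_cubes:
  fixes x y :: real assumes "0 \<le> x" "0 \<le> y" shows "x\<^sup>2 * y \<le> x^3 + y^3"
proof (cases "x \<le> y")
  case True
  then have "x\<^sup>2 * y \<le> y\<^sup>2 * y" using assms by (intro mult_right_mono power_mono) auto
  also have "\<dots> = y^3" by (simp add: power2_eq_square power3_eq_cube)
  finally show ?thesis using assms by (simp add: add_increasing)
next
  case False
  then have "x\<^sup>2 * y \<le> x\<^sup>2 * x" using assms by (intro mult_left_mono) auto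
  also have "\<dots> = x^3" by (simp add: power2_eq_square power3_eq_cube)
  finally show ?thesis using assms by (simp add: add_increasing2)
qed

text \<open>Away from t the inequality x^2 y <= x^3 + y^3, applied to the reciprocal distances,
  separates the two singularities; close to t the factor 1/|z - b|^2 is at most 4/R^2.\<close>

lemma end_majorant_bound:
  assumes R: "0 < R" and x: "R / 2 \<le> cmod (z - of_real b)" and z: "z \<in> upper_half"
  shows "ennreal (1 / ((cmod (z - of_real b))\<^sup>2 * cmod (z - of_real t)))
    \<le> ennreal (1 / (cmod (z - of_real b))^3) * indicator {R / 2..} (cmod (z - of_real b)) + end_majorant R z t"
proof -
  let ?x = "cmod (z - of_real b)" and ?p = "cmod (z - of_real t)"
  have pos: "0 < ?x" "0 < ?p" using upper_half_minus_real[OF z] by simp_all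
  show ?thesis
  proof (cases "R / 2 \<le> ?p")
    case True
    have "1 / (?x\<^sup>2 * ?p) \<le> 1 / ?x^3 + 1 / ?p^3"
      using mult_square_le_cubes[of "1 / ?x" "1 / ?p"] pos by (simp add: power_divide)
    then have "ennreal (1 / (?x\<^sup>2 * ?p)) \<le> ennreal (1 / ?x^3) + ennreal (1 / ?p^3)"
      by (simp add: ennreal_leI flip: ennreal_plus)
    also have "\<dots> \<le> ennreal (1 / ?x^3) + end_majorant R z t"
      using True by (intro add_left_mono) (simp add: end_majorant_def add_increasing2)
    finally show ?thesis using x by simp
  next
    case False
    have "(R / 2)\<^sup>2 \<le> ?x\<^sup>2" using x R by (intro power_mono) auto
    then have "1 / (?x\<^sup>2 * ?p) \<le> 1 / ((R / 2)\<^sup>2 * ?p)"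
      using pos R by (intro divide_left_mono mult_right_mono) auto
    also have "\<dots> = 4 / R\<^sup>2 * (1 / ?p)" by (simp add: power_divide)
    finally have "ennreal (1 / (?x\<^sup>2 * ?p)) \<le> ennreal (4 / R\<^sup>2 * (1 / ?p))" by (rule ennreal_leI)
    also have "\<dots> = ennreal (4 / R\<^sup>2) * ennreal (1 / ?p)" by (rule ennreal_mult) (use pos in auto)
    also have "\<dots> \<le> end_majorant R z t" using False by (simp add: end_majorant_def)
    finally show ?thesis by (simp add: add_increasing)
  qed
qed

text \<open>The first term occurs twice on purpose: one copy goes with each of the ends 1 and
  -1.\<close>

definition far_majorant :: "real \<Rightarrow> real \<Rightarrow> complex \<Rightarrow> ennreal" where
  "far_majorant R b z = ennreal (1 / (cmod (z - of_real b))^3) * indicator {R / 2..} (cmod (z - of_real b))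
     + ennreal (1 / (cmod (z - of_real b))^3) * indicator {R / 2..} (cmod (z - of_real b))
     + end_majorant R z 1 + end_majorant R z (- 1)"

text \<open>The distances p and q to the ends satisfy p + q >= 2, so 1/(p q) <= 1/p + 1/q. This
  splits the factor 1/|1 - z^2| into one singularity at a time.\<close>

lemma gub_square_far:
  assumes b: "\<bar>b\<bar> < 1" and R: "0 < R" and x: "R / 2 \<le> cmod (z - of_real b)" and z: "z \<in> upper_half"
  shows "ennreal ((cmod (gub b z))\<^sup>2) \<le> far_majorant R b z"
proof -
  let ?x = "cmod (z - of_real b)" and ?p = "cmod (z - of_real 1)" and ?q = "cmod (z - of_real (- 1))"
  have pos: "0 < ?x" "0 < ?p" "0 < ?q" unfolding zero_less_norm_iff by (rule upper_half_minus_real[OF z])+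
  have "2 \<le> ?p + ?q"
    using norm_triangle_ineq4[of "z - of_real (- 1)" "z - of_real 1"] by simp
  then have "1 / (?p * ?q) \<le> ((?p + ?q) / 2) / (?p * ?q)" using pos by (intro divide_right_mono) auto
  also have "\<dots> \<le> 1 / ?p + 1 / ?q" using pos by (simp add: field_simps)
  finally have pq: "1 / (?p * ?q) \<le> 1 / ?p + 1 / ?q" .
  have "(cmod (gub b z))\<^sup>2 = (1 - b\<^sup>2) * (1 / ?x\<^sup>2 * (1 / (?p * ?q)))"
    unfolding gub_square[OF b z] cmod_one_minus_square by simp
  also have "\<dots> \<le> 1 * (1 / ?x\<^sup>2 * (1 / ?p + 1 / ?q))"
    using pq b by (intro mult_mono mult_left_mono) (auto simp: abs_square_le_1)
  also have "\<dots> = 1 / (?x\<^sup>2 * ?p) + 1 / (?x\<^sup>2 * ?q)"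
    by (simp only: distrib_left mult_1 times_divide_times_eq)
  finally have "ennreal ((cmod (gub b z))\<^sup>2) \<le> ennreal (1 / (?x\<^sup>2 * ?p)) + ennreal (1 / (?x\<^sup>2 * ?q))"
    by (simp add: ennreal_leI flip: ennreal_plus)
  also have "\<dots> \<le> (ennreal (1 / ?x^3) * indicator {R / 2..} ?x + end_majorant R z 1)
      + (ennreal (1 / ?x^3) * indicator {R / 2..} ?x + end_majorant R z (- 1))"
    by (intro add_mono end_majorant_bound R x z)
  finally show ?thesis by (simp add: far_majorant_def add_ac)
qed

text \<open>Two inverse cube integrals of 2 pi / R each and two end majorants of 4 pi / R
  each.\<close>

definition far_const :: "real \<Rightarrow> real" where
  "far_const R = 12 * pi / R"

lemma end_majorant_measurable [measurable]: "(\<lambda>z. end_majorant R z t) \<in> borel_measurable borel"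
  unfolding end_majorant_def by measurable

lemma far_majorant_measurable [measurable]: "far_majorant R b \<in> borel_measurable borel"
  unfolding far_majorant_def[abs_def] by measurable

lemma nn_integral_end_majorant:
  assumes "0 < R"
  shows "(\<integral>\<^sup>+z. end_majorant R z t * indicator upper_half z \<partial>lborel) = ennreal (4 * pi / R)"
proof -
  let ?A = "\<lambda>z. ennreal (1 / (cmod (z - of_real t))^3) * indicator {R / 2..} (cmod (z - of_real t)) * indicator upper_half z"
  let ?B = "\<lambda>z. ennreal (1 / cmod (z - of_real t)) * indicator {..R / 2} (cmod (z - of_real t)) * indicator upper_half z"
  have "(\<integral>\<^sup>+z. end_majorant R z t * indicator upper_half z \<partial>lborel) = (\<integral>\<^sup>+z. ?A z + ennreal (4 / R\<^sup>2) * ?B z \<partial>lborel)"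
    by (intro nn_integral_cong) (simp add: end_majorant_def distrib_right mult.assoc)
  also have "\<dots> = (\<integral>\<^sup>+z. ?A z \<partial>lborel) + ennreal (4 / R\<^sup>2) * (\<integral>\<^sup>+z. ?B z \<partial>lborel)"
    by (simp add: nn_integral_add nn_integral_cmult)
  also have "\<dots> = ennreal (pi / (R / 2)) + ennreal (4 / R\<^sup>2) * ennreal (pi * (R / 2))"
    using assms by (simp only: nn_integral_half_plane_inverse_cube nn_integral_half_plane_inverse half_gt_zero_iff)
  also have "\<dots> = ennreal (4 * pi / R)"
    using assms by (simp add: power2_eq_square field_simps flip: ennreal_mult ennreal_plus)
  finally show ?thesis .
qed

lemma nn_integral_far_majorant:
  assumes "0 < R"
  shows "(\<integral>\<^sup>+z. far_majorant R b z * indicator upper_half z \<partial>lborel) = ennreal (far_const R)"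
proof -
  let ?A = "\<lambda>z. ennreal (1 / (cmod (z - of_real b))^3) * indicator {R / 2..} (cmod (z - of_real b)) * indicator upper_half z"
  have A: "(\<integral>\<^sup>+z. ?A z \<partial>lborel) = ennreal (pi / (R / 2))"
    using assms by (intro nn_integral_half_plane_inverse_cube) simp
  have "(\<integral>\<^sup>+z. far_majorant R b z * indicator upper_half z \<partial>lborel)
     = (\<integral>\<^sup>+z. ((?A z + ?A z) + end_majorant R z 1 * indicator upper_half z) + end_majorant R z (- 1) * indicator upper_half z \<partial>lborel)"
    by (intro nn_integral_cong) (simp add: far_majorant_def distrib_right)
  also have "\<dots> = (((\<integral>\<^sup>+z. ?A z \<partial>lborel) + (\<integral>\<^sup>+z. ?A z \<partial>lborel)) + (\<integral>\<^sup>+z. end_majorant R z 1 * indicator upper_half z \<partial>lborel))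
      + (\<integral>\<^sup>+z. end_majorant R z (- 1) * indicator upper_half z \<partial>lborel)"
    by (simp add: nn_integral_add)
  also have "\<dots> = ennreal (far_const R)"
    unfolding A nn_integral_end_majorant[OF assms] using assms
    by (simp add: far_const_def field_simps flip: ennreal_plus)
  finally show ?thesis .
qed

section \<open>The truncated profile and its energy\<close>

text \<open>\<open>R\<close> is fixed while the cut-off radius \<open>r\<close> may be arbitrarily
  small. The conditions on \<open>a\<close> are those encoded in the lower bound for
  \<open>rho\<close>, and \<open>coeff\<close> reflects |d n - cos \<alpha>| <= 2. The constants
  \<open>others_const\<close>, \<open>K5\<close> and \<open>reg_const\<close> depend on
  \<open>N\<close> and \<open>R\<close> alone, which gives uniformity in \<open>a\<close>,
  \<open>c\<close> and \<open>r\<close>.\<close>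

locale wall_profile =
  fixes N :: nat and a c :: "nat \<Rightarrow> real" and R r :: real
  assumes R: "0 < R" "R \<le> 1 / 2" and r: "0 < r" "r \<le> R / 2"
    and ends: "\<And>n. n \<in> {1..N} \<Longrightarrow> R \<le> 1 - \<bar>a n\<bar>"
    and separated: "\<And>n k. n \<in> {1..N} \<Longrightarrow> k \<in> {1..N} \<Longrightarrow> n \<noteq> k \<Longrightarrow> 2 * R \<le> \<bar>a n - a k\<bar>"
    and coeff: "\<And>n. n \<in> {1..N} \<Longrightarrow> \<bar>c n\<bar> \<le> 2"
begin

text \<open>The factor 2 places the transition of \<open>step\<close> at distances between r / sqrt
  2 and r, so the profile is untouched from distance r on and vanishes within distance r/2.\<close>

definition cut_arg :: "nat \<Rightarrow> complex \<Rightarrow> real" where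
  "cut_arg n z = 2 * dist2 (of_real (a n)) z / r\<^sup>2"

definition D :: "nat \<Rightarrow> complex \<Rightarrow> complex" where
  "D n z = step (cut_arg n z) *\<^sub>R gub (a n) z
     + (ub (a n) z * (step' (cut_arg n z) * (4 / r\<^sup>2))) *\<^sub>R (z - of_real (a n))"

text \<open>Subtracting the limits arcsin (a n) makes the sum vanish at infinity.\<close>

definition \<zeta> :: "complex \<Rightarrow> real" where
  "\<zeta> z = (\<Sum>n=1..N. c n * (ub (a n) z * step (cut_arg n z) - arcsin (a n)))"

definition G :: "complex \<Rightarrow> complex" where
  "G z = (\<Sum>n=1..N. c n *\<^sub>R D n z)"

lemma abs_a: "n \<in> {1..N} \<Longrightarrow> \<bar>a n\<bar> < 1"
  using ends[of n] R by linarith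

lemma cut_arg_eq: "cut_arg n z = 2 * (cmod (z - of_real (a n)))\<^sup>2 / r\<^sup>2"
  by (simp add: cut_arg_def dist2_eq)

lemma D_has_derivative:
  assumes n: "n \<in> {1..N}" and z: "z \<in> upper_half"
  shows "((\<lambda>z. ub (a n) z * step (cut_arg n z)) has_derivative (\<lambda>h. D n z \<bullet> h)) (at z)"
proof -
  have "(cut_arg n has_derivative (\<lambda>h. 2 * (Re h * (2 * (Re z - a n)) + Im h * (2 * Im z)) / r\<^sup>2)) (at z)"
    unfolding cut_arg_def[abs_def] divide_inverse
    by (rule has_derivative_eq_rhs[OF has_derivative_mult_left[OF has_derivative_mult_right[OF has_derivative_dist2]]]) simp
  from has_derivative_compose[OF this step_deriv[THEN has_field_derivative_imp_has_derivative]]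
  have s: "((\<lambda>z. step (cut_arg n z)) has_derivative
      (\<lambda>h. step' (cut_arg n z) * (2 * (Re h * (2 * (Re z - a n)) + Im h * (2 * Im z)) / r\<^sup>2))) (at z)" .
  show ?thesis
    by (rule has_derivative_eq_rhs[OF has_derivative_mult[OF ub_has_derivative[OF abs_a[OF n] z] s]])
      (simp add: fun_eq_iff D_def inner_add_left inner_complex_def algebra_simps add_divide_distrib diff_divide_distrib)
qed

lemma G_has_derivative:
  assumes z: "z \<in> upper_half"
  shows "(\<zeta> has_derivative (\<lambda>h. G z \<bullet> h)) (at z)"
  unfolding \<zeta>_def[abs_def] G_def inner_sum_left inner_scaleR_left
proof (rule has_derivative_sum)
  fix n assume n: "n \<in> {1..N}"
  from has_derivative_mult_right[OF has_derivative_diff[OF D_has_derivative[OF n z] has_derivative_const]]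
  show "((\<lambda>z. c n * (ub (a n) z * step (cut_arg n z) - arcsin (a n))) has_derivative (\<lambda>h. c n * (D n z \<bullet> h))) (at z)"
    by simp
qed

lemma continuous_on_cut_arg: "continuous_on A (cut_arg n)"
  unfolding cut_arg_def[abs_def] using r by (intro continuous_intros) auto

lemma continuous_on_G: "continuous_on upper_half G"
proof -
  have u: "continuous_on upper_half (ub (a n))" if "n \<in> {1..N}" for n
    by (rule has_derivative_upper_half_continuous[OF ub_has_derivative[OF abs_a[OF that]]])
  show ?thesis
    unfolding G_def[abs_def] D_def
    by (intro continuous_intros continuous_on_gub abs_a u
        continuous_on_compose2[OF continuous_step continuous_on_cut_arg subset_UNIV]
        continuous_on_compose2[OF continuous_step' continuous_on_cut_arg subset_UNIV]) auto
qed

lemma D_outside: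
  assumes "r \<le> cmod (z - of_real (a n))"
  shows "D n z = gub (a n) z"
proof -
  have "r\<^sup>2 \<le> (cmod (z - of_real (a n)))\<^sup>2" using assms r by (intro power_mono) auto
  then have "2 \<le> cut_arg n z" using r by (simp add: cut_arg_eq pos_le_divide_eq)
  then show ?thesis by (simp add: D_def step_eq_1 step'_eq_0)
qed

lemma D_inside:
  assumes "cmod (z - of_real (a n)) \<le> r / 2"
  shows "D n z = 0"
proof -
  have "(cmod (z - of_real (a n)))\<^sup>2 \<le> (r / 2)\<^sup>2" using assms by (intro power_mono) auto
  then have "4 * (cmod (z - of_real (a n)))\<^sup>2 \<le> r\<^sup>2" by (simp add: power_divide)
  then have "2 * (cmod (z - of_real (a n)))\<^sup>2 \<le> r\<^sup>2"
    using zero_le_power2[of "cmod (z - of_real (a n))"] by linarith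
  then have "cut_arg n z \<le> 1" using r by (simp add: cut_arg_eq)
  then show ?thesis by (simp add: D_def step_eq_0 step'_eq_0)
qed

abbreviation "K3 \<equiv> profile_const R"

lemma K3_pos: "0 < K3"
  unfolding profile_const_def using R step_mass_pos by (intro add_pos_pos) auto

text \<open>The cut-off varies only where |z - a n| < r, and its gradient, of order |z - a n| / r^2,
  is there at most of order 1/|z - a n|, the size of the gradient of \<open>ub\<close>
  itself.\<close>

lemma D_near:
  assumes n: "n \<in> {1..N}" and z: "z \<in> upper_half" and near: "cmod (z - of_real (a n)) \<le> R / 2"
  shows "cmod (D n z) \<le> K3 / cmod (z - of_real (a n))"
proof -
  let ?x = "cmod (z - of_real (a n))"
  have x: "0 < ?x" using upper_half_minus_real[OF z] by simp
  have g: "cmod (gub (a n) z) \<le> 2 / R / ?x"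
    by (rule gub_le[OF abs_a[OF n] z R(1) ends_far[OF ends[OF n] near]])
  have s: "\<bar>ub (a n) z * (step' (cut_arg n z) * (4 / r\<^sup>2))\<bar> * ?x \<le> 2 * pi / step_mass / ?x"
  proof (cases "r \<le> ?x")
    case True
    then have "r\<^sup>2 \<le> ?x\<^sup>2" using r by (intro power_mono) auto
    then have "2 \<le> cut_arg n z" using r by (simp add: cut_arg_eq pos_le_divide_eq)
    then show ?thesis using x step_mass_pos by (simp add: step'_eq_0)
  next
    case False
    have "\<bar>ub (a n) z\<bar> * (step' (cut_arg n z) * (4 / r\<^sup>2)) \<le> pi / 2 * (1 / step_mass * (4 / r\<^sup>2))"
      using ub_eq_arcsin(3)[OF abs_a[OF n] z] step'_nonneg step'_le
      by (intro mult_mono mult_right_mono) auto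
    then have "\<bar>ub (a n) z * (step' (cut_arg n z) * (4 / r\<^sup>2))\<bar> * ?x \<le> 2 * pi / step_mass * (1 / r\<^sup>2) * ?x"
      using step'_nonneg by (intro mult_right_mono) (auto simp: abs_mult)
    also have "\<dots> \<le> 2 * pi / step_mass * (1 / ?x\<^sup>2) * ?x"
      using False x r step_mass_pos
      by (intro mult_right_mono mult_left_mono divide_left_mono power_mono mult_pos_pos) auto
    also have "\<dots> = 2 * pi / step_mass / ?x" using x by (simp add: power2_eq_square)
    finally show ?thesis .
  qed
  have "cmod (D n z) \<le> cmod (step (cut_arg n z) *\<^sub>R gub (a n) z)
      + cmod ((ub (a n) z * (step' (cut_arg n z) * (4 / r\<^sup>2))) *\<^sub>R (z - of_real (a n)))"
    unfolding D_def by (rule norm_triangle_ineq)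
  also have "\<dots> \<le> 1 * cmod (gub (a n) z) + 2 * pi / step_mass / ?x"
    unfolding norm_scaleR using s step_bounds by (intro add_mono mult_right_mono) auto
  also have "\<dots> \<le> 2 / R / ?x + 2 * pi / step_mass / ?x" using g by simp
  also have "\<dots> = K3 / ?x" by (simp add: profile_const_def add_divide_distrib)
  finally show ?thesis .
qed

text \<open>The sharp bound is kept from distance r on, while the crude constant K3^2 is spent only
  on the annulus between r/2 and r, whose contribution is a fixed multiple of ln 2 however small r
  is.\<close>

lemma D_square_near:
  assumes n: "n \<in> {1..N}" and z: "z \<in> upper_half" and near: "cmod (z - of_real (a n)) \<le> R / 2"
  shows "(cmod (D n z))\<^sup>2 \<le> 1 / (cmod (z - of_real (a n)))\<^sup>2 * indicator {r..R/2} (cmod (z - of_real (a n)))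
     + 12 / R\<^sup>2 * (1 / cmod (z - of_real (a n)))
     + K3\<^sup>2 * (1 / (cmod (z - of_real (a n)))\<^sup>2 * indicator {r/2..r} (cmod (z - of_real (a n))))"
proof -
  let ?x = "cmod (z - of_real (a n))"
  have x: "0 < ?x" using upper_half_minus_real[OF z] by simp
  consider "r \<le> ?x" | "?x \<le> r / 2" | "r / 2 < ?x" "?x < r" by linarith
  then show ?thesis
  proof cases
    case 1
    then show ?thesis
      using gub_square_near[OF ends[OF n] z R near] near by (simp add: D_outside add_increasing2)
  next
    case 2
    then show ?thesis using x by (simp add: D_inside)
  next
    case 3
    have "(cmod (D n z))\<^sup>2 \<le> (K3 / ?x)\<^sup>2"
      by (rule power_mono[OF D_near[OF n z near]]) simp
    also have "\<dots> = K3\<^sup>2 * (1 / ?x\<^sup>2 * indicator {r/2..r} ?x)" using 3 by (simp add: power_divide)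
    finally show ?thesis by (simp add: add_increasing)
  qed
qed

text \<open>Each other summand has |c k| <= 2 and, at distance at least R/2 from its own pole, a
  gradient of size at most (2/R) / (R/2) = 4/R^2.\<close>

definition others_const :: real where
  "others_const = 8 * real N / R\<^sup>2"

text \<open>Collects the coefficients of 1/|z - a n| in the expansion of |G|^2 near
  \<open>a n\<close>: with S = \<open>others_const\<close>, the cross term gives 4 S K3, the square
  S^2 enters through 1 <= 1/|z - a n|, and 48/R^2 is 4 times the 12/R^2 of
  \<open>gub_square_near\<close>.\<close>

definition K5 :: real where
  "K5 = 4 * others_const * K3 + others_const\<^sup>2 + 48 / R\<^sup>2"

definition sing :: "complex \<Rightarrow> ennreal" where
  "sing z = (\<Sum>n=1..N. ennreal ((c n)\<^sup>2) * (ennreal (1 / (cmod (z - of_real (a n)))\<^sup>2)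
      * indicator {r..R/2} (cmod (z - of_real (a n)))))"

definition reg_term :: "nat \<Rightarrow> complex \<Rightarrow> ennreal" where
  "reg_term n z = ennreal K5 * (ennreal (1 / cmod (z - of_real (a n))) * indicator {..R/2} (cmod (z - of_real (a n))))
      + ennreal (4 * K3\<^sup>2) * (ennreal (1 / (cmod (z - of_real (a n)))\<^sup>2) * indicator {r/2..r} (cmod (z - of_real (a n))))
      + ennreal (4 * real N) * far_majorant R (a n) z"

definition reg_const :: real where
  "reg_const = real N * (K5 * (pi * (R / 2)) + 4 * K3\<^sup>2 * (pi * ln 2) + 4 * real N * far_const R)"

lemma others_const_nonneg: "0 \<le> others_const"
  by (simp add: others_const_def)

lemma K5_nonneg: "0 \<le> K5"
  unfolding K5_def using others_const_nonneg K3_pos by simp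

lemma reg_const_nonneg: "0 \<le> reg_const"
  unfolding reg_const_def far_const_def using K5_nonneg R by (intro mult_nonneg_nonneg add_nonneg_nonneg) auto

lemma G_others_le:
  assumes n: "n \<in> {1..N}" and z: "z \<in> upper_half" and near: "cmod (z - of_real (a n)) \<le> R / 2"
  shows "cmod (G z - c n *\<^sub>R D n z) \<le> others_const"
proof -
  have "G z - c n *\<^sub>R D n z = (\<Sum>k\<in>{1..N} - {n}. c k *\<^sub>R D k z)"
    unfolding G_def using n by (subst sum.remove[of _ n]) auto
  also have "cmod \<dots> \<le> (\<Sum>k\<in>{1..N} - {n}. 8 / R\<^sup>2)"
  proof (rule sum_norm_le)
    fix k assume k: "k \<in> {1..N} - {n}"
    then have kN: "k \<in> {1..N}" by simp
    have "2 * R \<le> \<bar>a n - a k\<bar>" using separated[OF n kN] k by auto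
    also have "\<dots> = cmod (of_real (a n) - of_real (a k))" by (simp flip: of_real_diff)
    also have "\<dots> \<le> cmod (z - of_real (a k)) + cmod (z - of_real (a n))"
      using norm_triangle_ineq4[of "z - of_real (a k)" "z - of_real (a n)"] by simp
    finally have x: "R / 2 \<le> cmod (z - of_real (a k))" using near R by linarith
    then have "D k z = gub (a k) z" using r by (intro D_outside) linarith
    moreover have "cmod (gub (a k) z) \<le> 2 / R / cmod (z - of_real (a k))"
      by (rule gub_le[OF abs_a[OF kN] z R(1) ends_far[OF ends[OF n] near]])
    moreover have "2 / R / cmod (z - of_real (a k)) \<le> 2 / R / (R / 2)"
      using x R by (intro divide_left_mono mult_pos_pos) (simp_all only: zero_le_divide_iff, auto)
    ultimately have "cmod (D k z) \<le> 4 / R\<^sup>2" by (simp add: power2_eq_square)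
    then have "cmod (c k *\<^sub>R D k z) \<le> 2 * (4 / R\<^sup>2)"
      unfolding norm_scaleR using coeff[OF kN] by (intro mult_mono) auto
    then show "cmod (c k *\<^sub>R D k z) \<le> 8 / R\<^sup>2" by simp
  qed
  also have "\<dots> \<le> (\<Sum>k\<in>{1..N}. 8 / R\<^sup>2)" by (intro sum_mono2) auto
  also have "\<dots> = others_const" by (simp add: others_const_def)
  finally show ?thesis .
qed

text \<open>Near one \<open>a n\<close> the other summands are bounded, so the square of the sum is
  one singular square, with its exact coefficient, plus cross terms of order 1/|z - a n|. Away from
  all the points Cauchy-Schwarz over the N summands suffices, because each of them has an integrable
  majorant.\<close>

lemma G_square_le:
  assumes z: "z \<in> upper_half"
  shows "ennreal ((cmod (G z))\<^sup>2) \<le> sing z + (\<Sum>n=1..N. reg_term n z)"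
proof (cases "\<exists>n\<in>{1..N}. cmod (z - of_real (a n)) \<le> R / 2")
  case True
  then obtain n where n: "n \<in> {1..N}" and near: "cmod (z - of_real (a n)) \<le> R / 2" by auto
  let ?x = "cmod (z - of_real (a n))"
  let ?s = "1 / ?x\<^sup>2 * indicator {r..R/2} ?x" and ?w = "1 / ?x\<^sup>2 * indicator {r/2..r} ?x"
  let ?S = others_const
  have x: "0 < ?x" "?x \<le> 1" using upper_half_minus_real[OF z] near R by auto
  have c2: "(c n)\<^sup>2 \<le> 4" using power_mono[OF coeff[OF n], of 2] by simp
  have "cmod (G z) \<le> cmod (c n *\<^sub>R D n z) + cmod (G z - c n *\<^sub>R D n z)"
    using norm_triangle_ineq[of "c n *\<^sub>R D n z" "G z - c n *\<^sub>R D n z"] by simp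
  also have "\<dots> \<le> \<bar>c n\<bar> * cmod (D n z) + ?S" using G_others_le[OF n z near] by simp
  finally have "(cmod (G z))\<^sup>2 \<le> (\<bar>c n\<bar> * cmod (D n z) + ?S)\<^sup>2" by (intro power_mono) auto
  also have "\<dots> = (c n)\<^sup>2 * (cmod (D n z))\<^sup>2 + 2 * (\<bar>c n\<bar> * cmod (D n z)) * ?S + ?S\<^sup>2"
    by (simp add: power2_sum power_mult_distrib)
  also have "\<dots> \<le> (c n)\<^sup>2 * (?s + 12 / R\<^sup>2 * (1 / ?x) + K3\<^sup>2 * ?w) + 2 * (2 * (K3 / ?x)) * ?S + ?S\<^sup>2 * (1 / ?x)"
  proof (intro add_mono mult_left_mono mult_right_mono mult_mono)
    show "(cmod (D n z))\<^sup>2 \<le> ?s + 12 / R\<^sup>2 * (1 / ?x) + K3\<^sup>2 * ?w" by (rule D_square_near[OF n z near])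
    show "cmod (D n z) \<le> K3 / ?x" by (rule D_near[OF n z near])
    show "\<bar>c n\<bar> \<le> 2" by (rule coeff[OF n])
    have "?S\<^sup>2 * 1 \<le> ?S\<^sup>2 * (1 / ?x)" using x by (intro mult_left_mono) auto
    then show "?S\<^sup>2 \<le> ?S\<^sup>2 * (1 / ?x)" by simp
  qed (use others_const_nonneg K3_pos x in auto)
  also have "\<dots> = (c n)\<^sup>2 * ?s + ((c n)\<^sup>2 * (12 / R\<^sup>2 * (1 / ?x)) + (c n)\<^sup>2 * (K3\<^sup>2 * ?w)) + (4 * ?S * K3 + ?S\<^sup>2) * (1 / ?x)"
    by (simp add: algebra_simps)
  also have "\<dots> \<le> (c n)\<^sup>2 * ?s + (4 * (12 / R\<^sup>2 * (1 / ?x)) + 4 * (K3\<^sup>2 * ?w)) + (4 * ?S * K3 + ?S\<^sup>2) * (1 / ?x)"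
    using c2 x by (intro add_mono mult_right_mono order_refl) (auto intro!: mult_nonneg_nonneg)
  also have "\<dots> = (c n)\<^sup>2 * ?s + (K5 * (1 / ?x) + 4 * K3\<^sup>2 * ?w)"
    unfolding K5_def by (simp add: algebra_simps)
  finally have "ennreal ((cmod (G z))\<^sup>2) \<le> ennreal ((c n)\<^sup>2 * ?s + (K5 * (1 / ?x) + 4 * K3\<^sup>2 * ?w))" by (rule ennreal_leI)
  also have "\<dots> = ennreal ((c n)\<^sup>2 * ?s) + (ennreal (K5 * (1 / ?x)) + ennreal (4 * K3\<^sup>2 * ?w))"
    using K5_nonneg by (simp add: ennreal_plus)
  also have "\<dots> = ennreal ((c n)\<^sup>2) * (ennreal (1 / ?x\<^sup>2) * indicator {r..R/2} ?x)
      + (ennreal K5 * (ennreal (1 / ?x) * indicator {..R/2} ?x) + ennreal (4 * K3\<^sup>2) * (ennreal (1 / ?x\<^sup>2) * indicator {r/2..r} ?x))"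
  proof -
    have e: "ennreal (A * (B * indicator S y)) = ennreal A * (ennreal B * indicator S y)"
      if "0 \<le> A" "0 \<le> B" for A B :: real and S and y :: real
      using that by (cases "y \<in> S") (simp_all add: ennreal_mult)
    have e1: "ennreal (K5 * (1 / ?x)) = ennreal K5 * (ennreal (1 / ?x) * indicator {..R/2} ?x)"
      using K5_nonneg near by (simp add: ennreal_mult'[symmetric])
    show ?thesis
      by (subst e, simp, simp, subst e, simp, simp, simp only: e1)
  qed
  also have "\<dots> \<le> sing z + (\<Sum>n=1..N. reg_term n z)"
  proof (rule add_mono)
    show "ennreal ((c n)\<^sup>2) * (ennreal (1 / ?x\<^sup>2) * indicator {r..R/2} ?x) \<le> sing z"
      unfolding sing_def by (rule member_le_sum[OF n]) auto
    have "ennreal K5 * (ennreal (1 / ?x) * indicator {..R/2} ?x) + ennreal (4 * K3\<^sup>2) * (ennreal (1 / ?x\<^sup>2) * indicator {r/2..r} ?x) \<le> reg_term n z"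
      by (simp add: reg_term_def add_increasing2)
    also have "\<dots> \<le> (\<Sum>n=1..N. reg_term n z)" by (rule member_le_sum[OF n]) auto
    finally show "ennreal K5 * (ennreal (1 / ?x) * indicator {..R/2} ?x) + ennreal (4 * K3\<^sup>2) * (ennreal (1 / ?x\<^sup>2) * indicator {r/2..r} ?x)
        \<le> (\<Sum>n=1..N. reg_term n z)" .
  qed
  finally show ?thesis .
next
  case False
  then have far: "R / 2 \<le> cmod (z - of_real (a n))" if "n \<in> {1..N}" for n using that by force
  have "cmod (G z) \<le> (\<Sum>n=1..N. 2 * cmod (gub (a n) z))"
    unfolding G_def
  proof (rule sum_norm_le)
    fix n assume n: "n \<in> {1..N}"
    have "D n z = gub (a n) z" using far[OF n] r by (intro D_outside) linarith
    then show "cmod (c n *\<^sub>R D n z) \<le> 2 * cmod (gub (a n) z)"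
      using coeff[OF n] by (simp add: mult_right_mono)
  qed
  then have "(cmod (G z))\<^sup>2 \<le> (\<Sum>n=1..N. 2 * cmod (gub (a n) z))\<^sup>2" by (intro power_mono) auto
  also have "\<dots> \<le> (\<Sum>n=1..N. (2 * cmod (gub (a n) z))\<^sup>2) * (\<Sum>n=1..N. 1\<^sup>2)"
    using Cauchy_Schwarz_ineq_sum[of "\<lambda>n. 2 * cmod (gub (a n) z)" "\<lambda>_. 1" "{1..N}"] by simp
  also have "\<dots> = (\<Sum>n=1..N. 4 * real N * (cmod (gub (a n) z))\<^sup>2)"
    by (simp add: power_mult_distrib sum_distrib_left sum_distrib_right mult_ac)
  finally have "ennreal ((cmod (G z))\<^sup>2) \<le> ennreal (\<Sum>n=1..N. 4 * real N * (cmod (gub (a n) z))\<^sup>2)" by (rule ennreal_leI)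
  also have "\<dots> = (\<Sum>n=1..N. ennreal (4 * real N) * ennreal ((cmod (gub (a n) z))\<^sup>2))"
    by (simp add: ennreal_mult flip: sum_ennreal)
  also have "\<dots> \<le> (\<Sum>n=1..N. reg_term n z)"
  proof (rule sum_mono)
    fix n assume n: "n \<in> {1..N}"
    have "ennreal (4 * real N) * ennreal ((cmod (gub (a n) z))\<^sup>2) \<le> ennreal (4 * real N) * far_majorant R (a n) z"
      by (intro mult_left_mono gub_square_far abs_a n R far z) simp
    also have "\<dots> \<le> reg_term n z" by (simp add: reg_term_def add_increasing)
    finally show "ennreal (4 * real N) * ennreal ((cmod (gub (a n) z))\<^sup>2) \<le> reg_term n z" .
  qed
  finally show ?thesis by (simp add: add_increasing)
qed

lemma reg_term_measurable [measurable]: "reg_term n \<in> borel_measurable borel"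
  unfolding reg_term_def[abs_def] by measurable

lemma nn_integral_reg_term:
  "(\<integral>\<^sup>+z. reg_term n z * indicator upper_half z \<partial>lborel)
    = ennreal (K5 * (pi * (R / 2)) + 4 * K3\<^sup>2 * (pi * ln 2) + 4 * real N * far_const R)"
proof -
  let ?A = "\<lambda>z. ennreal (1 / cmod (z - of_real (a n))) * indicator {..R/2} (cmod (z - of_real (a n))) * indicator upper_half z"
  let ?B = "\<lambda>z. ennreal (1 / (cmod (z - of_real (a n)))\<^sup>2) * indicator {r/2..r} (cmod (z - of_real (a n))) * indicator upper_half z"
  let ?C = "\<lambda>z. far_majorant R (a n) z * indicator upper_half z"
  have A: "(\<integral>\<^sup>+z. ?A z \<partial>lborel) = ennreal (pi * (R / 2))" using R by (intro nn_integral_half_plane_inverse) auto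
  have B: "(\<integral>\<^sup>+z. ?B z \<partial>lborel) = ennreal (pi * ln 2)"
    using nn_integral_half_plane_inverse_square[of "r / 2" r "a n"] r by simp
  have C: "(\<integral>\<^sup>+z. ?C z \<partial>lborel) = ennreal (far_const R)" by (rule nn_integral_far_majorant[OF R(1)])
  have "(\<integral>\<^sup>+z. reg_term n z * indicator upper_half z \<partial>lborel)
     = (\<integral>\<^sup>+z. ennreal K5 * ?A z + ennreal (4 * K3\<^sup>2) * ?B z + ennreal (4 * real N) * ?C z \<partial>lborel)"
    by (intro nn_integral_cong) (simp add: reg_term_def distrib_right mult.assoc)
  also have "\<dots> = ennreal K5 * (\<integral>\<^sup>+z. ?A z \<partial>lborel) + ennreal (4 * K3\<^sup>2) * (\<integral>\<^sup>+z. ?B z \<partial>lborel) + ennreal (4 * real N) * (\<integral>\<^sup>+z. ?C z \<partial>lborel)"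
    by (simp add: nn_integral_add nn_integral_cmult)
  also have "\<dots> = ennreal (K5 * (pi * (R / 2)) + 4 * K3\<^sup>2 * (pi * ln 2) + 4 * real N * far_const R)"
    unfolding A B C using K5_nonneg R
    by (simp add: far_const_def flip: ennreal_mult ennreal_plus)
  finally show ?thesis .
qed

text \<open>The set \<open>B\<close> allows two uses: the whole plane with s = 1, which gives the
  total energy with its logarithm, and the union of the balls of radius \<delta> with s = \<delta>,
  where the logarithm is only that of \<delta> / r.\<close>

lemma nn_integral_G_square_le:
  assumes s: "r \<le> s" and B [measurable]: "B \<in> sets borel"
    and near: "\<And>z n. z \<in> B \<Longrightarrow> n \<in> {1..N} \<Longrightarrow> cmod (z - of_real (a n)) \<le> R / 2 \<Longrightarrow> cmod (z - of_real (a n)) \<le> s"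
  shows "(\<integral>\<^sup>+z. ennreal ((cmod (G z))\<^sup>2) * indicator B z * indicator upper_half z \<partial>lborel)
    \<le> ennreal (pi * (\<Sum>n=1..N. (c n)\<^sup>2) * ln (s / r) + reg_const)"
proof -
  let ?A = "\<lambda>n z. ennreal (1 / (cmod (z - of_real (a n)))\<^sup>2) * indicator {r..s} (cmod (z - of_real (a n))) * indicator upper_half z"
  have "(\<integral>\<^sup>+z. ennreal ((cmod (G z))\<^sup>2) * indicator B z * indicator upper_half z \<partial>lborel)
     \<le> (\<integral>\<^sup>+z. (\<Sum>n=1..N. ennreal ((c n)\<^sup>2) * ?A n z) + (\<Sum>n=1..N. reg_term n z * indicator upper_half z) \<partial>lborel)"
  proof (rule nn_integral_mono)
    fix z
    show "ennreal ((cmod (G z))\<^sup>2) * indicator B z * indicator upper_half z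
       \<le> (\<Sum>n=1..N. ennreal ((c n)\<^sup>2) * ?A n z) + (\<Sum>n=1..N. reg_term n z * indicator upper_half z)"
    proof (cases "z \<in> B \<and> z \<in> upper_half")
      case True
      have "sing z \<le> (\<Sum>n=1..N. ennreal ((c n)\<^sup>2) * ?A n z)"
        unfolding sing_def
      proof (intro sum_mono mult_left_mono)
        fix n assume "n \<in> {1..N}"
        then show "ennreal (1 / (cmod (z - of_real (a n)))\<^sup>2) * indicator {r..R/2} (cmod (z - of_real (a n))) \<le> ?A n z"
          using near[of z n] True by (auto split: split_indicator)
      qed simp
      then show ?thesis
        using True G_square_le[of z] by (auto intro: order_trans add_right_mono)
    qed auto
  qed
  also have "\<dots> = (\<Sum>n=1..N. ennreal ((c n)\<^sup>2) * (\<integral>\<^sup>+z. ?A n z \<partial>lborel)) + (\<Sum>n=1..N. (\<integral>\<^sup>+z. reg_term n z * indicator upper_half z \<partial>lborel))"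
    by (subst nn_integral_add, measurable, subst nn_integral_sum, measurable, subst nn_integral_sum, measurable)
      (simp add: nn_integral_cmult)
  also have "\<dots> = (\<Sum>n=1..N. ennreal ((c n)\<^sup>2) * ennreal (pi * ln (s / r))) + (\<Sum>n=1..N. ennreal (K5 * (pi * (R / 2)) + 4 * K3\<^sup>2 * (pi * ln 2) + 4 * real N * far_const R))"
    unfolding nn_integral_reg_term nn_integral_half_plane_inverse_square[OF r(1) s] ..
  also have "\<dots> = ennreal (pi * (\<Sum>n=1..N. (c n)\<^sup>2) * ln (s / r)) + ennreal reg_const"
  proof (rule arg_cong2[of _ _ _ _ "(+)"])
    have l: "0 \<le> pi * ln (s / r)" using s r by simp
    have "(\<Sum>n=1..N. ennreal ((c n)\<^sup>2) * ennreal (pi * ln (s / r))) = (\<Sum>n=1..N. ennreal ((c n)\<^sup>2 * (pi * ln (s / r))))"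
      using l by (simp add: ennreal_mult)
    also have "\<dots> = ennreal (\<Sum>n=1..N. (c n)\<^sup>2 * (pi * ln (s / r)))"
      using l by (subst sum_ennreal) auto
    also have "(\<Sum>n=1..N. (c n)\<^sup>2 * (pi * ln (s / r))) = pi * (\<Sum>n=1..N. (c n)\<^sup>2) * ln (s / r)"
      by (simp add: sum_distrib_right mult_ac flip: sum_distrib_left)
    finally show "(\<Sum>n=1..N. ennreal ((c n)\<^sup>2) * ennreal (pi * ln (s / r))) = ennreal (pi * (\<Sum>n=1..N. (c n)\<^sup>2) * ln (s / r))" .
    have "0 \<le> K5 * (pi * (R / 2)) + 4 * K3\<^sup>2 * (pi * ln 2) + 4 * real N * far_const R"
      unfolding far_const_def using K5_nonneg R by (intro add_nonneg_nonneg mult_nonneg_nonneg) auto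
    then show "(\<Sum>n=1..N. ennreal (K5 * (pi * (R / 2)) + 4 * K3\<^sup>2 * (pi * ln 2) + 4 * real N * far_const R)) = ennreal reg_const"
      unfolding reg_const_def by (subst sum_ennreal) auto
  qed
  also have "\<dots> = ennreal (pi * (\<Sum>n=1..N. (c n)\<^sup>2) * ln (s / r) + reg_const)"
    using s r reg_const_nonneg by (intro ennreal_plus[symmetric] mult_nonneg_nonneg sum_nonneg) auto
  finally show ?thesis .
qed

end

section \<open>Pairing with the boundary charge\<close>

lemma lborel_pair_integrable_mult:
  fixes f g :: "real \<Rightarrow> real"
  assumes f: "integrable lborel f" and g: "integrable lborel g"
  shows "integrable (lborel \<Otimes>\<^sub>M lborel) (\<lambda>p. f (fst p) * g (snd p))"
proof (rule integrableI_bounded)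
  have [measurable]: "f \<in> borel_measurable borel" "g \<in> borel_measurable borel" using f g by auto
  show "(\<lambda>p. f (fst p) * g (snd p)) \<in> borel_measurable (lborel \<Otimes>\<^sub>M lborel)" by simp
  have "(\<integral>\<^sup>+p. ennreal (norm (f (fst p) * g (snd p))) \<partial>(lborel \<Otimes>\<^sub>M lborel))
     = (\<integral>\<^sup>+x. (\<integral>\<^sup>+y. ennreal \<bar>f x\<bar> * ennreal \<bar>g y\<bar> \<partial>lborel) \<partial>lborel)"
    by (subst lborel.nn_integral_fst[symmetric]) (simp_all add: abs_mult ennreal_mult)
  also have "\<dots> = (\<integral>\<^sup>+x. ennreal \<bar>f x\<bar> \<partial>lborel) * (\<integral>\<^sup>+y. ennreal \<bar>g y\<bar> \<partial>lborel)"
    by (simp add: nn_integral_cmult nn_integral_multc)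
  also have "\<dots> < \<infinity>" using f g by (simp add: integrable_iff_bounded ennreal_mult_less_top)
  finally show "(\<integral>\<^sup>+p. ennreal (norm (f (fst p) * g (snd p))) \<partial>(lborel \<Otimes>\<^sub>M lborel)) < \<infinity>" .
qed

text \<open>The radius 8 leaves room: a point within 5 of some t in [-1,1] is within 7 of both
  ends.\<close>

definition three_halves_kernel :: "complex \<Rightarrow> real \<Rightarrow> ennreal" where
  "three_halves_kernel z t = ennreal (1 / (cmod (z - of_real t) * sqrt (cmod (z - of_real t))))
     * indicator {..<8} (cmod (z - of_real t))"

lemma three_halves_kernel_measurable [measurable]: "(\<lambda>z. three_halves_kernel z t) \<in> borel_measurable borel"
  unfolding three_halves_kernel_def by measurable

lemma two_square_le:
  fixes y r :: real
  assumes "y\<^sup>2 \<le> (r / 2)\<^sup>2" shows "2 * y\<^sup>2 \<le> r\<^sup>2"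
proof -
  have "(r / 2)\<^sup>2 = r\<^sup>2 / 4" by (simp add: power_divide)
  with assms zero_le_power2[of y] show ?thesis by linarith
qed

context wall_profile
begin

text \<open>Division by |z - t| with t at an end raises the singularity there from exponent 1/2 to
  3/2, still integrable in the plane. For other t the product of the two singularities is split into
  exponents 3/2 by x^2 y <= x^3 + y^3 applied to reciprocal square roots.\<close>

lemma gub_div_near:
  assumes n: "n \<in> {1..N}" and z: "z \<in> upper_half" and far: "R / 2 \<le> cmod (z - of_real (a n))"
    and t: "t \<in> {-1..1}" "cmod (z - of_real t) \<le> 5"
  shows "ennreal (cmod (gub (a n) z) / cmod (z - of_real t))
    \<le> ennreal (2 / R) * (three_halves_kernel z 1 + three_halves_kernel z (- 1) + 2 * three_halves_kernel z t)"
proof -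
  let ?x = "cmod (z - of_real (a n))" and ?p = "cmod (z - of_real 1)" and ?q = "cmod (z - of_real (- 1))"
    and ?k = "cmod (z - of_real t)"
  define W where "W s = 1 / (cmod (z - of_real s) * sqrt (cmod (z - of_real s)))" for s
  have pos: "0 < cmod (z - of_real s)" for s using upper_half_minus_real[OF z] by simp
  note pos' = pos[of 1] pos[of "- 1"] pos[of t] pos[of "a n"]
  have k: "?p \<le> 7" "?q \<le> 7"
  proof -
    have "cmod (z - of_real s) \<le> ?k + \<bar>t - s\<bar>" for s
    proof -
      have "z - of_real s = (z - of_real t) + of_real (t - s)" by simp
      then have "cmod (z - of_real s) \<le> ?k + cmod (of_real (t - s))" by (metis norm_triangle_ineq)
      then show ?thesis by (simp only: norm_of_real)
    qed
    from this[of 1] this[of "- 1"] t show "?p \<le> 7" "?q \<le> 7" by (auto simp: abs_if split: if_splits)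
  qed
  have young: "1 / sqrt y * (1 / x) \<le> 1 / (y * sqrt y) + 1 / (x * sqrt x)" if "0 < x" "0 < y" for x y :: real
  proof -
    have "(1 / sqrt x)\<^sup>2 * (1 / sqrt y) \<le> (1 / sqrt x)^3 + (1 / sqrt y)^3"
      using that by (intro mult_square_le_cubes) auto
    then show ?thesis using that by (simp add: power_divide power3_eq_cube power2_eq_square add.commute mult.commute)
  qed
  have "2 \<le> ?p + ?q" using norm_triangle_ineq4[of "z - of_real (- 1)" "z - of_real 1"] by simp
  have pq: "1 / sqrt (?p * ?q) \<le> 1 / sqrt ?p + 1 / sqrt ?q"
  proof (cases "1 \<le> ?q")
    case True
    then have "1 / (sqrt ?p * sqrt ?q) \<le> 1 / (sqrt ?p * 1)"
      using pos' by (intro divide_left_mono mult_left_mono mult_pos_pos) auto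
    then show ?thesis using pos' by (simp only: real_sqrt_mult) (simp add: add_increasing2)
  next
    case False
    then have "1 \<le> ?p" using \<open>2 \<le> ?p + ?q\<close> by linarith
    then have "1 / (sqrt ?p * sqrt ?q) \<le> 1 / (1 * sqrt ?q)"
      using pos' by (intro divide_left_mono mult_right_mono mult_pos_pos) auto
    then show ?thesis using pos' by (simp only: real_sqrt_mult) (simp add: add_increasing)
  qed
  have "sqrt (1 - (a n)\<^sup>2) \<le> 1" "0 \<le> sqrt (1 - (a n)\<^sup>2)" using abs_a[OF n] by (auto simp: abs_square_le_1)
  then have "cmod (gub (a n) z) \<le> 1 / (?x * sqrt (?p * ?q))"
    unfolding cmod_gub[OF abs_a[OF n] z] cmod_one_minus_square of_real_1 of_real_minus diff_minus_eq_add
    by (intro divide_right_mono) auto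
  also have "\<dots> = 1 / ?x * (1 / sqrt (?p * ?q))" by simp
  also have "\<dots> \<le> 2 / R * (1 / sqrt ?p + 1 / sqrt ?q)"
  proof (rule mult_mono[OF _ pq])
    have "1 / ?x \<le> 1 / (R / 2)" using far R by (intro frac_le) auto
    then show "1 / ?x \<le> 2 / R" by simp
  qed (use R pos' in auto)
  finally have "cmod (gub (a n) z) * (1 / ?k) \<le> 2 / R * (1 / sqrt ?p + 1 / sqrt ?q) * (1 / ?k)"
    using pos' by (intro mult_right_mono) auto
  also have "\<dots> = 2 / R * (1 / sqrt ?p * (1 / ?k) + 1 / sqrt ?q * (1 / ?k))" by (simp only: distrib_right mult.assoc)
  also have "\<dots> \<le> 2 / R * ((W 1 + W t) + (W (- 1) + W t))"
    unfolding W_def using R pos' by (intro mult_left_mono add_mono young) auto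
  also have "(W 1 + W t) + (W (- 1) + W t) = W 1 + W (- 1) + 2 * W t" by simp
  finally have "ennreal (cmod (gub (a n) z) / ?k) \<le> ennreal (2 / R * (W 1 + W (- 1) + 2 * W t))"
    by (intro ennreal_leI) simp
  also have "\<dots> = ennreal (2 / R) * (ennreal (W 1) + ennreal (W (- 1)) + 2 * ennreal (W t))"
  proof -
    have "0 \<le> W s" for s by (simp add: W_def)
    note W0 = this
    have "ennreal (2 / R * (W 1 + W (- 1) + 2 * W t)) = ennreal (2 / R) * ennreal (W 1 + W (- 1) + 2 * W t)"
      by (rule ennreal_mult) (use R W0 in auto)
    also have "ennreal (W 1 + W (- 1) + 2 * W t) = ennreal (W 1) + ennreal (W (- 1)) + 2 * ennreal (W t)"
      using W0 by (simp add: ennreal_plus ennreal_mult)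
    finally show ?thesis .
  qed
  also have "\<dots> = ennreal (2 / R) * (three_halves_kernel z 1 + three_halves_kernel z (- 1) + 2 * three_halves_kernel z t)"
    using k t(2) by (simp add: three_halves_kernel_def W_def)
  finally show ?thesis .
qed

lemma gub_div_far:
  assumes n: "n \<in> {1..N}" and z: "z \<in> upper_half" and t: "t \<in> {-1..1}" "5 < cmod (z - of_real t)"
  shows "cmod (gub (a n) z) / cmod (z - of_real t) \<le> 4 * (1 / (cmod (z - of_real t))^3)"
proof -
  let ?k = "cmod (z - of_real t)"
  have half: "?k / 2 \<le> cmod (z - of_real s)" if "\<bar>s\<bar> \<le> 1" for s
  proof -
    have "z - of_real t = (z - of_real s) + of_real (s - t)" by simp
    then have "?k \<le> cmod (z - of_real s) + cmod (of_real (s - t))" by (metis norm_triangle_ineq)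
    then have "?k \<le> cmod (z - of_real s) + \<bar>s - t\<bar>" by (simp only: norm_of_real)
    then show ?thesis using t that by (auto simp: abs_if split: if_splits)
  qed
  have k0: "0 < ?k / 2" using t(2) by linarith
  have "(?k / 2)\<^sup>2 \<le> cmod (1 - z\<^sup>2)"
    unfolding cmod_one_minus_square power2_eq_square[of "?k / 2"]
    using half[of 1] half[of "- 1"] k0 by (intro mult_mono) auto
  then have s: "?k / 2 \<le> sqrt (cmod (1 - z\<^sup>2))" using k0 by (intro real_le_rsqrt)
  have "sqrt (1 - (a n)\<^sup>2) \<le> 1" "0 \<le> sqrt (1 - (a n)\<^sup>2)" using abs_a[OF n] by (auto simp: abs_square_le_1)
  then have "cmod (gub (a n) z) \<le> 1 / (?k / 2 * (?k / 2))"
    unfolding cmod_gub[OF abs_a[OF n] z]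
    using half[of "a n"] abs_a[OF n] s k0 by (intro frac_le mult_mono mult_pos_pos) auto
  then have "cmod (gub (a n) z) / ?k \<le> 1 / (?k / 2 * (?k / 2)) / ?k" by (intro divide_right_mono) auto
  then show ?thesis by (simp add: power3_eq_cube)
qed

text \<open>Supplies the absolute integrability that \<open>pairing\<close> asks for. The bound in
  the proof blows up as r tends to 0, which is harmless because its size never enters the
  estimate.\<close>

lemma G_kernel_bound:
  "\<exists>K. \<forall>t\<in>{-1..1}. (\<integral>\<^sup>+z. ennreal (cmod (G z) / cmod (z - of_real t)) * indicator upper_half z \<partial>lborel) \<le> ennreal K"
proof (intro exI ballI)
  fix t :: real assume t: "t \<in> {-1..1}"
  \<comment> \<open>Bounds \<open>D n\<close> near \<open>a n\<close>: it vanishes within distance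
    r/2 and is at most K3 / (r/2) beyond.\<close>
  let ?M = "2 * K3 / r"
  have M: "0 \<le> ?M" using K3_pos r by simp
  let ?A = "\<lambda>z. ennreal (1 / cmod (z - of_real t)) * indicator {..5} (cmod (z - of_real t)) * indicator upper_half z"
  let ?W = "\<lambda>s z. three_halves_kernel z s * indicator upper_half z"
  let ?C = "\<lambda>z. ennreal (1 / (cmod (z - of_real t))^3) * indicator {5..} (cmod (z - of_real t)) * indicator upper_half z"
  let ?S = "\<lambda>z. ennreal ?M * ?A z + ennreal (2 / R) * (?W 1 z + ?W (- 1) z + 2 * ?W t z) + 4 * ?C z"
  have term_le: "ennreal (cmod (D n z) / cmod (z - of_real t)) \<le> ?S z" if n: "n \<in> {1..N}" and z: "z \<in> upper_half" for n z
  proof -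
    let ?x = "cmod (z - of_real (a n))" and ?k = "cmod (z - of_real t)"
    have pos: "0 < ?x" "0 < ?k" using upper_half_minus_real[OF z] by simp_all
    consider "?x \<le> R / 2" | "R / 2 < ?x" "?k \<le> 5" | "R / 2 < ?x" "5 < ?k" by linarith
    then show ?thesis
    proof cases
      case 1
      have "cmod (D n z) \<le> ?M"
      proof (cases "?x \<le> r / 2")
        case False
        have "cmod (D n z) \<le> K3 / ?x" by (rule D_near[OF n z 1])
        also have "\<dots> \<le> K3 / (r / 2)" using False r K3_pos by (intro frac_le) auto
        finally show ?thesis by (simp add: mult.commute)
      qed (use M D_inside in auto)
      then have "cmod (D n z) / ?k \<le> ?M * (1 / ?k)"
        using pos divide_right_mono[of "cmod (D n z)" ?M ?k] by simp
      then have "ennreal (cmod (D n z) / ?k) \<le> ennreal (?M * (1 / ?k))" by (rule ennreal_leI)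
      also have "\<dots> = ennreal ?M * ennreal (1 / ?k)" by (rule ennreal_mult) (use M in auto)
      also have "\<dots> = ennreal ?M * ?A z"
      proof -
        have "z - of_real t = (z - of_real (a n)) + of_real (a n - t)" by simp
        then have "?k \<le> ?x + cmod (of_real (a n - t))" by (metis norm_triangle_ineq)
        then have "?k \<le> ?x + \<bar>a n - t\<bar>" by (simp only: norm_of_real)
        then have "?k \<le> 5" using t abs_a[OF n] 1 R by (auto simp: abs_if split: if_splits)
        then show ?thesis using z by simp
      qed
      finally show ?thesis by (simp add: add_increasing2 add.assoc)
    next
      case 2
      have "D n z = gub (a n) z" using 2 r by (intro D_outside) linarith
      then show ?thesis
        using gub_div_near[OF n z _ t 2(2)] 2 z by (simp add: add_increasing add_increasing2)
    next
      case 3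
      have "D n z = gub (a n) z" using 3 r by (intro D_outside) linarith
      then have "ennreal (cmod (D n z) / ?k) \<le> ennreal (4 * (1 / ?k^3))"
        using gub_div_far[OF n z t 3(2)] by (simp add: ennreal_leI)
      also have "\<dots> = ennreal 4 * ennreal (1 / ?k^3)" by (rule ennreal_mult) auto
      also have "\<dots> = 4 * ?C z" using 3 z by simp
      finally show ?thesis by (simp add: add_increasing)
    qed
  qed
  have W: "(\<integral>\<^sup>+z. ?W s z \<partial>lborel) = ennreal (2 * pi * sqrt 8)" for s
    unfolding three_halves_kernel_def by (rule nn_integral_half_plane_inverse_three_halves) simp
  have A: "(\<integral>\<^sup>+z. ?A z \<partial>lborel) = ennreal (pi * 5)" by (rule nn_integral_half_plane_inverse) simp
  have C: "(\<integral>\<^sup>+z. ?C z \<partial>lborel) = ennreal (pi / 5)" by (rule nn_integral_half_plane_inverse_cube) simp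
  let ?w = "2 * pi * sqrt 8"
  have "(\<integral>\<^sup>+z. ennreal (cmod (G z) / cmod (z - of_real t)) * indicator upper_half z \<partial>lborel)
     \<le> (\<integral>\<^sup>+z. ennreal (2 * real N) * ?S z \<partial>lborel)"
  proof (rule nn_integral_mono)
    fix z
    show "ennreal (cmod (G z) / cmod (z - of_real t)) * indicator upper_half z \<le> ennreal (2 * real N) * ?S z"
    proof (cases "z \<in> upper_half")
      case z: True
      have "cmod (G z) \<le> (\<Sum>n=1..N. 2 * cmod (D n z))"
        unfolding G_def using coeff by (intro sum_norm_le) (simp add: mult_right_mono)
      then have "cmod (G z) / cmod (z - of_real t) \<le> (\<Sum>n=1..N. 2 * (cmod (D n z) / cmod (z - of_real t)))"
        using divide_right_mono[of _ _ "cmod (z - of_real t)"] by (fastforce simp: sum_divide_distrib)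
      then have "ennreal (cmod (G z) / cmod (z - of_real t)) \<le> ennreal (\<Sum>n=1..N. 2 * (cmod (D n z) / cmod (z - of_real t)))"
        by (rule ennreal_leI)
      also have "\<dots> = (\<Sum>n=1..N. 2 * ennreal (cmod (D n z) / cmod (z - of_real t)))"
      proof -
        have "2 * ennreal x = ennreal (2 * x)" if "0 \<le> x" for x using that by (simp add: ennreal_mult)
        then show ?thesis by (simp only: divide_nonneg_nonneg norm_ge_zero) (rule sum_ennreal[symmetric], simp)
      qed
      also have "\<dots> \<le> (\<Sum>n=1..N. 2 * ?S z)"
        by (intro sum_mono mult_left_mono term_le z) auto
      also have "\<dots> = ennreal (2 * real N) * ?S z"
        by (simp add: ennreal_mult ennreal_of_nat_eq_real_of_nat mult_ac)
      finally show ?thesis using z by simp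
    qed simp
  qed
  also have "\<dots> = ennreal (2 * real N) * (ennreal ?M * ennreal (pi * 5)
      + ennreal (2 / R) * (ennreal ?w + ennreal ?w + 2 * ennreal ?w) + 4 * ennreal (pi / 5))"
    by (simp add: nn_integral_cmult nn_integral_add W A C)
  also have "\<dots> = ennreal (2 * real N * (?M * (pi * 5) + 2 / R * (?w + ?w + 2 * ?w) + 4 * (pi / 5)))"
  proof -
    have "ennreal A * (ennreal B * ennreal p + ennreal q * (ennreal w + ennreal w + 2 * ennreal w) + 4 * ennreal v)
        = ennreal (A * (B * p + q * (w + w + 2 * w) + 4 * v))"
      if "0 \<le> A" "0 \<le> B" "0 \<le> p" "0 \<le> q" "0 \<le> w" "0 \<le> v" for A B p q w v :: real
    proof -
      have "x + x + 2 * x = (1 + 1 + 2) * x" for x :: ennreal by (simp only: distrib_right mult_1_left)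
      then have "x + x + 2 * x = 4 * x" for x :: ennreal by simp
      then show ?thesis using that by (simp add: ennreal_mult ennreal_plus)
    qed
    then show ?thesis using M R by (simp only: mult_nonneg_nonneg divide_nonneg_nonneg real_sqrt_ge_zero
          pi_ge_zero of_nat_0_le_iff zero_le_numeral less_imp_le)
  qed
  finally show "(\<integral>\<^sup>+z. ennreal (cmod (G z) / cmod (z - of_real t)) * indicator upper_half z \<partial>lborel)
      \<le> ennreal (2 * real N * (?M * (pi * 5) + 2 / R * (?w + ?w + 2 * ?w) + 4 * (pi / 5)))" .
qed

section \<open>The boundary trace of the truncated profile\<close>

definition trace_fun :: "nat \<Rightarrow> real \<Rightarrow> real" where
  "trace_fun n t = (if t < a n then pi / 2 else - pi / 2) * step (2 * (t - a n)\<^sup>2 / r\<^sup>2)"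

definition trace_deriv :: "nat \<Rightarrow> real \<Rightarrow> real" where
  "trace_deriv n t = (if t < a n then pi / 2 else - pi / 2) * (step' (2 * (t - a n)\<^sup>2 / r\<^sup>2) * (4 * (t - a n) / r\<^sup>2))"

definition \<zeta>0 :: "real \<Rightarrow> real" where
  "\<zeta>0 t = (\<Sum>n=1..N. c n * (trace_fun n t - arcsin (a n)))"

lemma cut_arg_real: "cut_arg n (of_real t) = 2 * (t - a n)\<^sup>2 / r\<^sup>2"
  by (simp add: cut_arg_def dist2_def)

lemma isCont_step_cut: "isCont (\<lambda>z. step (cut_arg n z)) z"
  using continuous_on_compose2[OF continuous_step[of UNIV] continuous_on_cut_arg[of UNIV n] subset_UNIV]
  by (simp add: continuous_on_eq_continuous_at)

lemma \<zeta>_tendsto_real: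
  assumes t: "t \<in> {-1..1}"
  shows "(\<zeta> \<longlongrightarrow> \<zeta>0 t) (at (of_real t) within upper_half)"
  unfolding \<zeta>_def[abs_def] \<zeta>0_def
proof (intro tendsto_sum tendsto_mult_left tendsto_diff tendsto_const)
  fix n assume n: "n \<in> {1..N}"
  have s: "((\<lambda>z. step (cut_arg n z)) \<longlongrightarrow> step (2 * (t - a n)\<^sup>2 / r\<^sup>2)) (at (of_real t) within upper_half)"
    using isCont_step_cut[where n = n and z = "of_real t"] unfolding isCont_def cut_arg_real by (rule tendsto_within_subset) simp
  show "((\<lambda>z. ub (a n) z * step (cut_arg n z)) \<longlongrightarrow> trace_fun n t) (at (of_real t) within upper_half)"
  proof (cases "t = a n")
    case False
    show ?thesis unfolding trace_fun_def
      by (rule tendsto_mult[OF ub_tendsto_real[OF abs_a[OF n] t False] s])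
  next
    case True
    have "eventually (\<lambda>z. dist z (of_real t) < r / 2) (at (of_real t) within upper_half)"
      unfolding eventually_at using r by (intro exI[of _ "r / 2"]) auto
    then have "eventually (\<lambda>z. ub (a n) z * step (cut_arg n z) = trace_fun n t) (at (of_real t) within upper_half)"
    proof eventually_elim
      case (elim z)
      then have "(cmod (z - of_real (a n)))\<^sup>2 \<le> (r / 2)\<^sup>2" using True by (intro power_mono) (auto simp: dist_norm)
      then have "2 * (cmod (z - of_real (a n)))\<^sup>2 \<le> r\<^sup>2" by (rule two_square_le)
      then have "cut_arg n z \<le> 1" using r by (simp add: cut_arg_eq)
      then show ?case using True by (simp add: step_eq_0 trace_fun_def)
    qed
    then show ?thesis by (rule tendsto_eventually)
  qed
qed

lemma \<zeta>_tendsto_infinity: "(\<zeta> \<longlongrightarrow> 0) (inf at_infinity (principal upper_half))"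
proof -
  have "((\<lambda>z. \<Sum>n=1..N. c n * (ub (a n) z * step (cut_arg n z) - arcsin (a n)))
      \<longlongrightarrow> (\<Sum>n=1..N. c n * (arcsin (a n) * 1 - arcsin (a n)))) (inf at_infinity (principal upper_half))"
  proof (intro tendsto_sum tendsto_mult_left tendsto_diff tendsto_const tendsto_mult)
    fix n assume n: "n \<in> {1..N}"
    show "(ub (a n) \<longlongrightarrow> arcsin (a n)) (inf at_infinity (principal upper_half))"
      by (rule ub_tendsto_infinity[OF abs_a[OF n]])
    have "eventually (\<lambda>z. step (cut_arg n z) = 1) at_infinity"
      unfolding eventually_at_infinity
    proof (intro exI allI impI)
      fix z :: complex assume z: "r + 1 \<le> cmod z"
      have "cmod z \<le> cmod (z - of_real (a n)) + cmod (of_real (a n) :: complex)"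
        using norm_triangle_ineq[of "z - of_real (a n)" "of_real (a n)"] by simp
      then have "r \<le> cmod (z - of_real (a n))" using z abs_a[OF n] by simp
      then have "r\<^sup>2 \<le> (cmod (z - of_real (a n)))\<^sup>2" using r by (intro power_mono) auto
      then show "step (cut_arg n z) = 1" using r by (intro step_eq_1) (simp add: cut_arg_eq pos_le_divide_eq)
    qed
    then show "((\<lambda>z. step (cut_arg n z)) \<longlongrightarrow> 1) (inf at_infinity (principal upper_half))"
      by (intro tendsto_mono[OF inf_le1 tendsto_eventually])
  qed
  then show ?thesis by (simp add: \<zeta>_def[abs_def])
qed

text \<open>The change of sign at \<open>a n\<close> is invisible, because the factor
  \<open>step\<close> vanishes in a neighbourhood of that point.\<close>

lemma trace_fun_deriv: "(trace_fun n has_real_derivative trace_deriv n t) (at t)"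
proof (cases "t = a n")
  case True
  have "eventually (\<lambda>x. x \<in> {a n - r / 2<..<a n + r / 2}) (nhds t)"
    by (rule eventually_nhds_in_open) (use True r in auto)
  then have ev: "eventually (\<lambda>x. trace_fun n x = 0) (nhds t)"
  proof eventually_elim
    case (elim x)
    then have "x - a n \<le> r / 2" "- (x - a n) \<le> r / 2" unfolding greaterThanLessThan_iff by linarith+
    then have "\<bar>x - a n\<bar> \<le> r / 2" by (rule abs_leI)
    then have "\<bar>x - a n\<bar>\<^sup>2 \<le> (r / 2)\<^sup>2" by (intro power_mono) auto
    then have "2 * (x - a n)\<^sup>2 \<le> r\<^sup>2" using two_square_le[of "\<bar>x - a n\<bar>" r] by simp
    then show ?case using r by (simp add: trace_fun_def step_eq_0)
  qed
  have "(trace_fun n has_real_derivative 0) (at t)"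
    using DERIV_cong_ev[OF refl ev refl, of 0] by simp
  then show ?thesis using True by (simp add: trace_deriv_def)
next
  case False
  define s where "s = (if t < a n then pi / 2 else - pi / 2)"
  have "open {x. (x < a n) = (t < a n) \<and> x \<noteq> a n}"
  proof -
    have "{x. (x < a n) = (t < a n) \<and> x \<noteq> a n} = (if t < a n then {..<a n} else {a n<..})"
      by (auto simp: not_less)
    then show ?thesis by simp
  qed
  then have ev: "eventually (\<lambda>x. trace_fun n x = s * step (2 * (x - a n)\<^sup>2 / r\<^sup>2)) (nhds t)"
    using eventually_nhds_in_open[of "{x. (x < a n) = (t < a n) \<and> x \<noteq> a n}" t] False
    by (auto elim!: eventually_mono simp: trace_fun_def s_def)
  have "((\<lambda>x. 2 * (x - a n)\<^sup>2 / r\<^sup>2) has_real_derivative 4 * (t - a n) / r\<^sup>2) (at t)"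
    unfolding divide_inverse by (auto intro!: derivative_eq_intros)
  from DERIV_cmult[OF DERIV_chain2[OF step_deriv this], of s]
  have "((\<lambda>x. s * step (2 * (x - a n)\<^sup>2 / r\<^sup>2)) has_real_derivative trace_deriv n t) (at t)"
    by (simp add: trace_deriv_def s_def)
  then show ?thesis using DERIV_cong_ev[OF refl ev refl] by simp
qed

lemma trace_deriv_bound:
  "\<bar>trace_deriv n t\<bar> \<le> 2 * pi / step_mass / r * indicator {a n - r..a n + r} t"
proof (cases "\<bar>t - a n\<bar> \<le> r")
  case True
  then have "t \<in> {a n - r..a n + r}" by (auto simp: abs_le_iff)
  moreover have "\<bar>trace_deriv n t\<bar> = pi / 2 * (step' (2 * (t - a n)\<^sup>2 / r\<^sup>2) * (4 * \<bar>t - a n\<bar> / r\<^sup>2))"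
    using step'_nonneg by (simp add: trace_deriv_def abs_mult)
  moreover have "\<dots> \<le> pi / 2 * (1 / step_mass * (4 * r / r\<^sup>2))"
    using True step'_nonneg step'_le step_mass_pos
    by (intro mult_left_mono mult_mono divide_right_mono) auto
  moreover have "pi / 2 * (1 / step_mass * (4 * r / r\<^sup>2)) = 2 * pi / step_mass / r"
    using r by (simp add: power2_eq_square)
  ultimately show ?thesis by simp
next
  case False
  then have "r\<^sup>2 \<le> \<bar>t - a n\<bar>\<^sup>2" using r by (intro power_mono) auto
  then have "2 \<le> 2 * (t - a n)\<^sup>2 / r\<^sup>2" using r by (simp add: pos_le_divide_eq)
  then show ?thesis using r step_mass_pos by (simp add: trace_deriv_def step'_eq_0)
qed

lemma trace_deriv_measurable [measurable]: "trace_deriv n \<in> borel_measurable borel"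
proof -
  have [measurable]: "step' \<in> borel_measurable borel"
    by (rule borel_measurable_continuous_onI[OF continuous_step'])
  show ?thesis unfolding trace_deriv_def[abs_def] by measurable
qed

lemma integrable_trace_deriv: "integrable lborel (trace_deriv n)"
proof (rule Bochner_Integration.integrable_bound)
  show "integrable lborel (\<lambda>t. 2 * pi / step_mass / r * indicator {a n - r..a n + r} t)"
    using r by (intro integrable_mult_right integrable_real_indicator) auto
  show "AE t in lborel. norm (trace_deriv n t) \<le> norm (2 * pi / step_mass / r * indicator {a n - r..a n + r} t)"
    unfolding real_norm_def by (intro AE_I2 order_trans[OF trace_deriv_bound abs_ge_self])
qed simp

lemma trace_fun_ends:
  assumes n: "n \<in> {1..N}" shows "trace_fun n (- 1) = pi / 2" "trace_fun n 1 = - pi / 2"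
proof -
  have "step (2 * (t - a n)\<^sup>2 / r\<^sup>2) = 1" if "r \<le> \<bar>t - a n\<bar>" for t
  proof (rule step_eq_1)
    have "r\<^sup>2 \<le> \<bar>t - a n\<bar>\<^sup>2" using that r by (intro power_mono) auto
    then show "2 \<le> 2 * (t - a n)\<^sup>2 / r\<^sup>2" using r by (simp add: pos_le_divide_eq)
  qed
  moreover have "r \<le> \<bar>- 1 - a n\<bar>" "r \<le> \<bar>1 - a n\<bar>" "- 1 < a n" "a n < 1"
    using ends[OF n] r R by auto
  ultimately show "trace_fun n (- 1) = pi / 2" "trace_fun n 1 = - pi / 2"
    by (simp_all add: trace_fun_def)
qed

lemma integral_trace_deriv:
  assumes n: "n \<in> {1..N}" shows "(LINT s:{-1..1}|lborel. trace_deriv n s) = - pi"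
proof -
  have "set_integrable lborel {-1..1} (trace_deriv n)"
    unfolding set_integrable_def by (rule integrable_mult_indicator[OF _ integrable_trace_deriv]) simp
  from set_integral_FTC_Icc[OF _ trace_fun_deriv this] show ?thesis
    by (simp add: trace_fun_ends[OF n])
qed

text \<open>Near \<open>a n\<close> the trace differs from \<open>\<plusminus>\<pi>/2\<close>, which is harmless because \<open>g\<close> attains \<open>d\<close> there
  to second order.\<close>

lemma trace_integral:
  fixes f g :: "real \<Rightarrow> real"
  assumes n: "n \<in> {1..N}"
    and f: "integrable lborel f" "\<And>t. t \<notin> {-1..1} \<Longrightarrow> f t = 0" "(\<integral>t. f t \<partial>lborel) = 0"
    and g: "\<And>x. x \<in> {-1..1} \<Longrightarrow> g x = g (- 1) + (\<integral>t. indicator {-1..x} t * f t \<partial>lborel)"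
    and E: "0 \<le> E" "\<And>x. x \<in> {-1..1} \<Longrightarrow> \<bar>g x - d\<bar> \<le> E * \<bar>x - a n\<bar>"
  shows "integrable lborel (\<lambda>t. f t * trace_fun n t)"
    and "\<bar>(\<integral>t. f t * trace_fun n t \<partial>lborel) - pi * (d - g (- 1))\<bar> \<le> 4 * pi / step_mass * (r * E)"
proof -
  have [measurable]: "f \<in> borel_measurable borel" using f(1) by auto
  let ?T = "trace_deriv n"
  have T: "integrable lborel (\<lambda>s. indicator {-1..1} s * ?T s)"
    using integrable_mult_indicator[OF _ integrable_trace_deriv, of "{-1..1}" n] by simp
  \<comment> \<open>Fubini on the triangle t <= s acts as integration by parts for g, which is only
    the primitive of an integrable f.\<close>
  define Q where "Q t s = f t * (indicator {-1..1} s * ?T s) * indicator {p. fst p \<le> snd p} (t, s)" for t s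
  have [measurable]: "{p::real \<times> real. fst p \<le> snd p} \<in> sets borel"
    by (intro borel_closed closed_Collect_le continuous_intros)
  have [measurable]: "(\<lambda>p. Q (fst p) (snd p)) \<in> borel_measurable (lborel \<Otimes>\<^sub>M lborel)"
    unfolding Q_def by simp
  have prod: "integrable (lborel \<Otimes>\<^sub>M lborel) (\<lambda>p. f (fst p) * (indicator {-1..1} (snd p) * ?T (snd p)))"
    by (rule lborel_pair_integrable_mult[OF f(1) T])
  have Q: "integrable (lborel \<Otimes>\<^sub>M lborel) (\<lambda>p. Q (fst p) (snd p))"
    by (rule Bochner_Integration.integrable_bound[OF prod]) (auto simp: Q_def split: split_indicator)
  have in1: "(\<integral>s. Q t s \<partial>lborel) = f t * (- pi / 2 - trace_fun n t)" for t
  proof (cases "t \<in> {-1..1}")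
    case True
    have "(\<integral>s. Q t s \<partial>lborel) = (\<integral>s. f t * (indicator {t..1} s * ?T s) \<partial>lborel)"
      using True by (intro Bochner_Integration.integral_cong) (auto simp: Q_def split: split_indicator)
    also have "\<dots> = f t * (LINT s:{t..1}|lborel. ?T s)"
      by (simp add: set_lebesgue_integral_def)
    also have "(LINT s:{t..1}|lborel. ?T s) = trace_fun n 1 - trace_fun n t"
    proof (rule set_integral_FTC_Icc[OF _ trace_fun_deriv])
      show "set_integrable lborel {t..1} (trace_deriv n)"
        unfolding set_integrable_def by (rule integrable_mult_indicator[OF _ integrable_trace_deriv]) simp
    qed (use True in auto)
    finally show ?thesis by (simp add: trace_fun_ends[OF n])
  qed (simp add: Q_def f(2))
  have in2: "(\<integral>t. Q t s \<partial>lborel) = indicator {-1..1} s * ?T s * (g s - g (- 1))" for s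
  proof (cases "s \<in> {-1..1}")
    case True
    have "(\<integral>t. Q t s \<partial>lborel) = (\<integral>t. ?T s * (indicator {-1..s} t * f t) \<partial>lborel)"
    proof (rule Bochner_Integration.integral_cong[OF refl])
      fix t show "Q t s = ?T s * (indicator {-1..s} t * f t)"
        using True f(2)[of t] by (cases "t \<in> {-1..1}") (auto simp: Q_def split: split_indicator)
    qed
    then show ?thesis using g[OF True] True by simp
  qed (simp add: Q_def)
  have iT: "integrable lborel (\<lambda>t. f t * (- pi / 2 - trace_fun n t))"
    using lborel_pair.integrable_fst[of Q] Q in1 by (simp add: split_def)
  then have "integrable lborel (\<lambda>t. (- pi / 2) * f t - f t * (- pi / 2 - trace_fun n t))"
    using f(1) by (intro Bochner_Integration.integrable_diff) auto
  then show int: "integrable lborel (\<lambda>t. f t * trace_fun n t)" by (simp add: algebra_simps)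
  have "(\<integral>t. f t * (- pi / 2 - trace_fun n t) \<partial>lborel) = (\<integral>s. indicator {-1..1} s * ?T s * (g s - g (- 1)) \<partial>lborel)"
    unfolding in1[symmetric] in2[symmetric]
    by (rule lborel_pair.Fubini_integral[symmetric]) (use Q in \<open>simp add: split_def\<close>)
  moreover have "(\<integral>t. f t * (- pi / 2 - trace_fun n t) \<partial>lborel) = - (\<integral>t. f t * trace_fun n t \<partial>lborel)"
  proof -
    have "(\<integral>t. f t * (- pi / 2 - trace_fun n t) \<partial>lborel) = (\<integral>t. (- pi / 2) * f t - f t * trace_fun n t \<partial>lborel)"
      by (intro Bochner_Integration.integral_cong) (auto simp: algebra_simps)
    also have "\<dots> = (\<integral>t. (- pi / 2) * f t \<partial>lborel) - (\<integral>t. f t * trace_fun n t \<partial>lborel)"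
      using f(1) int by (intro Bochner_Integration.integral_diff) auto
    finally show ?thesis using f(3) by simp
  qed
  ultimately have eq: "(\<integral>t. f t * trace_fun n t \<partial>lborel) = - (\<integral>s. indicator {-1..1} s * ?T s * (g s - g (- 1)) \<partial>lborel)"
    by simp
  have i2: "integrable lborel (\<lambda>s. indicator {-1..1} s * ?T s * (g s - g (- 1)))"
    using lborel_pair.integrable_snd[of Q] Q in2 by (simp add: split_def)
  \<comment> \<open>Splitting g s - g (-1) into (g s - d) + (d - g (-1)) isolates the main term,
    because \<open>trace_deriv n\<close> has total integral -pi.\<close>
  have i3: "integrable lborel (\<lambda>s. indicator {-1..1} s * ?T s * (g s - d))"
  proof -
    have "integrable lborel (\<lambda>s. indicator {-1..1} s * ?T s * (g s - g (- 1)) - (d - g (- 1)) * (indicator {-1..1} s * ?T s))"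
      using i2 T by (intro Bochner_Integration.integrable_diff) auto
    then show ?thesis by (simp add: algebra_simps)
  qed
  have "(\<integral>s. indicator {-1..1} s * ?T s * (g s - g (- 1)) \<partial>lborel)
     = (\<integral>s. indicator {-1..1} s * ?T s * (g s - d) + (d - g (- 1)) * (indicator {-1..1} s * ?T s) \<partial>lborel)"
    by (intro Bochner_Integration.integral_cong) (auto simp: algebra_simps)
  also have "\<dots> = (\<integral>s. indicator {-1..1} s * ?T s * (g s - d) \<partial>lborel) + (d - g (- 1)) * (\<integral>s. indicator {-1..1} s * ?T s \<partial>lborel)"
    using i3 T by (subst Bochner_Integration.integral_add) auto
  also have "(\<integral>s. indicator {-1..1} s * ?T s \<partial>lborel) = - pi"
    using integral_trace_deriv[OF n] by (simp add: set_lebesgue_integral_def)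
  finally have diff: "(\<integral>t. f t * trace_fun n t \<partial>lborel) - pi * (d - g (- 1)) = - (\<integral>s. indicator {-1..1} s * ?T s * (g s - d) \<partial>lborel)"
    unfolding eq by simp
  \<comment> \<open>The derivative of the trace is at most 2 pi / (step_mass r), and |g - d| is at
    most E r, on an interval of length 2 r; one factor r survives.\<close>
  let ?C = "2 * pi / step_mass / r * (E * r)"
  have "\<bar>\<integral>s. indicator {-1..1} s * ?T s * (g s - d) \<partial>lborel\<bar> \<le> (\<integral>s. ?C * indicator {a n - r..a n + r} s \<partial>lborel)"
  proof (rule order_trans[OF integral_abs_bound], rule integral_mono)
    show "integrable lborel (\<lambda>s. \<bar>indicator {-1..1} s * ?T s * (g s - d)\<bar>)" using i3 by auto
    show "integrable lborel (\<lambda>s. ?C * indicator {a n - r..a n + r} s)"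
      using r by (intro integrable_mult_right integrable_real_indicator) auto
    fix s
    show "\<bar>indicator {-1..1} s * ?T s * (g s - d)\<bar> \<le> ?C * indicator {a n - r..a n + r} s"
    proof (cases "s \<in> {-1..1} \<and> s \<in> {a n - r..a n + r}")
      case True
      then have "\<bar>s - a n\<bar> \<le> r" by (auto simp: abs_le_iff)
      then have "\<bar>g s - d\<bar> \<le> E * r" using E True by (meson mult_left_mono order_trans)
      moreover have "\<bar>?T s\<bar> \<le> 2 * pi / step_mass / r" using trace_deriv_bound[of n s] True by simp
      ultimately have "\<bar>?T s\<bar> * \<bar>g s - d\<bar> \<le> ?C" using step_mass_pos r by (intro mult_mono) auto
      then show ?thesis using True by (simp add: abs_mult)
    next
      case False
      then have "indicator {-1..1} s * ?T s = 0" using trace_deriv_bound[of n s] by (auto split: split_indicator)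
      moreover have "0 \<le> ?C * indicator {a n - r..a n + r} s"
        using step_mass_pos r E(1) by (intro mult_nonneg_nonneg divide_nonneg_nonneg) auto
      ultimately show ?thesis by (simp only: mult_zero_left abs_zero)
    qed
  qed
  also have "\<dots> = 4 * pi / step_mass * (r * E)" using r by simp
  finally show "\<bar>(\<integral>t. f t * trace_fun n t \<partial>lborel) - pi * (d - g (- 1))\<bar> \<le> 4 * pi / step_mass * (r * E)"
    unfolding diff by simp
qed

end

section \<open>Comparison of the energies\<close>

lemma nn_integral_eq_set_integral:
  fixes h :: "complex \<Rightarrow> real"
  assumes "set_integrable lborel A h" "\<And>z. 0 \<le> h z"
  shows "(\<integral>\<^sup>+z. ennreal (h z) * indicator A z \<partial>lborel) = ennreal (LINT z:A|lborel. h z)"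
proof -
  have "(\<integral>\<^sup>+z. ennreal (h z) * indicator A z \<partial>lborel) = (\<integral>\<^sup>+z. ennreal (indicator A z *\<^sub>R h z) \<partial>lborel)"
    by (intro nn_integral_cong) (auto split: split_indicator)
  also have "\<dots> = ennreal (LINT z:A|lborel. h z)"
    using assms unfolding set_lebesgue_integral_def set_integrable_def by (intro nn_integral_eq_integral) auto
  finally show ?thesis .
qed

lemma set_integrable_nn_bound:
  fixes h :: "complex \<Rightarrow> real"
  assumes "(\<lambda>z. indicator A z *\<^sub>R h z) \<in> borel_measurable borel" "\<And>z. 0 \<le> h z" "0 \<le> K"
    and le: "(\<integral>\<^sup>+z. ennreal (h z) * indicator A z \<partial>lborel) \<le> ennreal K"
  shows "set_integrable lborel A h" "(LINT z:A|lborel. h z) \<le> K"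
proof -
  have "(\<integral>\<^sup>+z. ennreal (norm (indicator A z *\<^sub>R h z)) \<partial>lborel) = (\<integral>\<^sup>+z. ennreal (h z) * indicator A z \<partial>lborel)"
    using assms(2) by (intro nn_integral_cong) (auto split: split_indicator)
  also have "\<dots> < \<infinity>" using le by (auto intro: le_less_trans)
  finally show i: "set_integrable lborel A h"
    unfolding set_integrable_def using assms(1) by (intro integrableI_bounded) auto
  from le show "(LINT z:A|lborel. h z) \<le> K"
    unfolding nn_integral_eq_set_integral[OF i assms(2)] using assms(3) by simp
qed

lemma A_set_rho_bounds:
  assumes a: "a \<in> A_set N" and R: "R \<le> rho N a" and N: "1 \<le> N" and R0: "0 < R"
  shows "n \<in> {1..N} \<Longrightarrow> R \<le> 1 - \<bar>a n\<bar>"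
    and "n \<in> {1..N} \<Longrightarrow> k \<in> {1..N} \<Longrightarrow> n \<noteq> k \<Longrightarrow> 2 * R \<le> \<bar>a n - a k\<bar>"
proof -
  let ?S = "{2 * a 1 + 2, 2 - 2 * a N} \<union> {a (Suc n) - a n | n. 1 \<le> n \<and> n < N}"
  have "{a (Suc n) - a n | n. 1 \<le> n \<and> n < N} = (\<lambda>n. a (Suc n) - a n) ` {1..<N}" by auto
  then have fin: "finite ?S" by simp
  have S: "2 * R \<le> x" if "x \<in> ?S" for x
  proof -
    have "Min ?S \<le> x" using fin that by (rule Min_le)
    moreover have "2 * R \<le> Min ?S" using R unfolding rho_def by linarith
    ultimately show ?thesis by linarith
  qed
  have mono: "a n + 2 * R * real (k - n) \<le> a k" if "1 \<le> n" "n \<le> k" "k \<le> N" for n k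
    using that(2,3)
  proof (induction k rule: dec_induct)
    case (step k)
    have "2 * R \<le> a (Suc k) - a k"
      by (intro S UnI2 CollectI exI[of _ k] conjI) (use step that(1) in auto)
    then show ?case using step by (simp add: Suc_diff_le algebra_simps)
  qed simp
  have 1: "2 * R \<le> 2 * a 1 + 2" "2 * R \<le> 2 - 2 * a N" using S by auto
  show "R \<le> 1 - \<bar>a n\<bar>" if n: "n \<in> {1..N}"
  proof -
    have "a 1 \<le> a n" "a n \<le> a N"
      using mono[of 1 n] mono[of n N] n R0 by (auto intro: order_trans[rotated] simp: add_increasing2)
    then show ?thesis using 1 by (auto simp: abs_if)
  qed
  have less: "2 * R \<le> a k - a n" if "n \<in> {1..N}" "k \<in> {1..N}" "n < k" for n k
  proof -
    have "2 * R * 1 \<le> 2 * R * real (k - n)" using that R0 by (intro mult_left_mono) auto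
    then show ?thesis using mono[of n k] that by auto
  qed
  show "2 * R \<le> \<bar>a n - a k\<bar>" if "n \<in> {1..N}" "k \<in> {1..N}" "n \<noteq> k"
    using less[of n k] less[of k n] that by (cases "n < k") auto
qed

section \<open>The magnetization and its boundary charge\<close>

text \<open>\<open>closed_loop\<close> concerns the first component only; it is what makes the
  charge have mean zero.\<close>

locale magnetization =
  fixes m m' :: "real \<Rightarrow> complex"
  assumes W: "W12_S1 m m'" and closed_loop: "Re (m (- 1)) = Re (m 1)"
begin

definition charge :: "real \<Rightarrow> real" where
  "charge t = indicator {-1..1} t * Re (m' t)"

definition Eint :: real where
  "Eint = (LINT x:{-1..1}|lborel. (cmod (m' x))\<^sup>2)"

lemma int_m': "integrable lborel (\<lambda>t. indicator {-1..1} t *\<^sub>R m' t)"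
  and int_m'2: "integrable lborel (\<lambda>t. indicator {-1..1} t *\<^sub>R (cmod (m' t))\<^sup>2)"
  and m_norm: "\<And>x. x \<in> {-1..1} \<Longrightarrow> cmod (m x) = 1"
  and m_eq: "\<And>x. x \<in> {-1..1} \<Longrightarrow> m x = m (- 1) + (LINT t:{-1..x}|lborel. m' t)"
  using W unfolding W12_S1_def set_integrable_def by blast+

lemma Eint_nonneg: "0 \<le> Eint"
  unfolding Eint_def set_lebesgue_integral_def by (rule integral_nonneg_AE) auto

lemma integrable_charge: "integrable lborel charge"
  using integrable_Re[OF int_m'] by (simp add: charge_def[abs_def])

lemma Re_m: "x \<in> {-1..1} \<Longrightarrow> Re (m x) = Re (m (- 1)) + (\<integral>t. indicator {-1..x} t * charge t \<partial>lborel)"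
proof -
  assume x: "x \<in> {-1..1}"
  have sub: "indicator {-1..x} t *\<^sub>R (indicator {-1..1} t *\<^sub>R m' t) = indicator {-1..x} t *\<^sub>R m' t" for t
    using x by (auto split: split_indicator)
  have i: "integrable lborel (\<lambda>t. indicator {-1..x} t *\<^sub>R m' t)"
    using integrable_mult_indicator[OF _ int_m', of "{-1..x}"] unfolding sub by simp
  have "Re (LINT t:{-1..x}|lborel. m' t) = (\<integral>t. Re (indicator {-1..x} t *\<^sub>R m' t) \<partial>lborel)"
    unfolding set_lebesgue_integral_def by (rule integral_Re[symmetric]) (rule i)
  also have "\<dots> = (\<integral>t. indicator {-1..x} t * charge t \<partial>lborel)"
    using x by (intro Bochner_Integration.integral_cong) (auto simp: charge_def split: split_indicator)
  finally show ?thesis using m_eq[OF x] by simp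
qed

sublocale boundary_charge charge
proof
  show "integrable lborel charge" by (rule integrable_charge)
  have [measurable]: "charge \<in> borel_measurable borel" using integrable_charge by auto
  show "integrable lborel (\<lambda>t. (charge t)\<^sup>2)"
  proof (rule Bochner_Integration.integrable_bound[OF int_m'2])
    show "AE t in lborel. norm ((charge t)\<^sup>2) \<le> norm (indicator {-1..1} t *\<^sub>R (cmod (m' t))\<^sup>2)"
      by (intro AE_I2) (auto simp: charge_def cmod_power2 split: split_indicator)
  qed simp
  show "charge t = 0" if "t \<notin> {-1..1}" for t using that by (simp add: charge_def)
  have "(\<lambda>t. indicator {-1..1} t * charge t) = charge" by (auto simp: charge_def fun_eq_iff split: split_indicator)
  then show "(\<integral>t. charge t \<partial>lborel) = 0" using Re_m[of 1] closed_loop by simp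
qed

lemma is_stray: "is_stray_potential m' pot"
  by (rule is_stray_potential_pot) (simp add: charge_def)

lemma U_eq: "U m' = pot"
  by (rule U_eqI[OF is_stray])

lemma grad_U: "z \<in> upper_half \<Longrightarrow> grad (U m') z = field z"
  unfolding U_eq by (rule grad_eqI[OF pot_has_derivative])

lemma energy_eq: "energy \<epsilon> m' = \<epsilon> / 2 * Eint + 1 / 2 * (LINT z:upper_half|lborel. (cmod (field z))\<^sup>2)"
proof -
  have "(LINT z:upper_half|lborel. (norm (grad (U m') z))\<^sup>2) = (LINT z:upper_half|lborel. (cmod (field z))\<^sup>2)"
    by (intro set_lebesgue_integral_cong) (auto simp: grad_U)
  then show ?thesis by (simp add: energy_def Eint_def)
qed

lemma m_diff_square:
  assumes x: "x \<in> {-1..1}" and y: "y \<in> {-1..1}" and xy: "x < y"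
  shows "(cmod (m y - m x))\<^sup>2 \<le> (y - x) * Eint"
proof -
  define h where "h t = indicator {x..y} t * cmod (m' t)" for t
  have sub: "indicator {-1..s} t *\<^sub>R (indicator {-1..1} t *\<^sub>R m' t) = indicator {-1..s} t *\<^sub>R m' t" if "s \<le> 1" for s t
    using that by (auto split: split_indicator)
  have i: "integrable lborel (\<lambda>t. indicator {-1..s} t *\<^sub>R m' t)" if "s \<le> 1" for s
    using integrable_mult_indicator[OF _ int_m', of "{-1..s}"] unfolding sub[OF that] by simp
  have h: "integrable lborel h"
  proof -
    have "integrable lborel (\<lambda>t. indicator {x..y} t *\<^sub>R norm (indicator {-1..1} t *\<^sub>R m' t))"
      by (rule integrable_mult_indicator[OF _ integrable_norm[OF int_m']]) simp
    also have "(\<lambda>t. indicator {x..y} t *\<^sub>R norm (indicator {-1..1} t *\<^sub>R m' t)) = h"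
      using x y by (auto simp: h_def fun_eq_iff split: split_indicator)
    finally show ?thesis .
  qed
  have h2: "integrable lborel (\<lambda>t. (h t)\<^sup>2)"
  proof -
    have "integrable lborel (\<lambda>t. indicator {x..y} t *\<^sub>R (indicator {-1..1} t *\<^sub>R (cmod (m' t))\<^sup>2))"
      by (rule integrable_mult_indicator[OF _ int_m'2]) simp
    also have "(\<lambda>t. indicator {x..y} t *\<^sub>R (indicator {-1..1} t *\<^sub>R (cmod (m' t))\<^sup>2)) = (\<lambda>t. (h t)\<^sup>2)"
      using x y by (auto simp: h_def fun_eq_iff split: split_indicator)
    finally show ?thesis .
  qed
  have h2E: "(\<integral>t. (h t)\<^sup>2 \<partial>lborel) \<le> Eint"
    unfolding Eint_def set_lebesgue_integral_def
    by (rule integral_mono[OF h2 int_m'2]) (use x y in \<open>auto simp: h_def split: split_indicator\<close>)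
  define I where "I = (\<integral>t. h t \<partial>lborel)"
  have I0: "0 \<le> I" unfolding I_def by (rule integral_nonneg_AE) (auto simp: h_def)
  have "cmod (m y - m x) \<le> I"
  proof -
    have "m y - m x = (\<integral>t. indicator {-1..y} t *\<^sub>R m' t - indicator {-1..x} t *\<^sub>R m' t \<partial>lborel)"
      using m_eq[OF x] m_eq[OF y] i[of x] i[of y] x y
      by (simp add: set_lebesgue_integral_def Bochner_Integration.integral_diff)
    also have "cmod \<dots> \<le> I" unfolding I_def
    proof (rule order_trans[OF integral_norm_bound], rule integral_mono)
      show "integrable lborel (\<lambda>t. cmod (indicator {-1..y} t *\<^sub>R m' t - indicator {-1..x} t *\<^sub>R m' t))"
        using i[of x] i[of y] x y by (intro integrable_norm Bochner_Integration.integrable_diff) auto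
      show "cmod (indicator {-1..y} t *\<^sub>R m' t - indicator {-1..x} t *\<^sub>R m' t) \<le> h t" for t
        using x y xy by (auto simp: h_def split: split_indicator)
    qed (rule h)
    finally show ?thesis .
  qed
  then have "(cmod (m y - m x))\<^sup>2 \<le> I\<^sup>2" by (intro power_mono) auto
  also have "I\<^sup>2 \<le> (y - x) * (\<integral>t. (h t)\<^sup>2 \<partial>lborel)"
  proof -
    \<comment> \<open>The mean of \<open>h\<close> over the interval, the value for which
      nonnegativity of the integral of (h - l)^2 becomes the Cauchy-Schwarz inequality.\<close>
    define l where "l = I / (y - x)"
    have ind: "integrable lborel (\<lambda>t. l\<^sup>2 * indicator {x..y} t)"
      using xy by (intro integrable_mult_right integrable_real_indicator) auto
    have "0 \<le> (\<integral>t. (h t - l * indicator {x..y} t)\<^sup>2 \<partial>lborel)" by (rule integral_nonneg_AE) auto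
    also have "(\<lambda>t. (h t - l * indicator {x..y} t)\<^sup>2) = (\<lambda>t. (h t)\<^sup>2 - 2 * l * h t + l\<^sup>2 * indicator {x..y} t)"
      by (auto simp: fun_eq_iff h_def power2_diff power2_eq_square algebra_simps split: split_indicator)
    also have "(\<integral>t. (h t)\<^sup>2 - 2 * l * h t + l\<^sup>2 * indicator {x..y} t \<partial>lborel) = (\<integral>t. (h t)\<^sup>2 \<partial>lborel) - 2 * l * I + l\<^sup>2 * (y - x)"
      using h h2 ind xy by (simp add: I_def)
    also have "\<dots> = (\<integral>t. (h t)\<^sup>2 \<partial>lborel) - I\<^sup>2 / (y - x)"
      using xy by (simp add: l_def power2_eq_square)
    finally show ?thesis using xy by (simp add: field_simps)
  qed
  also have "\<dots> \<le> (y - x) * Eint" using h2E xy by (intro mult_left_mono) auto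
  finally show ?thesis .
qed

text \<open>On the unit circle, with m b = d, one has |m x - m b|^2 = 2 |Re (m x) - d|, so the
  Hoelder bound of exponent 1/2 for m becomes a linear bound for its first component.\<close>

lemma Re_m_near_pole:
  assumes x: "x \<in> {-1..1}" and b: "b \<in> {-1..1}" and d: "Re (m b) = d" "d \<in> {-1, 1}"
  shows "\<bar>Re (m x) - d\<bar> \<le> Eint / 2 * \<bar>x - b\<bar>"
proof -
  have "(cmod (m b))\<^sup>2 = 1" using m_norm[OF b] by simp
  then have "Im (m b) = 0" using d by (auto simp: cmod_power2)
  then have mb: "m b = of_real d" using d(1) by (simp add: complex_eq_iff)
  have mx: "(Re (m x))\<^sup>2 + (Im (m x))\<^sup>2 = 1" using m_norm[OF x] by (simp flip: cmod_power2)
  have d2: "d\<^sup>2 = 1" using d(2) by auto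
  have "(cmod (m x - m b))\<^sup>2 = (Re (m x))\<^sup>2 + (Im (m x))\<^sup>2 - 2 * d * Re (m x) + d\<^sup>2"
    by (simp add: mb cmod_power2 power2_diff)
  also have "\<dots> = 2 - 2 * d * Re (m x)" by (simp add: mx d2)
  also have "\<dots> = 2 * \<bar>Re (m x) - d\<bar>"
    using d(2) abs_Re_le_cmod[of "m x"] m_norm[OF x] by auto
  finally have eq: "2 * \<bar>Re (m x) - d\<bar> = (cmod (m x - m b))\<^sup>2" by simp
  have "(cmod (m x - m b))\<^sup>2 \<le> \<bar>x - b\<bar> * Eint"
    using m_diff_square[OF x b] m_diff_square[OF b x]
    by (cases x b rule: linorder_cases) (auto simp: norm_minus_commute)
  then show ?thesis using eq by (simp add: mult.commute)
qed

end

context wall_profile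
begin

text \<open>Each wall contributes c n times pi c n, with at most twice the error of
  \<open>trace_integral\<close> for E = Eint / 2. The constants arcsin (a n) in the trace pair to
  zero with a charge of mean zero.\<close>

lemma pairing_lower_bound:
  assumes m: "magnetization m m'" and d: "\<And>n. n \<in> {1..N} \<Longrightarrow> d n \<in> {-1, 1}"
    and md: "\<And>n. n \<in> {1..N} \<Longrightarrow> Re (m (a n)) = d n" and c: "\<And>n. n \<in> {1..N} \<Longrightarrow> c n = d n - Re (m (- 1))"
  shows "pi * (\<Sum>n=1..N. (c n)\<^sup>2) - 4 * pi * real N / step_mass * (r * magnetization.Eint m')
     \<le> (LINT z:upper_half|lborel. boundary_charge.field (magnetization.charge m') z \<bullet> G z)"
proof -
  interpret magnetization m m' by (rule m)
  obtain K where K: "\<And>t. t \<in> {-1..1} \<Longrightarrow>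
      (\<integral>\<^sup>+z. ennreal (cmod (G z) / cmod (z - of_real t)) * indicator upper_half z \<partial>lborel) \<le> ennreal K"
    using G_kernel_bound by blast
  have an: "a n \<in> {-1..1}" if "n \<in> {1..N}" for n using abs_a[OF that] by (auto simp: abs_less_iff)
  let ?T = "\<lambda>n. \<integral>t. charge t * trace_fun n t \<partial>lborel"
  have T: "integrable lborel (\<lambda>t. charge t * trace_fun n t) \<and>
     \<bar>?T n - pi * (d n - Re (m (- 1)))\<bar> \<le> 4 * pi / step_mass * (r * (Eint / 2))" if n: "n \<in> {1..N}" for n
  proof -
    have E: "\<bar>Re (m x) - d n\<bar> \<le> Eint / 2 * \<bar>x - a n\<bar>" if "x \<in> {-1..1}" for x
      by (rule Re_m_near_pole[OF that an[OF n] md[OF n] d[OF n]])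
    have "0 \<le> Eint / 2" using Eint_nonneg by simp
    from trace_integral[OF n integrable_charge supp mean_zero Re_m this E]
    show ?thesis by blast
  qed
  have Ti: "integrable lborel (\<lambda>t. charge t * trace_fun n t)"
    and Tb: "\<bar>?T n - pi * c n\<bar> \<le> 4 * pi / step_mass * (r * (Eint / 2))" if n: "n \<in> {1..N}" for n
    using T[OF n] c[OF n] by auto
  have "(LINT z:upper_half|lborel. field z \<bullet> G z) = (\<integral>t. charge t * \<zeta>0 t \<partial>lborel)"
    by (rule pairing[OF G_has_derivative continuous_on_G K \<zeta>_tendsto_real \<zeta>_tendsto_infinity])
  also have "\<dots> = (\<integral>t. (\<Sum>n=1..N. c n * (charge t * trace_fun n t) - c n * arcsin (a n) * charge t) \<partial>lborel)"
    by (intro Bochner_Integration.integral_cong) (auto simp: \<zeta>0_def sum_distrib_left algebra_simps)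
  also have "\<dots> = (\<Sum>n=1..N. (\<integral>t. c n * (charge t * trace_fun n t) - c n * arcsin (a n) * charge t \<partial>lborel))"
    by (rule Bochner_Integration.integral_sum) (use Ti integrable_charge in auto)
  also have "\<dots> = (\<Sum>n=1..N. c n * ?T n)"
  proof (rule sum.cong[OF refl])
    fix n assume n: "n \<in> {1..N}"
    have "(\<integral>t. c n * (charge t * trace_fun n t) - c n * arcsin (a n) * charge t \<partial>lborel)
       = (\<integral>t. c n * (charge t * trace_fun n t) \<partial>lborel) - (\<integral>t. c n * arcsin (a n) * charge t \<partial>lborel)"
      using Ti[OF n] integrable_charge by (intro Bochner_Integration.integral_diff) auto
    then show "(\<integral>t. c n * (charge t * trace_fun n t) - c n * arcsin (a n) * charge t \<partial>lborel) = c n * ?T n"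
      using mean_zero by simp
  qed
  also have "\<dots> \<ge> (\<Sum>n=1..N. pi * (c n)\<^sup>2 - 4 * pi / step_mass * (r * Eint))"
  proof (rule sum_mono)
    fix n assume n: "n \<in> {1..N}"
    have "\<bar>c n\<bar> * \<bar>?T n - pi * c n\<bar> \<le> 2 * (4 * pi / step_mass * (r * (Eint / 2)))"
      by (rule mult_mono[OF coeff[OF n] Tb[OF n]]) auto
    then have "\<bar>c n * ?T n - pi * (c n)\<^sup>2\<bar> \<le> 4 * pi / step_mass * (r * Eint)"
      by (simp add: power2_eq_square algebra_simps flip: abs_mult)
    then show "pi * (c n)\<^sup>2 - 4 * pi / step_mass * (r * Eint) \<le> c n * ?T n" by linarith
  qed
  finally show ?thesis by (simp add: sum_subtractf sum_distrib_left mult_ac)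
qed

end

text \<open>With x = ln (1/\<epsilon>) and \<delta> = \<epsilon> x one has ln (1/\<delta>) = x - ln
  x, and ln x <= x/2. The pairing error carries ln (1/\<epsilon>), while the estimate is measured in
  ln (1/\<delta>); this comparison links them.\<close>

lemma ln_inverse_mult_ln_inverse_ge:
  fixes \<epsilon> :: real
  assumes "0 < \<epsilon>" "\<epsilon> \<le> 1 / 2"
  shows "0 < ln (1 / \<epsilon>)" "0 < \<epsilon> * ln (1 / \<epsilon>)" "ln (1 / \<epsilon>) \<le> 2 * ln (1 / (\<epsilon> * ln (1 / \<epsilon>)))"
proof -
  let ?x = "ln (1 / \<epsilon>)"
  have "1 < 1 / \<epsilon>" using assms by simp
  then show x: "0 < ?x" by (rule ln_gt_zero)
  then show "0 < \<epsilon> * ?x" using assms by simp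
  have "ln (?x / 2) \<le> ?x / 2 - 1" using x by (intro ln_le_minus_one) simp
  moreover have "ln (?x / 2) = ln ?x - ln 2" using x by (simp add: ln_div)
  moreover have "ln 2 \<le> (1::real)" using ln_le_minus_one[of 2] by simp
  ultimately have "ln ?x \<le> ?x / 2" by linarith
  moreover have "ln (1 / (\<epsilon> * ?x)) = ?x - ln ?x"
  proof -
    have "ln (1 / \<epsilon> / ?x) = ln (1 / \<epsilon>) - ln ?x" by (subst ln_div) (use x assms in auto)
    then show ?thesis by (simp only: divide_divide_eq_left)
  qed
  ultimately show "?x \<le> 2 * ln (1 / (\<epsilon> * ?x))" by linarith
qed

lemma set_integral_norm_diff_square:
  fixes F G :: "complex \<Rightarrow> complex"
  assumes F: "(\<lambda>z. indicator A z *\<^sub>R F z) \<in> borel_measurable borel" "set_integrable lborel A (\<lambda>z. (cmod (F z))\<^sup>2)"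
    and G: "(\<lambda>z. indicator A z *\<^sub>R G z) \<in> borel_measurable borel" "set_integrable lborel A (\<lambda>z. (cmod (G z))\<^sup>2)"
  shows "set_integrable lborel A (\<lambda>z. (cmod (F z - k *\<^sub>R G z))\<^sup>2)"
    and "(LINT z:A|lborel. (cmod (F z - k *\<^sub>R G z))\<^sup>2) = (LINT z:A|lborel. (cmod (F z))\<^sup>2)
      - 2 * k * (LINT z:A|lborel. F z \<bullet> G z) + k\<^sup>2 * (LINT z:A|lborel. (cmod (G z))\<^sup>2)"
proof -
  note FG = set_integrable_inner_L2[OF F G]
  have eq: "(cmod (F z - k *\<^sub>R G z))\<^sup>2 = (cmod (F z))\<^sup>2 - 2 * k * (F z \<bullet> G z) + k\<^sup>2 * (cmod (G z))\<^sup>2" for z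
    unfolding power2_norm_eq_inner
    by (simp add: inner_diff_left inner_diff_right inner_commute[of "G z" "F z"] power2_eq_square algebra_simps)
  show "set_integrable lborel A (\<lambda>z. (cmod (F z - k *\<^sub>R G z))\<^sup>2)"
    unfolding eq by (intro set_integral_add(1) set_integral_diff(1) set_integrable_mult_right F G FG)
  show "(LINT z:A|lborel. (cmod (F z - k *\<^sub>R G z))\<^sup>2) = (LINT z:A|lborel. (cmod (F z))\<^sup>2)
      - 2 * k * (LINT z:A|lborel. F z \<bullet> G z) + k\<^sup>2 * (LINT z:A|lborel. (cmod (G z))\<^sup>2)"
    unfolding eq
    by (subst set_integral_add(2), intro set_integral_diff(1) set_integrable_mult_right F FG,
        intro set_integrable_mult_right G, subst set_integral_diff(2), rule F, intro set_integrable_mult_right FG, simp)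
qed

text \<open>\<open>D2\<close> and \<open>Z2\<close> are the energies of the stray field and of the truncated profile, \<open>P\<close> is their
  pairing, and \<open>X2\<close> is the exchange energy, which is absorbed in the last step.\<close>

lemma energy_balance:
  fixes L X2 D2 P Z2 Q2 g C0 C2 :: real
  assumes L: "0 < L" and X2: "0 \<le> X2" and Q2: "0 \<le> Q2"
    and upper: "X2 + D2 \<le> g / L + 2 * C0 / L\<^sup>2" and P: "g - L * X2 / 4 \<le> P" and Z2: "Z2 \<le> g * L + C2"
    and Q2_eq: "Q2 = D2 - 2 * (1 / L) * P + (1 / L)\<^sup>2 * Z2"
  shows "Q2 \<le> (2 * C0 + C2) / L\<^sup>2" "g / L - (2 * C0 + 2 * C2) / L\<^sup>2 \<le> D2"
proof -
  define u v w p q where "u = C0 / L\<^sup>2" and "v = C2 / L\<^sup>2" and "w = g / L"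
    and "p = 2 * (1 / L) * P" and "q = (1 / L)\<^sup>2 * Z2"
  note defs = u_def v_def w_def p_def q_def
  have "2 * (1 / L) * (g - L * X2 / 4) \<le> 2 * (1 / L) * P" using L P by (intro mult_left_mono) auto
  moreover have "2 * (1 / L) * (g - L * X2 / 4) = 2 * w - X2 / 2" using L by (simp add: defs right_diff_distrib)
  ultimately have a: "2 * w - X2 / 2 \<le> p" by (simp add: defs)
  have "(1 / L)\<^sup>2 * Z2 \<le> (1 / L)\<^sup>2 * (g * L + C2)" using Z2 by (intro mult_left_mono) auto
  also have "\<dots> = w + v" using L by (simp add: defs field_simps power2_eq_square)
  finally have b: "q \<le> w + v" by (simp add: defs)
  have up: "X2 + D2 \<le> w + 2 * u" using upper by (simp add: defs)
  have eq: "Q2 = D2 - p + q" using Q2_eq by (simp add: defs)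
  have s: "(2 * C0 + C2) / L\<^sup>2 = 2 * u + v" "g / L - (2 * C0 + 2 * C2) / L\<^sup>2 = w - (2 * u + 2 * v)"
    by (simp_all add: defs add_divide_distrib)
  \<comment> \<open>The pairing costs half of the exchange energy and the energy bound provides all
    of it, so the other half remains on the left.\<close>
  have c: "Q2 + X2 / 2 \<le> 2 * u + v" using a b up eq by linarith
  show "Q2 \<le> (2 * C0 + C2) / L\<^sup>2" unfolding s using X2 c by linarith
  \<comment> \<open>Q2 >= 0 gives D2 >= p - q, and the loss X2 / 2 contained in the bound for p is
    itself controlled by the preceding inequality.\<close>
  show "g / L - (2 * C0 + 2 * C2) / L\<^sup>2 \<le> D2" unfolding s using a b c eq Q2 by linarith
qed

text \<open>\<open>\<kappa>\<close> is chosen so that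
  \<open>32 * pi * real N / step_mass * \<kappa>\<close> is at most 1, which brings the pairing
  error down to L/4 times the exchange energy, as \<open>energy_balance\<close> requires.
  \<open>C2\<close> bounds \<open>g * ln (1 / \<kappa>) + reg_const\<close> by means of g <= 4 pi N.
  Both depend on N and R alone. The second estimate is the lower bound over the whole half plane
  minus the energy in the removed balls.\<close>

lemma wall_estimate:
  fixes N :: nat and R C0 \<alpha> :: real
  assumes N: "1 \<le> N" and R: "0 < R" "R \<le> 1 / 2" and C0: "0 < C0"
  defines "\<kappa> \<equiv> min (1 / 2) (step_mass / (32 * pi * real N))"
  defines "C2 \<equiv> 4 * pi * real N * ln (1 / \<kappa>) + \<bar>wall_profile.reg_const N R\<bar>"
  assumes a: "a \<in> A_set N" "R \<le> rho N a" and d: "\<forall>n\<in>{1..N}. d n \<in> {-1, 1}"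
    and \<epsilon>: "0 < \<epsilon>" "\<epsilon> \<le> 1 / 2" and \<delta>R: "\<epsilon> * ln (1 / \<epsilon>) \<le> R"
    and m: "in_M \<alpha> N a d m m'"
    and L_def: "L = ln (1 / (\<epsilon> * ln (1 / \<epsilon>)))" and g_def: "g = pi * (\<Sum>n=1..N. (d n - cos \<alpha>)\<^sup>2)"
    and energy: "energy \<epsilon> m' \<le> g / (2 * L) + C0 / L\<^sup>2"
  shows "(\<integral>\<^sup>+z. ennreal ((norm (grad (U m') z - grad (ustar \<alpha> N a d) z / of_real L))\<^sup>2)
              * indicator (Omega N (\<epsilon> * ln (1 / \<epsilon>)) a) z \<partial>lborel) \<le> ennreal ((2 * C0 + C2) / L\<^sup>2)"
    and "ennreal (g / L - (6 * C0 + 6 * C2) / L\<^sup>2)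
         \<le> (\<integral>\<^sup>+z. ennreal ((norm (grad (U m') z))\<^sup>2) * indicator (Omega N (\<epsilon> * ln (1 / \<epsilon>)) a) z \<partial>lborel)"
proof -
  define \<delta> where "\<delta> = \<epsilon> * ln (1 / \<epsilon>)"
  define c where "c n = d n - cos \<alpha>" for n
  have x: "0 < ln (1 / \<epsilon>)" and \<delta>: "0 < \<delta>" "\<delta> \<le> R" and xL: "ln (1 / \<epsilon>) \<le> 2 * L"
    using ln_inverse_mult_ln_inverse_ge[OF \<epsilon>] \<delta>R unfolding \<delta>_def L_def by auto
  have L: "0 < L" using x xL by linarith
  have \<kappa>: "0 < \<kappa>" "\<kappa> \<le> 1 / 2" using step_mass_pos N by (auto simp: \<kappa>_def)
  have \<kappa>c: "32 * pi * real N / step_mass * \<kappa> \<le> 1"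
  proof -
    have "32 * pi * real N / step_mass * \<kappa> \<le> 32 * pi * real N / step_mass * (step_mass / (32 * pi * real N))"
      unfolding \<kappa>_def using step_mass_pos by (intro mult_left_mono) auto
    also have "\<dots> = 1" using step_mass_pos N by simp
    finally show ?thesis .
  qed
  have cb: "\<bar>c n\<bar> \<le> 2" if "n \<in> {1..N}" for n
  proof -
    have "d n = - 1 \<or> d n = 1" using d that by auto
    then show ?thesis unfolding c_def
      by (elim disjE; intro abs_leI; insert cos_ge_minus_one[of \<alpha>] cos_le_one[of \<alpha>], linarith)
  qed
  interpret wall_profile N a c R "\<kappa> * \<delta>"
  proof
    show "0 < \<kappa> * \<delta>" using \<kappa> \<delta> by simp
    have "\<kappa> * \<delta> \<le> 1 / 2 * R" using \<kappa> \<delta> by (intro mult_mono) auto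
    then show "\<kappa> * \<delta> \<le> R / 2" by simp
  qed (use R cb A_set_rho_bounds[OF a N R(1)] in auto)
  have mm: "W12_S1 m m'" "Re (m (- 1)) = cos \<alpha>" "Re (m 1) = cos \<alpha>" "\<And>n. n \<in> {1..N} \<Longrightarrow> Re (m (a n)) = d n"
    using m by (auto simp: in_M_def)
  interpret magnetization m m' by unfold_locales (use mm in auto)
  have r: "0 < \<kappa> * \<delta>" using \<kappa> \<delta> by simp
  define X2 D2 P Z2 where "X2 = \<epsilon> * Eint" and "D2 = (LINT z:upper_half|lborel. (cmod (field z))\<^sup>2)"
    and "P = (LINT z:upper_half|lborel. field z \<bullet> G z)" and "Z2 = (LINT z:upper_half|lborel. (cmod (G z))\<^sup>2)"
  define k where "k = 1 / L"
  have g_eq: "g = pi * (\<Sum>n=1..N. (c n)\<^sup>2)" by (simp add: g_def c_def)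
  have gN: "0 \<le> g" "g \<le> 4 * pi * real N"
  proof -
    show "0 \<le> g" unfolding g_eq by (intro mult_nonneg_nonneg sum_nonneg) auto
    have "(\<Sum>n=1..N. (c n)\<^sup>2) \<le> (\<Sum>n=1..N. 4)"
      using power_mono[OF cb, of _ 2] by (intro sum_mono) auto
    then have "pi * (\<Sum>n=1..N. (c n)\<^sup>2) \<le> pi * (4 * real N)" by (intro mult_left_mono) auto
    then show "g \<le> 4 * pi * real N" unfolding g_eq by simp
  qed
  have l\<kappa>: "0 \<le> ln (1 / \<kappa>)" using \<kappa> by simp
  have gC2: "g * ln (1 / \<kappa>) + reg_const \<le> C2"
    unfolding C2_def using gN l\<kappa> by (intro add_mono mult_right_mono) auto
  have C2: "0 \<le> C2" unfolding C2_def using l\<kappa> by simp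
  have X2: "0 \<le> X2" using Eint_nonneg \<epsilon> by (simp add: X2_def)
  have upper: "X2 + D2 \<le> g / L + 2 * C0 / L\<^sup>2"
  proof -
    have "2 * (\<epsilon> / 2 * Eint + 1 / 2 * D2) \<le> 2 * (g / (2 * L) + C0 / L\<^sup>2)"
      using energy energy_eq[of \<epsilon>] by (simp add: D2_def)
    then show ?thesis by (simp add: X2_def distrib_left)
  qed
  have P: "g - L * X2 / 4 \<le> P"
  proof -
    \<comment> \<open>\<delta> times \<open>Eint\<close> is ln (1/\<epsilon>) times X2, and ln
      (1/\<epsilon>) is then replaced by 2 L; the factor 32 in \<open>\<kappa>\<close> leaves 2/8 =
      1/4.\<close>
    have "4 * pi * real N / step_mass * (\<kappa> * \<delta> * Eint) = (32 * pi * real N / step_mass * \<kappa>) * (ln (1 / \<epsilon>) * X2 / 8)"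
      by (simp add: \<delta>_def X2_def)
    also have "\<dots> \<le> 1 * (2 * L * X2 / 8)"
      using \<kappa>c xL X2 x \<kappa>(1) step_mass_pos by (intro mult_mono divide_right_mono mult_right_mono) auto
    finally have "4 * pi * real N / step_mass * (\<kappa> * \<delta> * Eint) \<le> L * X2 / 4" by simp
    moreover have "g - 4 * pi * real N / step_mass * (\<kappa> * \<delta> * Eint) \<le> P"
      unfolding g_eq P_def
      by (rule pairing_lower_bound) (use d mm magnetization_axioms in \<open>auto simp: c_def\<close>)
    ultimately show ?thesis by linarith
  qed
  have Gm: "(\<lambda>z. indicator upper_half z *\<^sub>R G z) \<in> borel_measurable borel"
    by (rule borel_measurable_continuous_on_indicator) (use continuous_on_G in auto)
  have Gm2: "(\<lambda>z. indicator B z *\<^sub>R (indicator upper_half z *\<^sub>R (cmod (G z))\<^sup>2)) \<in> borel_measurable borel"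
    if B: "B \<in> sets borel" for B
  proof -
    have "(\<lambda>z. indicator upper_half z *\<^sub>R (cmod (G z))\<^sup>2) = (\<lambda>z. (cmod (indicator upper_half z *\<^sub>R G z))\<^sup>2)"
      by (auto simp: fun_eq_iff split: split_indicator)
    moreover have "(\<lambda>z. (cmod (indicator upper_half z *\<^sub>R G z))\<^sup>2) \<in> borel_measurable borel"
      using measurable_compose[OF Gm, of "\<lambda>w. (cmod w)\<^sup>2" borel] by simp
    ultimately have "(\<lambda>z. indicator upper_half z *\<^sub>R (cmod (G z))\<^sup>2) \<in> borel_measurable borel" by (simp only:)
    then show ?thesis by (rule borel_measurable_scaleR[OF borel_measurable_indicator[OF B]])
  qed
  have ind: "indicator (upper_half \<inter> B) z *\<^sub>R y = indicator B z *\<^sub>R (indicator upper_half z *\<^sub>R y)" for B z and y :: real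
    by (auto split: split_indicator)
  have Gbound: "set_integrable lborel (upper_half \<inter> B) (\<lambda>z. (cmod (G z))\<^sup>2)"
    "(LINT z:upper_half \<inter> B|lborel. (cmod (G z))\<^sup>2) \<le> g * ln (s / (\<kappa> * \<delta>)) + reg_const"
    if s: "\<kappa> * \<delta> \<le> s" and B: "B \<in> sets borel"
      and near: "\<And>z n. z \<in> B \<Longrightarrow> n \<in> {1..N} \<Longrightarrow> cmod (z - of_real (a n)) \<le> R / 2 \<Longrightarrow> cmod (z - of_real (a n)) \<le> s" for B s
  proof -
    have pos: "0 \<le> g * ln (s / (\<kappa> * \<delta>)) + reg_const"
      using s r gN reg_const_nonneg by (intro add_nonneg_nonneg mult_nonneg_nonneg) auto
    have "(\<integral>\<^sup>+z. ennreal ((cmod (G z))\<^sup>2) * indicator (upper_half \<inter> B) z \<partial>lborel)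
       = (\<integral>\<^sup>+z. ennreal ((cmod (G z))\<^sup>2) * indicator B z * indicator upper_half z \<partial>lborel)"
      by (intro nn_integral_cong) (auto split: split_indicator)
    also have "\<dots> \<le> ennreal (g * ln (s / (\<kappa> * \<delta>)) + reg_const)"
      unfolding g_eq by (rule nn_integral_G_square_le[OF s B near])
    finally have le: "(\<integral>\<^sup>+z. ennreal ((cmod (G z))\<^sup>2) * indicator (upper_half \<inter> B) z \<partial>lborel)
       \<le> ennreal (g * ln (s / (\<kappa> * \<delta>)) + reg_const)" .
    note sb = set_integrable_nn_bound[OF _ _ pos le]
    show "set_integrable lborel (upper_half \<inter> B) (\<lambda>z. (cmod (G z))\<^sup>2)"
      by (rule sb(1)) (use Gm2[OF B] in \<open>auto simp only: ind zero_le_power2\<close>)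
    show "(LINT z:upper_half \<inter> B|lborel. (cmod (G z))\<^sup>2) \<le> g * ln (s / (\<kappa> * \<delta>)) + reg_const"
      by (rule sb(2)) (use Gm2[OF B] in \<open>auto simp only: ind zero_le_power2\<close>)
  qed
  have \<kappa>\<delta>1: "\<kappa> * \<delta> \<le> 1" using \<kappa> \<delta> R mult_mono[of \<kappa> 1 \<delta> 1] by auto
  \<comment> \<open>The case of the whole half plane with s = 1, where the logarithm is ln
    (1/\<kappa>) + L.\<close>
  have Z: "set_integrable lborel upper_half (\<lambda>z. (cmod (G z))\<^sup>2)" "Z2 \<le> g * L + C2"
  proof -
    have near: "cmod (z - of_real (a n)) \<le> 1" if "cmod (z - of_real (a n)) \<le> R / 2" for z n
      using that R by linarith
    show "set_integrable lborel upper_half (\<lambda>z. (cmod (G z))\<^sup>2)"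
      using Gbound(1)[OF \<kappa>\<delta>1, of UNIV] near by simp
    have "Z2 \<le> g * ln (1 / (\<kappa> * \<delta>)) + reg_const"
      using Gbound(2)[OF \<kappa>\<delta>1, of UNIV] near by (simp add: Z2_def)
    also have "ln (1 / (\<kappa> * \<delta>)) = ln (1 / \<kappa>) + L"
    proof -
      have "1 / (\<kappa> * \<delta>) = (1 / \<kappa>) * (1 / \<delta>)" by simp
      moreover have "ln ((1 / \<kappa>) * (1 / \<delta>)) = ln (1 / \<kappa>) + ln (1 / \<delta>)" by (rule ln_mult_pos) (use \<kappa> \<delta> in auto)
      ultimately show ?thesis by (simp only: L_def \<delta>_def)
    qed
    finally show "Z2 \<le> g * L + C2" using gC2 by (simp add: distrib_left)
  qed
  have Fm: "(\<lambda>z. indicator upper_half z *\<^sub>R field z) \<in> borel_measurable borel" by (rule field_measurable)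
  note Q = set_integral_norm_diff_square[OF Fm field_L2 Gm Z(1), of k]
  let ?Q = "\<lambda>z. (cmod (field z - k *\<^sub>R G z))\<^sup>2"
  define Q2 where "Q2 = (LINT z:upper_half|lborel. ?Q z)"
  have Q2: "0 \<le> Q2"
    unfolding Q2_def set_lebesgue_integral_def by (rule integral_nonneg_AE) auto
  have Q2_eq: "Q2 = D2 - 2 * (1 / L) * P + (1 / L)\<^sup>2 * Z2"
    using Q(2) by (simp only: Q2_def D2_def P_def Z2_def k_def)
  note balance = energy_balance[OF L X2 Q2 upper P Z(2) Q2_eq]
  let ?\<Omega> = "Omega N \<delta> a"
  define B where "B = (\<Union>n\<in>{1..N}. ball (complex_of_real (a n)) \<delta>)"
  have Bm: "B \<in> sets borel" unfolding B_def by (intro borel_open open_UN) auto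
  have \<Omega>: "?\<Omega> \<subseteq> upper_half" "?\<Omega> \<inter> B = {}" "upper_half = ?\<Omega> \<union> (upper_half \<inter> B)"
    "?\<Omega> \<in> sets borel"
    using Bm by (auto simp: Omega_def B_def)
  have gradu: "grad (U m') z = field z" if "z \<in> ?\<Omega>" for z
    using grad_U that \<Omega>(1) by auto
  \<comment> \<open>Outside the balls of radius \<delta> the cut-off at \<kappa>\<delta> <= \<delta>
    is inactive, so \<open>G\<close> is exactly the gradient of \<open>ustar\<close> there.\<close>
  have gradstar: "grad (ustar \<alpha> N a d) z = G z" if z: "z \<in> ?\<Omega>" for z
  proof (rule grad_eqI)
    have zH: "z \<in> upper_half" using z \<Omega>(1) by auto
    have "G z = (\<Sum>n=1..N. c n *\<^sub>R gub (a n) z)"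
      unfolding G_def
    proof (rule sum.cong[OF refl])
      fix n assume "n \<in> {1..N}"
      then have "\<delta> \<le> cmod (z - of_real (a n))"
        using z by (force simp: Omega_def dist_norm norm_minus_commute)
      moreover have "\<kappa> * \<delta> \<le> 1 * \<delta>" using \<kappa> \<delta> by (intro mult_right_mono) auto
      ultimately show "c n *\<^sub>R D n z = c n *\<^sub>R gub (a n) z" by (subst D_outside) auto
    qed
    then have Gz: "(\<lambda>h. G z \<bullet> h) = (\<lambda>h. \<Sum>n=1..N. c n * (gub (a n) z \<bullet> h))"
      by (simp add: inner_sum_left)
    show "(ustar \<alpha> N a d has_derivative (\<lambda>h. G z \<bullet> h)) (at z)"
      unfolding Gz ustar_def[abs_def] c_def[symmetric]
      by (intro has_derivative_sum has_derivative_mult_right ub_has_derivative abs_a zH)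
  qed
  have "(\<integral>\<^sup>+z. ennreal ((norm (grad (U m') z - grad (ustar \<alpha> N a d) z / of_real L))\<^sup>2) * indicator ?\<Omega> z \<partial>lborel)
     \<le> (\<integral>\<^sup>+z. ennreal (?Q z) * indicator upper_half z \<partial>lborel)"
  proof (rule nn_integral_mono)
    fix z
    have "G z / of_real L = k *\<^sub>R G z" by (simp add: k_def scaleR_conv_of_real divide_inverse)
    then show "ennreal ((norm (grad (U m') z - grad (ustar \<alpha> N a d) z / of_real L))\<^sup>2) * indicator ?\<Omega> z
       \<le> ennreal (?Q z) * indicator upper_half z"
      using gradu[of z] gradstar[of z] \<Omega>(1) by (cases "z \<in> ?\<Omega>") auto
  qed
  also have "\<dots> = ennreal Q2" unfolding Q2_def by (rule nn_integral_eq_set_integral[OF Q(1)]) simp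
  also have "\<dots> \<le> ennreal ((2 * C0 + C2) / L\<^sup>2)" using balance(1) by (rule ennreal_leI)
  finally show "(\<integral>\<^sup>+z. ennreal ((norm (grad (U m') z - grad (ustar \<alpha> N a d) z / of_real L))\<^sup>2)
              * indicator (Omega N (\<epsilon> * ln (1 / \<epsilon>)) a) z \<partial>lborel) \<le> ennreal ((2 * C0 + C2) / L\<^sup>2)"
    unfolding \<delta>_def .
  have sub: "set_integrable lborel S h" if "set_integrable lborel upper_half h" "S \<in> sets borel" "S \<subseteq> upper_half"
    for S and h :: "complex \<Rightarrow> real"
    using that by (intro set_integrable_subset[OF that(1)]) auto
  let ?HB = "upper_half \<inter> B"
  have HBm: "?HB \<in> sets borel" using Bm by auto
  have split: "D2 = (LINT z:?\<Omega>|lborel. (cmod (field z))\<^sup>2) + (LINT z:?HB|lborel. (cmod (field z))\<^sup>2)"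
    unfolding D2_def
    by (subst \<Omega>(3), rule set_integral_Un) (use \<Omega> HBm sub[OF field_L2] in auto)
  \<comment> \<open>The case of the balls with s = \<delta>: the logarithm reduces to ln
    (1/\<kappa>), so the profile has bounded energy there.\<close>
  have GB: "set_integrable lborel ?HB (\<lambda>z. (cmod (G z))\<^sup>2)" "(LINT z:?HB|lborel. (cmod (G z))\<^sup>2) \<le> C2"
  proof -
    have \<kappa>\<delta>: "\<kappa> * \<delta> \<le> \<delta>" using \<kappa> \<delta> mult_right_mono[of \<kappa> 1 \<delta>] by auto
    have near: "cmod (z - of_real (a n)) \<le> \<delta>"
      if z: "z \<in> B" and n: "n \<in> {1..N}" and le: "cmod (z - of_real (a n)) \<le> R / 2" for z n
    proof -
      obtain j where j: "j \<in> {1..N}" "cmod (z - of_real (a j)) < \<delta>"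
        using z by (auto simp: B_def dist_norm norm_minus_commute)
      \<comment> \<open>Otherwise 2 R <= |a n - a j| < \<delta> + R/2 <= 3 R/2.\<close>
      have "j = n"
      proof (rule ccontr)
        assume "j \<noteq> n"
        then have "2 * R \<le> \<bar>a n - a j\<bar>" using separated[OF n j(1)] by auto
        also have "\<dots> = cmod (of_real (a n) - of_real (a j))" by (simp flip: of_real_diff)
        also have "\<dots> \<le> cmod (z - of_real (a j)) + cmod (z - of_real (a n))"
          using norm_triangle_ineq4[of "z - of_real (a j)" "z - of_real (a n)"] by simp
        finally show False using j(2) le \<delta> R by linarith
      qed
      then show ?thesis using j(2) by simp
    qed
    show "set_integrable lborel ?HB (\<lambda>z. (cmod (G z))\<^sup>2)" by (rule Gbound(1)[OF \<kappa>\<delta> Bm near])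
    have "(LINT z:?HB|lborel. (cmod (G z))\<^sup>2) \<le> g * ln (\<delta> / (\<kappa> * \<delta>)) + reg_const"
      by (rule Gbound(2)[OF \<kappa>\<delta> Bm near])
    also have "\<delta> / (\<kappa> * \<delta>) = 1 / \<kappa>" using \<delta> by simp
    finally show "(LINT z:?HB|lborel. (cmod (G z))\<^sup>2) \<le> C2" using gC2 by linarith
  qed
  have QB: "(LINT z:?HB|lborel. ?Q z) \<le> Q2"
    unfolding Q2_def set_lebesgue_integral_def
    by (rule integral_mono) (use Q(1) sub[OF Q(1) HBm] in \<open>auto simp: set_integrable_def split: split_indicator\<close>)
  \<comment> \<open>Comparison with k G, where k = 1/L: the difference has energy at most Q2 and the
    energy of k G in the balls is at most C2 / L^2, so the balls carry only O(1/L^2) of the stray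
    field energy.\<close>
  have "(LINT z:?HB|lborel. (cmod (field z))\<^sup>2) \<le> (LINT z:?HB|lborel. 2 * ?Q z + 2 * k\<^sup>2 * (cmod (G z))\<^sup>2)"
  proof (rule set_integral_mono)
    show "set_integrable lborel ?HB (\<lambda>z. (cmod (field z))\<^sup>2)" using sub[OF field_L2 HBm] by simp
    show "set_integrable lborel ?HB (\<lambda>z. 2 * ?Q z + 2 * k\<^sup>2 * (cmod (G z))\<^sup>2)"
      using sub[OF Q(1) HBm] GB(1) by (intro set_integral_add(1) set_integrable_mult_right) auto
    fix z
    have "cmod (field z) \<le> cmod (field z - k *\<^sub>R G z) + cmod (k *\<^sub>R G z)"
      using norm_triangle_ineq[of "field z - k *\<^sub>R G z" "k *\<^sub>R G z"] by simp
    then have "(cmod (field z))\<^sup>2 \<le> (cmod (field z - k *\<^sub>R G z) + cmod (k *\<^sub>R G z))\<^sup>2" by (intro power_mono) auto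
    also have "\<dots> \<le> 2 * (cmod (field z - k *\<^sub>R G z))\<^sup>2 + 2 * (cmod (k *\<^sub>R G z))\<^sup>2"
      using sum_squares_bound[of "cmod (field z - k *\<^sub>R G z)" "cmod (k *\<^sub>R G z)"] by (simp add: power2_sum)
    finally show "(cmod (field z))\<^sup>2 \<le> 2 * ?Q z + 2 * k\<^sup>2 * (cmod (G z))\<^sup>2" by (simp add: power_mult_distrib)
  qed
  also have "\<dots> = 2 * (LINT z:?HB|lborel. ?Q z) + 2 * k\<^sup>2 * (LINT z:?HB|lborel. (cmod (G z))\<^sup>2)"
    using sub[OF Q(1) HBm] GB(1) by (subst set_integral_add(2)) (auto intro!: set_integrable_mult_right)
  also have "\<dots> \<le> 2 * ((2 * C0 + C2) / L\<^sup>2) + 2 * k\<^sup>2 * C2"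
    using QB balance(1) GB(2) by (intro add_mono mult_left_mono) auto
  also have "\<dots> = (4 * C0 + 4 * C2) / L\<^sup>2"
    by (simp add: k_def power_divide add_divide_distrib)
  finally have FB: "(LINT z:?HB|lborel. (cmod (field z))\<^sup>2) \<le> (4 * C0 + 4 * C2) / L\<^sup>2" .
  have "(6 * C0 + 6 * C2) / L\<^sup>2 = (2 * C0 + 2 * C2) / L\<^sup>2 + (4 * C0 + 4 * C2) / L\<^sup>2"
    by (simp flip: add_divide_distrib)
  then have "g / L - (6 * C0 + 6 * C2) / L\<^sup>2 \<le> (LINT z:?\<Omega>|lborel. (cmod (field z))\<^sup>2)"
    using balance(2) FB split by linarith
  then have "ennreal (g / L - (6 * C0 + 6 * C2) / L\<^sup>2) \<le> ennreal (LINT z:?\<Omega>|lborel. (cmod (field z))\<^sup>2)"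
    by (rule ennreal_leI)
  also have "\<dots> = (\<integral>\<^sup>+z. ennreal ((cmod (field z))\<^sup>2) * indicator ?\<Omega> z \<partial>lborel)"
    by (rule nn_integral_eq_set_integral[symmetric]) (use sub[OF field_L2 \<Omega>(4,1)] in auto)
  also have "\<dots> = (\<integral>\<^sup>+z. ennreal ((norm (grad (U m') z))\<^sup>2) * indicator ?\<Omega> z \<partial>lborel)"
    by (intro nn_integral_cong) (auto simp: gradu split: split_indicator)
  finally show "ennreal (g / L - (6 * C0 + 6 * C2) / L\<^sup>2)
         \<le> (\<integral>\<^sup>+z. ennreal ((norm (grad (U m') z))\<^sup>2) * indicator (Omega N (\<epsilon> * ln (1 / \<epsilon>)) a) z \<partial>lborel)"
    unfolding \<delta>_def .
qed

theorem theorem5p2: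
  fixes \<alpha> :: real and N :: nat
  assumes "0 < \<alpha>" "\<alpha> < pi" "N \<ge> 1"
  shows "\<forall>R C0. 0 < R \<and> R \<le> 1/2 \<and> 0 < C0 \<longrightarrow>
    (\<exists>C1>0. \<forall>a d \<epsilon> m m'.
       a \<in> A_set N \<and> rho N a \<ge> R \<and> (\<forall>n\<in>{1..N}. d n \<in> {-1, 1}) \<and>
       0 < \<epsilon> \<and> \<epsilon> \<le> 1/2 \<and> \<epsilon> * ln (1/\<epsilon>) \<le> R \<and>
       in_M \<alpha> N a d m m' \<and>
       energy \<epsilon> m' \<le> pi * (\<Sum>n=1..N. (d n - cos \<alpha>)\<^sup>2) / (2 * ln (1 / (\<epsilon> * ln (1/\<epsilon>))))
                       + C0 / (ln (1 / (\<epsilon> * ln (1/\<epsilon>))))\<^sup>2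
       \<longrightarrow>
       (let \<delta> = \<epsilon> * ln (1/\<epsilon>); L = ln (1/\<delta>); \<Gamma> = (\<Sum>n=1..N. (d n - cos \<alpha>)\<^sup>2); u = U m' in
         (\<integral>\<^sup>+z. ennreal ((norm (grad u z - grad (ustar \<alpha> N a d) z / of_real L))\<^sup>2)
                 * indicator (Omega N \<delta> a) z \<partial>lborel) \<le> ennreal (C1 / L\<^sup>2) \<and>
         (\<integral>\<^sup>+z. ennreal ((norm (grad u z))\<^sup>2) * indicator (Omega N \<delta> a) z \<partial>lborel)
                 \<ge> ennreal (pi * \<Gamma> / L - C1 / L\<^sup>2)))"
proof (intro allI impI)
  fix R C0 :: real
  assume R: "0 < R \<and> R \<le> 1 / 2 \<and> 0 < C0"
  define \<kappa> where "\<kappa> = min (1 / 2) (step_mass / (32 * pi * real N))"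
  \<comment> \<open>The absolute value is taken because nonnegativity of \<open>reg_const\<close> is
    proved inside the locale, for an actual profile, and none is fixed at this point.\<close>
  define C2 where "C2 = 4 * pi * real N * ln (1 / \<kappa>) + \<bar>wall_profile.reg_const N R\<bar>"
  have "0 < \<kappa>" "\<kappa> \<le> 1 / 2" using step_mass_pos assms(3) by (auto simp: \<kappa>_def)
  then have C2: "0 \<le> C2" unfolding C2_def by (intro add_nonneg_nonneg mult_nonneg_nonneg) auto
  \<comment> \<open>Dominates the constants of both estimates; 6 = 2 + 4 collects the loss in the
    energy balance and the energy of the removed balls.\<close>
  let ?C1 = "6 * C0 + 6 * C2 + 1"
  show "\<exists>C1>0. \<forall>a d \<epsilon> m m'.
       a \<in> A_set N \<and> rho N a \<ge> R \<and> (\<forall>n\<in>{1..N}. d n \<in> {-1, 1}) \<and>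
       0 < \<epsilon> \<and> \<epsilon> \<le> 1/2 \<and> \<epsilon> * ln (1/\<epsilon>) \<le> R \<and>
       in_M \<alpha> N a d m m' \<and>
       energy \<epsilon> m' \<le> pi * (\<Sum>n=1..N. (d n - cos \<alpha>)\<^sup>2) / (2 * ln (1 / (\<epsilon> * ln (1/\<epsilon>))))
                       + C0 / (ln (1 / (\<epsilon> * ln (1/\<epsilon>))))\<^sup>2
       \<longrightarrow>
       (let \<delta> = \<epsilon> * ln (1/\<epsilon>); L = ln (1/\<delta>); \<Gamma> = (\<Sum>n=1..N. (d n - cos \<alpha>)\<^sup>2); u = U m' in
         (\<integral>\<^sup>+z. ennreal ((norm (grad u z - grad (ustar \<alpha> N a d) z / of_real L))\<^sup>2)
                 * indicator (Omega N \<delta> a) z \<partial>lborel) \<le> ennreal (C1 / L\<^sup>2) \<and>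
         (\<integral>\<^sup>+z. ennreal ((norm (grad u z))\<^sup>2) * indicator (Omega N \<delta> a) z \<partial>lborel)
                 \<ge> ennreal (pi * \<Gamma> / L - C1 / L\<^sup>2))"
  proof (intro exI[of _ ?C1] conjI allI impI)
    show "0 < ?C1" using R C2 by simp
    fix a d :: "nat \<Rightarrow> real" and \<epsilon> :: real and m m' :: "real \<Rightarrow> complex"
    define L where "L = ln (1 / (\<epsilon> * ln (1 / \<epsilon>)))"
    define g where "g = pi * (\<Sum>n=1..N. (d n - cos \<alpha>)\<^sup>2)"
    assume H: "a \<in> A_set N \<and> rho N a \<ge> R \<and> (\<forall>n\<in>{1..N}. d n \<in> {-1, 1}) \<and>
       0 < \<epsilon> \<and> \<epsilon> \<le> 1/2 \<and> \<epsilon> * ln (1/\<epsilon>) \<le> R \<and>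
       in_M \<alpha> N a d m m' \<and>
       energy \<epsilon> m' \<le> pi * (\<Sum>n=1..N. (d n - cos \<alpha>)\<^sup>2) / (2 * ln (1 / (\<epsilon> * ln (1/\<epsilon>))))
                       + C0 / (ln (1 / (\<epsilon> * ln (1/\<epsilon>))))\<^sup>2"
    then have en: "energy \<epsilon> m' \<le> g / (2 * L) + C0 / L\<^sup>2" by (simp add: g_def L_def)
    note est = wall_estimate[OF assms(3), of R C0 a d \<epsilon> \<alpha> m m' L g, folded \<kappa>_def, folded C2_def]
    have 1: "(\<integral>\<^sup>+z. ennreal ((norm (grad (U m') z - grad (ustar \<alpha> N a d) z / of_real L))\<^sup>2)
        * indicator (Omega N (\<epsilon> * ln (1 / \<epsilon>)) a) z \<partial>lborel) \<le> ennreal ((2 * C0 + C2) / L\<^sup>2)"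
      by (rule est(1)) (use H R en L_def g_def in blast)+
    have 2: "ennreal (g / L - (6 * C0 + 6 * C2) / L\<^sup>2)
        \<le> (\<integral>\<^sup>+z. ennreal ((norm (grad (U m') z))\<^sup>2) * indicator (Omega N (\<epsilon> * ln (1 / \<epsilon>)) a) z \<partial>lborel)"
      by (rule est(2)) (use H R en L_def g_def in blast)+
    have "(2 * C0 + C2) / L\<^sup>2 \<le> ?C1 / L\<^sup>2" "(6 * C0 + 6 * C2) / L\<^sup>2 \<le> ?C1 / L\<^sup>2"
      using R C2 by (auto intro!: divide_right_mono)
    then have "ennreal ((2 * C0 + C2) / L\<^sup>2) \<le> ennreal (?C1 / L\<^sup>2)"
      "ennreal (g / L - ?C1 / L\<^sup>2) \<le> ennreal (g / L - (6 * C0 + 6 * C2) / L\<^sup>2)"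
      by (auto intro!: ennreal_leI)
    with 1 2 show "let \<delta> = \<epsilon> * ln (1/\<epsilon>); L = ln (1/\<delta>); \<Gamma> = (\<Sum>n=1..N. (d n - cos \<alpha>)\<^sup>2); u = U m' in
         (\<integral>\<^sup>+z. ennreal ((norm (grad u z - grad (ustar \<alpha> N a d) z / of_real L))\<^sup>2)
                 * indicator (Omega N \<delta> a) z \<partial>lborel) \<le> ennreal (?C1 / L\<^sup>2) \<and>
         (\<integral>\<^sup>+z. ennreal ((norm (grad u z))\<^sup>2) * indicator (Omega N \<delta> a) z \<partial>lborel)
                 \<ge> ennreal (pi * \<Gamma> / L - ?C1 / L\<^sup>2)"
      unfolding Let_def L_def[symmetric] g_def[symmetric] by (auto intro: order_trans)
  qed
qed

end
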